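(* Let $L_K(E)$ be the Leavitt path algebra associated to a graph $E$. Then, for $n\ge1$, $P_l^{(n+1)}(E)$ is the saturated closure (the smallest saturated subset of $E^0$ containing it) of the set $$\{v\in E^0 \;\vert\; T_E(v)\text{ is acyclic and for all } w\in T_E(v),\ r_E(s_E^{-1}(w))\subseteq^1 P_l^{(n)}(E)\},$$ where, for two sets of vertices $X,Y\subseteq E^0$, $X\subseteq^1 Y$ means that all the vertices of $X$ are contained in $Y$ except at most one.
   Context: Graphs are directed graphs $E=(E^0,E^1,r,s)$ (also written $r_E,s_E$), assumed row-finite ($s^{-1}(v)$ finite for all $v$). $K$ is a field. $L_K(E)$ is the Leavitt path algebra: the $K$-algebra generated by $E^0\cup E^1\cup\{e^*: e\in E^1\}$ with relations $vw=\delta_{v,w}v$, $s(e)e=e=e\,r(e)$, $r(e)e^*=e^*=e^*s(e)$, $e^*f=\delta_{e,f}r(e)$, and $v=\sum_{s(e)=v}ee^*$ for each regular vertex $v$ ($0<|s^{-1}(v)|<\infty$). $I(X)$ is the two-sided ideal of $L_K(E)$ generated by $X\subseteq E^0$. $u\ge v$ means there is a path (possibly of length $0$) from $u$ to $v$. $T_E(v)=\{w\in E^0: v\ge w\}$; it is acyclic if no vertex of it lies on a cycle of $E$. The set $r_E(s_E^{-1}(w))\subseteq E^0$ is the set of ranges of the edges with source $w$. A set $X\subseteq E^0$ is hereditary if $v\in X$, $v\ge w$ imply $w\in X$; it is saturated if every regular vertex $v$ with $r(s^{-1}(v))\subseteq X$ lies in $X$. For an algebra $A$, the socle series is $\mathrm{Soc}^{(1)}(A)=\mathrm{Soc}(A)$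 and $\mathrm{Soc}^{(n+1)}(A)/\mathrm{Soc}^{(n)}(A)=\mathrm{Soc}\big(A/\mathrm{Soc}^{(n)}(A)\big)$. For $A=L_K(E)$ each $\mathrm{Soc}^{(n)}(A)$ is a graded ideal (known), hence equals $I(P_l^{(n)}(E))$ for a unique hereditary and saturated set $P_l^{(n)}(E)\subseteq E^0$, namely $P_l^{(n)}(E)=E^0\cap\mathrm{Soc}^{(n)}(L_K(E))$. $P_l^{(1)}(E)$ is the hereditary and saturated closure of the set of line points of $E$ (vertices $v$ such that no vertex of $T_E(v)$ emits two or more edges or lies on a cycle).
   Formalization: Here X ⊆¹ Y counts edges: at most one edge leaving w has its range outside P_l^(n). With r(s⁻¹(w)) as a plain set the claim fails for v_0, v_1, … with exactly two edges v_i → v_{i+1}: all P_l^(n) are empty, but the displayed set is E^0. Without parallel edges both agree. *)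

theory Defs
  imports
    "HOL-Algebra.QuotRing"
    "HOL-Algebra.Module"
    "HOL-Library.Poly_Mapping"
    "HOL-Library.Multiset"
    "Graph_Theory.Arc_Walk"
begin

section \<open>Not necessarily unital algebras over a field\<close>

text \<open>
  Algebras are HOL-Algebra \<^type>\<open>module\<close> records whose scalars form a type \<open>'k\<close> of class \<open>field\<close>.
  Leavitt path algebras of graphs with infinitely many vertices have no unit, so the field \<open>one\<close>
  of the record carries no meaning and is never used; for the same reason the HOL-Algebra locales
  for rings and ideals, which demand a unit, do not apply.
\<close>

definition alg_subspace :: "('k::field, 'a) module \<Rightarrow> 'a set \<Rightarrow> bool" where
  "alg_subspace A V \<longleftrightarrow> V \<subseteq> carrier A \<and> \<zero>\<^bsub>A\<^esub> \<in> V \<and>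
     (\<forall>x\<in>V. \<forall>y\<in>V. x \<oplus>\<^bsub>A\<^esub> y \<in> V) \<and> (\<forall>c. \<forall>x\<in>V. c \<odot>\<^bsub>A\<^esub> x \<in> V)"

definition alg_left_ideal :: "('k::field, 'a) module \<Rightarrow> 'a set \<Rightarrow> bool" where
  "alg_left_ideal A I \<longleftrightarrow> alg_subspace A I \<and> (\<forall>a\<in>carrier A. \<forall>x\<in>I. a \<otimes>\<^bsub>A\<^esub> x \<in> I)"

definition alg_ideal :: "('k::field, 'a) module \<Rightarrow> 'a set \<Rightarrow> bool" where
  "alg_ideal A I \<longleftrightarrow> alg_left_ideal A I \<and> (\<forall>a\<in>carrier A. \<forall>x\<in>I. x \<otimes>\<^bsub>A\<^esub> a \<in> I)"

definition alg_ideal_generated :: "('k::field, 'a) module \<Rightarrow> 'a set \<Rightarrow> 'a set" where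
  "alg_ideal_generated A X = \<Inter>{I. alg_ideal A I \<and> X \<subseteq> I}"

text \<open>The quotient is HOL-Algebra's \<open>A Quot I\<close> equipped with the induced scalar multiplication.\<close>

definition alg_quotient :: "('k::field, 'a) module \<Rightarrow> 'a set \<Rightarrow> ('k, 'a set) module" where
  "alg_quotient A I =
     ring.extend (A Quot I) (module.fields (\<lambda>c X. \<Union>x\<in>X. I +>\<^bsub>A\<^esub> (c \<odot>\<^bsub>A\<^esub> x)))"

definition minimal_left_ideal :: "('k::field, 'a) module \<Rightarrow> 'a set \<Rightarrow> bool" where
  "minimal_left_ideal A M \<longleftrightarrow> alg_left_ideal A M \<and> M \<noteq> {\<zero>\<^bsub>A\<^esub>} \<and>
     (\<forall>I. alg_left_ideal A I \<and> I \<subseteq> M \<longrightarrow> I = {\<zero>\<^bsub>A\<^esub>} \<or> I = M)"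

text \<open>
  The sum of all minimal left ideals, i.e. the smallest left ideal containing them; it is zero if
  there are none. Leavitt path algebras and their quotients by graded ideals are semiprime, so the
  right socle is the same.
\<close>

definition Soc :: "('k::field, 'a) module \<Rightarrow> 'a set" where
  "Soc A = \<Inter>{I. alg_left_ideal A I \<and> (\<forall>M. minimal_left_ideal A M \<longrightarrow> M \<subseteq> I)}"

text \<open>The series starts at index 1; the value at index 0 is the usual convention.\<close>

primrec Soc_series :: "('k::field, 'a) module \<Rightarrow> nat \<Rightarrow> 'a set" where
  "Soc_series A 0 = {\<zero>\<^bsub>A\<^esub>}"
| "Soc_series A (Suc n) =
     (if n = 0 then Soc A
      else {x \<in> carrier A. Soc_series A n +>\<^bsub>A\<^esub> x \<in> Soc (alg_quotient A (Soc_series A n))})"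

section \<open>Leavitt path algebras\<close>

text \<open>
  With words as an additive monoid under concatenation, \<open>'x list \<Rightarrow>\<^sub>0 'k\<close> becomes the free unital
  \<open>'k\<close>-algebra on \<open>'x\<close>, with convolution as multiplication.
\<close>

instantiation list :: (type) monoid_add
begin

definition zero_list :: "'a list" where "zero_list = []"
definition plus_list :: "'a list \<Rightarrow> 'a list \<Rightarrow> 'a list" where "plus_list = (@)"

instance by standard (simp_all add: zero_list_def plus_list_def)

end

text \<open>The free non-unital algebra on \<open>X\<close>: combinations of nonempty words in \<open>X\<close>.\<close>

definition free_algebra :: "'x set \<Rightarrow> ('k::field, 'x list \<Rightarrow>\<^sub>0 'k) module" where
  "free_algebra X =
     \<lparr>carrier = {f. Poly_Mapping.keys f \<subseteq> lists X - {[]}}, monoid.mult = (*), one = 1, zero = 0, add = (+),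
      smult = (\<lambda>c. Poly_Mapping.map ((*) c))\<rparr>"

definition gen :: "'x \<Rightarrow> ('x list \<Rightarrow>\<^sub>0 'k::field)" where
  "gen x = Poly_Mapping.single [x] 1"

datatype ('v, 'e) lpa_gen = Vertex 'v | Edge 'e | Ghost 'e

text \<open>Directed graphs are those of the theory Digraph: \<open>tail E\<close> is \<open>s\<close> and \<open>head E\<close> is \<open>r\<close>.\<close>

definition regular_vertex :: "('v, 'e) pre_digraph \<Rightarrow> 'v \<Rightarrow> bool" where
  "regular_vertex E v \<longleftrightarrow> v \<in> verts E \<and> out_arcs E v \<noteq> {} \<and> finite (out_arcs E v)"

definition row_finite :: "('v, 'e) pre_digraph \<Rightarrow> bool" where
  "row_finite E \<longleftrightarrow> (\<forall>v\<in>verts E. finite (out_arcs E v))"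

definition lpa_free :: "('v, 'e) pre_digraph \<Rightarrow> ('k::field, ('v, 'e) lpa_gen list \<Rightarrow>\<^sub>0 'k) module" where
  "lpa_free E = free_algebra (Vertex ` verts E \<union> Edge ` arcs E \<union> Ghost ` arcs E)"

text \<open>Each defining relation \<open>a = b\<close> is recorded as the element \<open>a - b\<close>.\<close>

definition lpa_relations :: "('v, 'e) pre_digraph \<Rightarrow> (('v, 'e) lpa_gen list \<Rightarrow>\<^sub>0 'k::field) set" where
  "lpa_relations E =
     {gen (Vertex v) * gen (Vertex w) - (if v = w then gen (Vertex v) else 0) |v w.
        v \<in> verts E \<and> w \<in> verts E} \<union>
     {gen (Vertex (tail E e)) * gen (Edge e) - gen (Edge e) |e. e \<in> arcs E} \<union>
     {gen (Edge e) * gen (Vertex (head E e)) - gen (Edge e) |e. e \<in> arcs E} \<union>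
     {gen (Vertex (head E e)) * gen (Ghost e) - gen (Ghost e) |e. e \<in> arcs E} \<union>
     {gen (Ghost e) * gen (Vertex (tail E e)) - gen (Ghost e) |e. e \<in> arcs E} \<union>
     {gen (Ghost e) * gen (Edge f) - (if e = f then gen (Vertex (head E e)) else 0) |e f.
        e \<in> arcs E \<and> f \<in> arcs E} \<union>
     {gen (Vertex v) - (\<Sum>e\<in>out_arcs E v. gen (Edge e) * gen (Ghost e)) |v. regular_vertex E v}"

definition lpa_ideal :: "('v, 'e) pre_digraph \<Rightarrow> (('v, 'e) lpa_gen list \<Rightarrow>\<^sub>0 'k::field) set" where
  "lpa_ideal E = alg_ideal_generated (lpa_free E) (lpa_relations E)"

definition leavitt_path_algebra ::
  "('v, 'e) pre_digraph \<Rightarrow> ('k::field, (('v, 'e) lpa_gen list \<Rightarrow>\<^sub>0 'k) set) module" where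
  "leavitt_path_algebra E = alg_quotient (lpa_free E) (lpa_ideal E)"

definition lpa_vertex :: "('v, 'e) pre_digraph \<Rightarrow> 'v \<Rightarrow> (('v, 'e) lpa_gen list \<Rightarrow>\<^sub>0 'k::field) set" where
  "lpa_vertex E v = lpa_ideal E +>\<^bsub>lpa_free E\<^esub> gen (Vertex v)"

text \<open>
  \<open>P_l TYPE('k) E n\<close> is the set of vertices lying in the \<open>n\<close>-th socle of the Leavitt path algebra
  of \<open>E\<close> over the field \<open>'k\<close>.
\<close>

definition P_l :: "'k::field itself \<Rightarrow> ('v, 'e) pre_digraph \<Rightarrow> nat \<Rightarrow> 'v set" where
  "P_l K E n = {v \<in> verts E.
     lpa_vertex E v \<in> Soc_series (leavitt_path_algebra E :: ('k, _) module) n}"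

section \<open>Trees, saturation and inclusion up to one vertex\<close>

definition tree_of :: "('v, 'e) pre_digraph \<Rightarrow> 'v \<Rightarrow> 'v set" where
  "tree_of E v = {w. v \<rightarrow>\<^sup>*\<^bsub>E\<^esub> w}"

text \<open>The library's cycles include loops and pairs of opposite arcs.\<close>

definition on_cycle :: "('v, 'e) pre_digraph \<Rightarrow> 'v \<Rightarrow> bool" where
  "on_cycle E w \<longleftrightarrow>
     (\<exists>u p. pre_digraph.cycle E p \<and> pre_digraph.awalk E u p u \<and> w \<in> set (pre_digraph.awalk_verts E u p))"

definition acyclic_tree :: "('v, 'e) pre_digraph \<Rightarrow> 'v \<Rightarrow> bool" where
  "acyclic_tree E v \<longleftrightarrow> (\<forall>w\<in>tree_of E v. \<not> on_cycle E w)"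

definition saturated :: "('v, 'e) pre_digraph \<Rightarrow> 'v set \<Rightarrow> bool" where
  "saturated E X \<longleftrightarrow> X \<subseteq> verts E \<and>
     (\<forall>v. regular_vertex E v \<and> head E ` out_arcs E v \<subseteq> X \<longrightarrow> v \<in> X)"

definition saturated_closure :: "('v, 'e) pre_digraph \<Rightarrow> 'v set \<Rightarrow> 'v set" where
  "saturated_closure E X = \<Inter>{Y. saturated E Y \<and> X \<subseteq> Y}"

text \<open>
  The ranges of the edges leaving \<open>w\<close>, one entry per edge. Multiplicities matter: in the graph with
  vertices \<open>v\<^sub>0, v\<^sub>1, \<dots>\<close> and exactly two edges from each \<open>v\<^sub>i\<close> to \<open>v\<^sub>i\<^sub>+\<^sub>1\<close> there are no line points, so
  every \<open>P_l\<close> is empty, but as a plain set the ranges of the edges leaving \<open>v\<^sub>i\<close> form a singleton.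
\<close>

definition ranges :: "('v, 'e) pre_digraph \<Rightarrow> 'v \<Rightarrow> 'v multiset" where
  "ranges E w = image_mset (head E) (mset_set (out_arcs E w))"

definition subseteq1 :: "'v multiset \<Rightarrow> 'v set \<Rightarrow> bool" (infix \<open>\<subseteq>\<^sup>1\<close> 50) where
  "X \<subseteq>\<^sup>1 Y \<longleftrightarrow> size (filter_mset (\<lambda>x. x \<notin> Y) X) \<le> 1"

text \<open>Where no two edges leaving \<open>w\<close> share their range, this is the relation between plain sets.\<close>

lemma ranges_subseteq1_iff_set:
  assumes "finite (out_arcs E w)" "inj_on (head E) (out_arcs E w)"
  shows "ranges E w \<subseteq>\<^sup>1 Y \<longleftrightarrow> card (head E ` out_arcs E w - Y) \<le> 1"
proof -
  have "ranges E w = mset_set (head E ` out_arcs E w)"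
    using assms by (simp add: ranges_def image_mset_mset_set)
  moreover have "{x \<in> head E ` out_arcs E w. x \<notin> Y} = head E ` out_arcs E w - Y"
    by auto
  ultimately show ?thesis
    using assms(1) by (simp add: subseteq1_def filter_mset_mset_set)
qed

lemma ranges_subseteq1_iff_arcs:
  assumes "finite (out_arcs E w)"
  shows "ranges E w \<subseteq>\<^sup>1 Y \<longleftrightarrow> card {e \<in> out_arcs E w. head E e \<notin> Y} \<le> 1"
  using assms
  by (simp add: ranges_def subseteq1_def filter_mset_image_mset filter_mset_mset_set)

end

theory Submission
  imports Defs "HOL-Library.Countable_Set"
begin

text \<open>
  All ideals are pulled back to the free algebra, where the socle of a quotient by an ideal \<open>J\<close> becomes
  the smallest left ideal that contains \<open>J\<close> and every left ideal that is minimal over \<open>J\<close>. Suppose that \<open>J\<close> is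
  graded and contains the Leavitt relations, and let \<open>H\<close> be the set of vertices in \<open>J\<close>. Multiplying an
  element outside \<open>J\<close> by a suitable path on the right and a ghost path on the left gives \<open>c w + \<Sum> k\<^sub>i q\<^sub>i\<close> modulo \<open>J\<close>,
  with a vertex \<open>w\<close> outside \<open>H\<close>, \<open>c \<noteq> 0\<close> and nontrivial closed paths \<open>q\<^sub>i\<close> at \<open>w\<close>. If \<open>v\<close> emits, along its whole tree,
  at most one edge with range outside \<open>H\<close> and its tree is acyclic, the sum is empty and \<open>v\<close> generates a
  minimal left ideal. Conversely, in a minimal left ideal the lowest degree term \<open>c w\<close> can be cancelled,
  which shows that \<open>w\<close> itself generates a minimal left ideal; this forces \<open>w\<close> to be such a vertex.
  So the next socle is generated by these vertices, and the vertices in it are their saturated closure,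
  because the quotient by a hereditary and saturated set has a representation in which no other
  vertex acts as zero.
\<close>

section \<open>Ideals and socles in free algebras\<close>

text \<open>An element of a factor of the socle series is a coset of cosets of noncommutative
  polynomials. After the pull-back all ideals are subsets of one algebra, and cosets give way to
  congruences between polynomials that can be multiplied directly.

  Minimality of a left ideal speaks of multiplication on the left, but the reduction to
  \<open>c w + \<Sum> k\<^sub>i q\<^sub>i\<close> also multiplies on the right and thereby leaves
  the left ideal. The grading bridges the gap: the closed paths have positive degree, so this
  element, though hardly ever invertible, can be cancelled as a right factor modulo
  \<open>J\<close>.

  The theorem asks for acyclicity in the whole graph, whereas a left ideal minimal over
  \<open>J\<close> sees only the vertices outside \<open>H\<close>. Cycles inside \<open>H\<close>
  have to be excluded by other means: the induction carries along that every vertex of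
  \<open>P_l\<close> has an acyclic tree, a property that survives saturated closure. The recursion
  is anchored at index 0, where \<open>P_l\<close> is empty and the set of the theorem is that of
  the line points.\<close>

lemma poly_mapping_sum_singles:
  "(f :: 'a \<Rightarrow>\<^sub>0 'b::comm_monoid_add) = (\<Sum>w\<in>Poly_Mapping.keys f. Poly_Mapping.single w (Poly_Mapping.lookup f w))"
  by (rule poly_mapping_eqI) (simp add: lookup_sum lookup_single when_def in_keys_iff)

text \<open>Scalars become multiples of the empty word, so scalar multiplication turns into
  multiplication of polynomials. For \<open>c \<noteq> 0\<close> the element \<open>scal c\<close>
  lies outside \<open>FA X\<close>, which is why closure under scalars is a separate condition on
  ideals.\<close>

definition scal :: "'k::field \<Rightarrow> ('x list \<Rightarrow>\<^sub>0 'k)" where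
  "scal c = Poly_Mapping.single 0 c"

lemma scal_0 [simp]: "scal 0 = 0" and scal_1 [simp]: "scal 1 = 1"
  and scal_minus_1: "scal (- 1) = - 1"
  by (simp_all add: scal_def single_uminus)

lemma scal_mult: "scal c * scal d = scal (c * d)" and scal_add: "scal c + scal d = scal (c + d)"
  by (simp_all add: scal_def mult_single single_add)

lemma scal_sum: "scal (sum f A) = (\<Sum>i\<in>A. scal (f i))"
  by (induction A rule: infinite_finite_induct) (simp_all flip: scal_add)

lemma scal_mult_single: "scal c * Poly_Mapping.single w d = Poly_Mapping.single w (c * d)"
  by (simp add: scal_def mult_single)

lemma single_mult_scal: "Poly_Mapping.single w d * scal c = Poly_Mapping.single w (d * c)"
  by (simp add: scal_def mult_single)

lemma mult_scal: "x * scal c = scal c * x"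
proof -
  have "x * scal c = (\<Sum>w\<in>Poly_Mapping.keys x. Poly_Mapping.single w (Poly_Mapping.lookup x w) * scal c)"
    by (subst (1) poly_mapping_sum_singles[of x]) (rule sum_distrib_right)
  also have "\<dots> = (\<Sum>w\<in>Poly_Mapping.keys x. scal c * Poly_Mapping.single w (Poly_Mapping.lookup x w))"
    by (simp add: scal_mult_single single_mult_scal mult.commute)
  also have "\<dots> = scal c * x"
    by (subst (3) poly_mapping_sum_singles[of x]) (rule sum_distrib_left[symmetric])
  finally show ?thesis .
qed

lemma mult_scal_left: "x * (scal c * y) = scal c * (x * y)"
  by (metis mult.assoc mult_scal)

definition FA :: "'x set \<Rightarrow> ('x list \<Rightarrow>\<^sub>0 'k::field) set" where
  "FA X = {f. Poly_Mapping.keys f \<subseteq> lists X - {[]}}"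

lemma FA_0 [simp, intro]: "0 \<in> FA X"
  by (simp add: FA_def)

lemma FA_add [simp, intro]: "x \<in> FA X \<Longrightarrow> y \<in> FA X \<Longrightarrow> x + y \<in> FA X"
  using keys_add[of x y] by (auto simp: FA_def)

lemma FA_mult [simp, intro]: "x \<in> FA X \<Longrightarrow> y \<in> FA X \<Longrightarrow> x * y \<in> FA X"
  using keys_mult[of x y] by (fastforce simp: FA_def plus_list_def)

lemma FA_scal [simp, intro]: "x \<in> FA X \<Longrightarrow> scal c * x \<in> FA X"
  using keys_mult[of "scal c" x] by (fastforce simp: FA_def scal_def zero_list_def plus_list_def split: if_splits)

lemma FA_uminus [simp, intro]: "x \<in> FA X \<Longrightarrow> - x \<in> FA X"
  using FA_scal[of x X "- 1"] by (simp add: scal_minus_1)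

lemma FA_diff [simp, intro]: "x \<in> FA X \<Longrightarrow> y \<in> FA X \<Longrightarrow> x - y \<in> FA X"
  using FA_add[of x X "- y"] by simp

lemma FA_sum [intro]: "(\<And>i. i \<in> A \<Longrightarrow> f i \<in> FA X) \<Longrightarrow> sum f A \<in> FA X"
  by (induction A rule: infinite_finite_induct) auto

lemma FA_gen [simp, intro]: "x \<in> X \<Longrightarrow> gen x \<in> FA X"
  by (auto simp: FA_def gen_def)

lemma FA_single: "w \<in> lists X \<Longrightarrow> w \<noteq> [] \<Longrightarrow> Poly_Mapping.single w c \<in> FA X"
  by (auto simp: FA_def)

abbreviation fa_left_ideal :: "'x set \<Rightarrow> ('x list \<Rightarrow>\<^sub>0 'k::field) set \<Rightarrow> bool" where
  "fa_left_ideal X \<equiv> alg_left_ideal (free_algebra X)"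

abbreviation fa_ideal :: "'x set \<Rightarrow> ('x list \<Rightarrow>\<^sub>0 'k::field) set \<Rightarrow> bool" where
  "fa_ideal X \<equiv> alg_ideal (free_algebra X)"

lemma fa_left_ideal_iff:
  "fa_left_ideal X J \<longleftrightarrow> J \<subseteq> FA X \<and> 0 \<in> J \<and> (\<forall>x\<in>J. \<forall>y\<in>J. x + y \<in> J) \<and>
     (\<forall>c. \<forall>x\<in>J. scal c * x \<in> J) \<and> (\<forall>a\<in>FA X. \<forall>x\<in>J. a * x \<in> J)"
  by (auto simp: alg_left_ideal_def alg_subspace_def free_algebra_def FA_def mult_map_scale_conv_mult scal_def)

lemma fa_ideal_iff:
  "fa_ideal X J \<longleftrightarrow> fa_left_ideal X J \<and> (\<forall>a\<in>FA X. \<forall>x\<in>J. x * a \<in> J)"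
  by (auto simp: alg_ideal_def free_algebra_def FA_def)

lemma fa_left_ideal_closed:
  assumes "fa_left_ideal X J"
  shows "x \<in> J \<Longrightarrow> x \<in> FA X" "0 \<in> J" "x \<in> J \<Longrightarrow> y \<in> J \<Longrightarrow> x + y \<in> J" "x \<in> J \<Longrightarrow> scal c * x \<in> J"
    "a \<in> FA X \<Longrightarrow> x \<in> J \<Longrightarrow> a * x \<in> J" "x \<in> J \<Longrightarrow> - x \<in> J" "x \<in> J \<Longrightarrow> y \<in> J \<Longrightarrow> x - y \<in> J"
proof -
  show *: "x \<in> J \<Longrightarrow> x \<in> FA X" "0 \<in> J" "x \<in> J \<Longrightarrow> y \<in> J \<Longrightarrow> x + y \<in> J" "x \<in> J \<Longrightarrow> scal c * x \<in> J"
    "a \<in> FA X \<Longrightarrow> x \<in> J \<Longrightarrow> a * x \<in> J" for x y c a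
    using assms unfolding fa_left_ideal_iff by auto
  show **: "x \<in> J \<Longrightarrow> - x \<in> J" for x
    using *(4)[of x "- 1"] by (simp add: scal_minus_1)
  show "x \<in> J \<Longrightarrow> y \<in> J \<Longrightarrow> x - y \<in> J"
    using *(3)[of x "- y"] **[of y] by simp
qed

lemma fa_ideal_closed:
  assumes "fa_ideal X J"
  shows "x \<in> J \<Longrightarrow> x \<in> FA X" "0 \<in> J" "x \<in> J \<Longrightarrow> y \<in> J \<Longrightarrow> x + y \<in> J" "x \<in> J \<Longrightarrow> scal c * x \<in> J"
    "a \<in> FA X \<Longrightarrow> x \<in> J \<Longrightarrow> a * x \<in> J" "x \<in> J \<Longrightarrow> - x \<in> J" "x \<in> J \<Longrightarrow> y \<in> J \<Longrightarrow> x - y \<in> J"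
    "a \<in> FA X \<Longrightarrow> x \<in> J \<Longrightarrow> x * a \<in> J"
proof -
  have l: "fa_left_ideal X J" and r: "\<forall>a\<in>FA X. \<forall>x\<in>J. x * a \<in> J"
    using assms by (simp_all add: fa_ideal_iff)
  note c = fa_left_ideal_closed[OF l]
  show "x \<in> J \<Longrightarrow> x \<in> FA X" "0 \<in> J" "x \<in> J \<Longrightarrow> y \<in> J \<Longrightarrow> x + y \<in> J" "x \<in> J \<Longrightarrow> scal c * x \<in> J"
    "a \<in> FA X \<Longrightarrow> x \<in> J \<Longrightarrow> a * x \<in> J" "x \<in> J \<Longrightarrow> - x \<in> J" "x \<in> J \<Longrightarrow> y \<in> J \<Longrightarrow> x - y \<in> J"
    by (fact c)+
  show "a \<in> FA X \<Longrightarrow> x \<in> J \<Longrightarrow> x * a \<in> J"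
    using r by blast
qed

lemma fa_left_ideal_sum:
  assumes "fa_left_ideal X J" "\<And>i. i \<in> A \<Longrightarrow> f i \<in> J"
  shows "sum f A \<in> J"
  using assms(2) by (induction A rule: infinite_finite_induct) (auto intro: fa_left_ideal_closed[OF assms(1)])

lemma fa_left_ideal_Inter:
  assumes "S \<noteq> {}" "\<And>I. I \<in> S \<Longrightarrow> fa_left_ideal X I"
  shows "fa_left_ideal X (\<Inter>S)"
proof -
  obtain I0 where "I0 \<in> S" using assms(1) by blast
  then have "\<Inter>S \<subseteq> FA X" using assms(2)[of I0] by (auto simp: fa_left_ideal_iff)
  then show ?thesis
    unfolding fa_left_ideal_iff using fa_left_ideal_closed(2-5)[OF assms(2)] by simp
qed

lemma fa_ideal_Inter:
  assumes "S \<noteq> {}" "\<And>I. I \<in> S \<Longrightarrow> fa_ideal X I"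
  shows "fa_ideal X (\<Inter>S)"
  unfolding fa_ideal_iff
  using fa_left_ideal_Inter[of S X] fa_ideal_closed(8)[OF assms(2)] assms by (simp add: fa_ideal_iff)

lemma fa_ideal_FA: "fa_ideal X (FA X)"
  by (simp add: fa_ideal_iff fa_left_ideal_iff)

section \<open>Socles relative to an ideal and the correspondence of left ideals\<close>

definition rel_minimal :: "'x set \<Rightarrow> ('x list \<Rightarrow>\<^sub>0 'k::field) set \<Rightarrow> ('x list \<Rightarrow>\<^sub>0 'k) set \<Rightarrow> bool" where
  "rel_minimal X J M \<longleftrightarrow> fa_left_ideal X M \<and> J \<subseteq> M \<and> M \<noteq> J \<and>
     (\<forall>I. fa_left_ideal X I \<and> J \<subseteq> I \<and> I \<subseteq> M \<longrightarrow> I = J \<or> I = M)"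

definition rel_soc :: "'x set \<Rightarrow> ('x list \<Rightarrow>\<^sub>0 'k::field) set \<Rightarrow> ('x list \<Rightarrow>\<^sub>0 'k) set" where
  "rel_soc X J = \<Inter>{I. fa_left_ideal X I \<and> J \<subseteq> I \<and> (\<forall>M. rel_minimal X J M \<longrightarrow> M \<subseteq> I)}"

text \<open>\<open>free_proj X \<phi> B I\<close> says that \<open>\<phi>\<close> induces an isomorphism of \<open>FA X\<close> modulo \<open>I\<close> with \<open>B\<close>.\<close>

definition free_proj ::
  "'x set \<Rightarrow> (('x list \<Rightarrow>\<^sub>0 'k::field) \<Rightarrow> 'b) \<Rightarrow> ('k, 'b) module \<Rightarrow> ('x list \<Rightarrow>\<^sub>0 'k) set \<Rightarrow> bool" where
  "free_proj X \<phi> B I \<longleftrightarrow> carrier B = \<phi> ` FA X \<and> \<zero>\<^bsub>B\<^esub> = \<phi> 0 \<and>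
     (\<forall>x\<in>FA X. \<forall>y\<in>FA X. \<phi> x \<oplus>\<^bsub>B\<^esub> \<phi> y = \<phi> (x + y) \<and> \<phi> x \<otimes>\<^bsub>B\<^esub> \<phi> y = \<phi> (x * y) \<and>
        (\<phi> x = \<phi> y \<longleftrightarrow> x - y \<in> I)) \<and>
     (\<forall>c. \<forall>x\<in>FA X. c \<odot>\<^bsub>B\<^esub> \<phi> x = \<phi> (scal c * x))"

lemma free_projD:
  assumes "free_proj X \<phi> B I"
  shows "carrier B = \<phi> ` FA X" "\<zero>\<^bsub>B\<^esub> = \<phi> 0"
    "x \<in> FA X \<Longrightarrow> y \<in> FA X \<Longrightarrow> \<phi> x \<oplus>\<^bsub>B\<^esub> \<phi> y = \<phi> (x + y)"
    "x \<in> FA X \<Longrightarrow> y \<in> FA X \<Longrightarrow> \<phi> x \<otimes>\<^bsub>B\<^esub> \<phi> y = \<phi> (x * y)"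
    "x \<in> FA X \<Longrightarrow> y \<in> FA X \<Longrightarrow> \<phi> x = \<phi> y \<longleftrightarrow> x - y \<in> I"
    "x \<in> FA X \<Longrightarrow> c \<odot>\<^bsub>B\<^esub> \<phi> x = \<phi> (scal c * x)"
  using assms unfolding free_proj_def by blast+

text \<open>Together with \<open>free_proj_image\<close> this is the correspondence theorem:
  preimage and image under \<open>\<phi>\<close> are inverse bijections between the left ideals of
  \<open>B\<close> and the left ideals of \<open>FA X\<close> that contain \<open>I\<close>.\<close>

lemma free_proj_vimage:
  assumes p: "free_proj X \<phi> B I" and I: "fa_left_ideal X I" and N: "alg_left_ideal B N"
  shows "fa_left_ideal X {x \<in> FA X. \<phi> x \<in> N}" "I \<subseteq> {x \<in> FA X. \<phi> x \<in> N}"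
    "\<phi> ` {x \<in> FA X. \<phi> x \<in> N} = N"
proof -
  note P = free_projD[OF p]
  have N': "N \<subseteq> \<phi> ` FA X" "\<phi> 0 \<in> N" "\<And>x y. x \<in> N \<Longrightarrow> y \<in> N \<Longrightarrow> x \<oplus>\<^bsub>B\<^esub> y \<in> N"
    "\<And>c x. x \<in> N \<Longrightarrow> c \<odot>\<^bsub>B\<^esub> x \<in> N" "\<And>a x. a \<in> FA X \<Longrightarrow> x \<in> N \<Longrightarrow> \<phi> a \<otimes>\<^bsub>B\<^esub> x \<in> N"
    using N by (auto simp: alg_left_ideal_def alg_subspace_def P)
  show "fa_left_ideal X {x \<in> FA X. \<phi> x \<in> N}"
    unfolding fa_left_ideal_iff using N' by (auto simp flip: P(3,4,6))
  show "\<phi> ` {x \<in> FA X. \<phi> x \<in> N} = N"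
    using N' by auto
  show "I \<subseteq> {x \<in> FA X. \<phi> x \<in> N}"
  proof safe
    fix x assume x: "x \<in> I"
    then show xF: "x \<in> FA X" using I by (auto simp: fa_left_ideal_iff)
    have "\<phi> x = \<phi> 0" using x by (simp add: P(5)[OF xF])
    then show "\<phi> x \<in> N" using N' by simp
  qed
qed

lemma free_proj_image:
  assumes p: "free_proj X \<phi> B I" and M: "fa_left_ideal X M" "I \<subseteq> M"
  shows "alg_left_ideal B (\<phi> ` M)" "{x \<in> FA X. \<phi> x \<in> \<phi> ` M} = M"
proof -
  note P = free_projD[OF p]
  note Mc = fa_left_ideal_closed[OF M(1)]
  show "alg_left_ideal B (\<phi> ` M)"
    unfolding alg_left_ideal_def alg_subspace_def P
    by (auto simp: P Mc intro!: imageI)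
  have "x \<in> M" if "x \<in> FA X" "m \<in> M" "\<phi> x = \<phi> m" for x m
  proof -
    have "x - m \<in> M" using that P(5)[of x m] Mc(1) M(2) by auto
    from Mc(3)[OF this \<open>m \<in> M\<close>] show ?thesis by simp
  qed
  then show "{x \<in> FA X. \<phi> x \<in> \<phi> ` M} = M"
    using Mc(1) by auto
qed

text \<open>The correspondence preserves inclusions and sends \<open>I\<close> to zero, so minimal
  goes to minimal in both directions.\<close>

lemma free_proj_minimal:
  assumes p: "free_proj X \<phi> B I" and I: "fa_left_ideal X I"
  shows "minimal_left_ideal B N \<Longrightarrow> rel_minimal X I {x \<in> FA X. \<phi> x \<in> N}"
    and "rel_minimal X I M \<Longrightarrow> minimal_left_ideal B (\<phi> ` M)"
proof -
  have zero: "\<phi> ` I = {\<zero>\<^bsub>B\<^esub>}"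
    using free_projD(2)[OF p] free_projD(5)[OF p, of _ 0] fa_left_ideal_closed[OF I] by fastforce
  { assume N: "minimal_left_ideal B N"
    then have lN: "alg_left_ideal B N" and N0: "N \<noteq> {\<zero>\<^bsub>B\<^esub>}"
      and Nmin: "\<And>K. alg_left_ideal B K \<Longrightarrow> K \<subseteq> N \<Longrightarrow> K = {\<zero>\<^bsub>B\<^esub>} \<or> K = N"
      by (auto simp: minimal_left_ideal_def)
    note v = free_proj_vimage[OF p I lN]
    show "rel_minimal X I {x \<in> FA X. \<phi> x \<in> N}"
      unfolding rel_minimal_def
    proof (intro conjI allI impI)
      show "{x \<in> FA X. \<phi> x \<in> N} \<noteq> I" using v(3) N0 zero by metis
      fix K assume "fa_left_ideal X K \<and> I \<subseteq> K \<and> K \<subseteq> {x \<in> FA X. \<phi> x \<in> N}"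
      then have K: "fa_left_ideal X K" "I \<subseteq> K" "\<phi> ` K \<subseteq> N" by auto
      have "\<phi> ` K = \<phi> ` I \<or> \<phi> ` K = N"
        using Nmin[OF free_proj_image(1)[OF p K(1,2)] K(3)] by (simp add: zero)
      then have "{x \<in> FA X. \<phi> x \<in> \<phi> ` K} = {x \<in> FA X. \<phi> x \<in> \<phi> ` I} \<or>
          {x \<in> FA X. \<phi> x \<in> \<phi> ` K} = {x \<in> FA X. \<phi> x \<in> N}"
        by (elim disjE) simp_all
      then show "K = I \<or> K = {x \<in> FA X. \<phi> x \<in> N}"
        unfolding free_proj_image(2)[OF p K(1,2)] free_proj_image(2)[OF p I order_refl] .
    qed (fact v)+ }
  { assume M: "rel_minimal X I M"
    then have lM: "fa_left_ideal X M" "I \<subseteq> M" and M0: "M \<noteq> I"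
      and Mmin: "\<And>K. fa_left_ideal X K \<Longrightarrow> I \<subseteq> K \<Longrightarrow> K \<subseteq> M \<Longrightarrow> K = I \<or> K = M"
      by (auto simp: rel_minimal_def)
    note im = free_proj_image[OF p lM]
    show "minimal_left_ideal B (\<phi> ` M)"
      unfolding minimal_left_ideal_def
    proof (intro conjI allI impI)
      show "\<phi> ` M \<noteq> {\<zero>\<^bsub>B\<^esub>}"
        using im(2) free_proj_image(2)[OF p I order_refl] M0 zero by metis
      fix K assume "alg_left_ideal B K \<and> K \<subseteq> \<phi> ` M"
      then have K: "alg_left_ideal B K" "K \<subseteq> \<phi> ` M" by auto
      note v = free_proj_vimage[OF p I K(1)]
      have "{x \<in> FA X. \<phi> x \<in> K} \<subseteq> M" using K(2) im(2) by blast
      then have "{x \<in> FA X. \<phi> x \<in> K} = I \<or> {x \<in> FA X. \<phi> x \<in> K} = M"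
        by (rule Mmin[OF v(1,2)])
      then have "\<phi> ` {x \<in> FA X. \<phi> x \<in> K} = \<phi> ` I \<or> \<phi> ` {x \<in> FA X. \<phi> x \<in> K} = \<phi> ` M"
        by (elim disjE) simp_all
      then show "K = {\<zero>\<^bsub>B\<^esub>} \<or> K = \<phi> ` M"
        unfolding v(3) zero .
    qed (rule im(1)) }
qed

text \<open>Needed to recover \<open>Soc B\<close>, defined as an intersection, as the image of its
  preimage in \<open>FA X\<close>; \<open>Soc_series_vimage\<close> works with that image.\<close>

lemma free_proj_Soc_subset:
  assumes p: "free_proj X \<phi> B I"
  shows "Soc B \<subseteq> carrier B"
proof -
  note P = free_projD[OF p]
  have "alg_left_ideal B (carrier B)"
    unfolding alg_left_ideal_def alg_subspace_def P(1,2)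
    by (simp add: P(3,4,6))
  moreover have "M \<subseteq> carrier B" if "minimal_left_ideal B M" for M
    using that by (simp add: minimal_left_ideal_def alg_left_ideal_def alg_subspace_def)
  ultimately show ?thesis
    unfolding Soc_def by (intro Inter_lower) simp
qed

lemma free_proj_Soc:
  fixes \<phi> :: "('x list \<Rightarrow>\<^sub>0 'k::field) \<Rightarrow> 'b"
  assumes p: "free_proj X \<phi> B I" and I: "fa_left_ideal X I"
  shows "{x \<in> FA X. \<phi> x \<in> Soc B} = rel_soc X I"
proof safe
  fix x assume x: "x \<in> FA X" "\<phi> x \<in> Soc B"
  show "x \<in> rel_soc X I"
    unfolding rel_soc_def
  proof safe
    fix K assume K: "fa_left_ideal X K" "I \<subseteq> K" "\<forall>M. rel_minimal X I M \<longrightarrow> M \<subseteq> K"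
    note im = free_proj_image[OF p K(1,2)]
    have "N \<subseteq> \<phi> ` K" if N: "minimal_left_ideal B N" for N
    proof -
      have "\<phi> ` {x \<in> FA X. \<phi> x \<in> N} \<subseteq> \<phi> ` K"
        using free_proj_minimal(1)[OF p I N] K(3) by (blast intro: image_mono)
      then show ?thesis
        using free_proj_vimage(3)[OF p I] N by (auto simp: minimal_left_ideal_def)
    qed
    then have "\<phi> x \<in> \<phi> ` K" using x im(1) by (auto simp: Soc_def)
    then show "x \<in> K" using im(2) x by blast
  qed
next
  fix x assume x: "x \<in> rel_soc X I"
  have gen: "x \<in> {x \<in> FA X. \<phi> x \<in> K}"
    if K: "alg_left_ideal B K" "\<And>N. minimal_left_ideal B N \<Longrightarrow> N \<subseteq> K" for K
  proof -
    note v = free_proj_vimage[OF p I K(1)]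
    have "M \<subseteq> {x \<in> FA X. \<phi> x \<in> K}" if M: "rel_minimal X I M" for M
      using K(2)[OF free_proj_minimal(2)[OF p I M]] M fa_left_ideal_closed(1)[of X M]
      by (auto simp: rel_minimal_def)
    then show ?thesis using x v(1,2) by (auto simp: rel_soc_def)
  qed
  show Soc: "\<phi> x \<in> Soc B"
    using gen by (auto simp: Soc_def)
  have "fa_left_ideal X (FA X :: ('x list \<Rightarrow>\<^sub>0 'k) set)" by (simp add: fa_left_ideal_iff)
  moreover have "I \<subseteq> FA X" using I by (simp add: fa_left_ideal_iff)
  moreover have "rel_minimal X I M \<Longrightarrow> M \<subseteq> FA X" for M by (simp add: rel_minimal_def fa_left_ideal_iff)
  ultimately show "x \<in> FA X" using x unfolding rel_soc_def by blast
qed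

lemma alg_quotient_simps:
  "carrier (alg_quotient A I) = a_rcosets\<^bsub>A\<^esub> I"
  "monoid.mult (alg_quotient A I) = rcoset_mult A I"
  "zero (alg_quotient A I) = I"
  "add (alg_quotient A I) = set_add A"
  "smult (alg_quotient A I) c Y = (\<Union>x\<in>Y. I +>\<^bsub>A\<^esub> (c \<odot>\<^bsub>A\<^esub> x))"
  by (simp_all add: alg_quotient_def ring.defs module.defs FactRing_def)

text \<open>The third isomorphism theorem: dividing \<open>B\<close> by the image of
  \<open>J\<close> amounts to dividing the free algebra by \<open>J\<close> at once. This lets the
  socle series climb without leaving \<open>FA X\<close>.\<close>

lemma free_proj_quotient:
  fixes \<phi> :: "('x list \<Rightarrow>\<^sub>0 'k::field) \<Rightarrow> 'b"
  assumes p: "free_proj X \<phi> B I" and J: "fa_ideal X J" and IJ: "I \<subseteq> J"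
  shows "free_proj X (\<lambda>x. \<phi> ` J +>\<^bsub>B\<^esub> \<phi> x) (alg_quotient B (\<phi> ` J)) J"
proof -
  note P = free_projD[OF p]
  note Jc = fa_ideal_closed[OF J]
  have co: "\<phi> ` J +>\<^bsub>B\<^esub> \<phi> x = \<phi> ` ((\<lambda>j. j + x) ` J)" if "x \<in> FA X" for x
    using that Jc(1) by (auto simp: a_r_coset_def r_coset_def P(3) image_iff intro!: bexI)
  have mem: "\<phi> y \<in> \<phi> ` J +>\<^bsub>B\<^esub> \<phi> x \<longleftrightarrow> y - x \<in> J" if xy: "x \<in> FA X" "y \<in> FA X" for x y
  proof
    assume "\<phi> y \<in> \<phi> ` J +>\<^bsub>B\<^esub> \<phi> x"
    then obtain j where j: "j \<in> J" "\<phi> y = \<phi> (j + x)" by (auto simp: co[OF xy(1)])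
    then have "y - (j + x) \<in> J" using P(5)[of y "j + x"] xy Jc(1) IJ by auto
    from Jc(3)[OF this j(1)] show "y - x \<in> J" by (simp add: algebra_simps)
  next
    assume "y - x \<in> J"
    then show "\<phi> y \<in> \<phi> ` J +>\<^bsub>B\<^esub> \<phi> x"
      unfolding co[OF xy(1)] by (auto simp: image_iff intro!: bexI[of _ "y - x"])
  qed
  have eq: "\<phi> ` J +>\<^bsub>B\<^esub> \<phi> x = \<phi> ` J +>\<^bsub>B\<^esub> \<phi> y \<longleftrightarrow> x - y \<in> J" if "x \<in> FA X" "y \<in> FA X" for x y
  proof
    assume "\<phi> ` J +>\<^bsub>B\<^esub> \<phi> x = \<phi> ` J +>\<^bsub>B\<^esub> \<phi> y"
    then show "x - y \<in> J" using mem[of x x] mem[of y x] that Jc(2) by simp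
  next
    assume d: "x - y \<in> J"
    have "(\<lambda>j. j + x) ` J = (\<lambda>j. j + y) ` J"
    proof (intro Set.set_eqI iffI)
      fix z assume "z \<in> (\<lambda>j. j + x) ` J"
      then obtain j where "j \<in> J" "z = j + x" by blast
      then show "z \<in> (\<lambda>j. j + y) ` J"
        using Jc(3)[OF _ d] by (auto simp: image_iff intro!: bexI[of _ "j + (x - y)"])
    next
      fix z assume "z \<in> (\<lambda>j. j + y) ` J"
      then obtain j where "j \<in> J" "z = j + y" by blast
      then show "z \<in> (\<lambda>j. j + x) ` J"
        using Jc(7)[OF _ d] by (auto simp: image_iff intro!: bexI[of _ "j - (x - y)"])
    qed
    then show "\<phi> ` J +>\<^bsub>B\<^esub> \<phi> x = \<phi> ` J +>\<^bsub>B\<^esub> \<phi> y" by (simp add: co that)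
  qed
  have elem: "\<exists>y\<in>FA X. z = \<phi> y \<and> y - x \<in> J" if "x \<in> FA X" "z \<in> \<phi> ` J +>\<^bsub>B\<^esub> \<phi> x" for x z
  proof -
    from that obtain j where "j \<in> J" "z = \<phi> (j + x)" by (auto simp: co)
    then show ?thesis using Jc(1) that(1) by (intro bexI[of _ "j + x"]) auto
  qed
  have self: "\<phi> x \<in> \<phi> ` J +>\<^bsub>B\<^esub> \<phi> x" if "x \<in> FA X" for x
    using mem[of x x] that Jc(2) by simp
  show ?thesis
    unfolding free_proj_def alg_quotient_simps
  proof (intro conjI ballI allI)
    show "a_rcosets\<^bsub>B\<^esub> (\<phi> ` J) = (\<lambda>x. \<phi> ` J +>\<^bsub>B\<^esub> \<phi> x) ` FA X"
      by (auto simp: A_RCOSETS_def RCOSETS_def a_r_coset_def P(1))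
    show "\<phi> ` J = \<phi> ` J +>\<^bsub>B\<^esub> \<phi> 0"
      by (simp add: co)
    fix x y :: "'x list \<Rightarrow>\<^sub>0 'k" assume xy: "x \<in> FA X" "y \<in> FA X"
    show "(\<phi> ` J +>\<^bsub>B\<^esub> \<phi> x) <+>\<^bsub>B\<^esub> (\<phi> ` J +>\<^bsub>B\<^esub> \<phi> y) = \<phi> ` J +>\<^bsub>B\<^esub> \<phi> (x + y)"
    proof (intro Set.set_eqI iffI)
      fix z assume "z \<in> (\<phi> ` J +>\<^bsub>B\<^esub> \<phi> x) <+>\<^bsub>B\<^esub> (\<phi> ` J +>\<^bsub>B\<^esub> \<phi> y)"
      then obtain s t where st: "s \<in> \<phi> ` J +>\<^bsub>B\<^esub> \<phi> x" "t \<in> \<phi> ` J +>\<^bsub>B\<^esub> \<phi> y" "z = s \<oplus>\<^bsub>B\<^esub> t"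
        by (auto simp: set_add_def set_mult_def)
      from elem[OF xy(1) st(1)] elem[OF xy(2) st(2)] obtain s' t' where
        "s' \<in> FA X" "t' \<in> FA X" "s = \<phi> s'" "t = \<phi> t'" "s' - x \<in> J" "t' - y \<in> J" by blast
      with st(3) Jc(3)[of "s' - x" "t' - y"] show "z \<in> \<phi> ` J +>\<^bsub>B\<^esub> \<phi> (x + y)"
        using xy by (simp add: P(3) mem algebra_simps)
    next
      fix z assume "z \<in> \<phi> ` J +>\<^bsub>B\<^esub> \<phi> (x + y)"
      from elem[OF _ this] xy obtain w where w: "w \<in> FA X" "z = \<phi> w" "w - (x + y) \<in> J" by auto
      then have "z = \<phi> (w - y) \<oplus>\<^bsub>B\<^esub> \<phi> y" "\<phi> (w - y) \<in> \<phi> ` J +>\<^bsub>B\<^esub> \<phi> x"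
        using xy by (simp_all add: P(3) mem algebra_simps)
      then show "z \<in> (\<phi> ` J +>\<^bsub>B\<^esub> \<phi> x) <+>\<^bsub>B\<^esub> (\<phi> ` J +>\<^bsub>B\<^esub> \<phi> y)"
        using self[OF xy(2)] by (auto simp: set_add_def set_mult_def)
    qed
    show "rcoset_mult B (\<phi> ` J) (\<phi> ` J +>\<^bsub>B\<^esub> \<phi> x) (\<phi> ` J +>\<^bsub>B\<^esub> \<phi> y) = \<phi> ` J +>\<^bsub>B\<^esub> \<phi> (x * y)"
    proof -
      \<comment> \<open>The product of two cosets is a union over all pairs of representatives;
        every pair yields the same coset because \<open>J\<close> is two-sided.\<close>
      have *: "\<phi> ` J +>\<^bsub>B\<^esub> (s \<otimes>\<^bsub>B\<^esub> t) = \<phi> ` J +>\<^bsub>B\<^esub> \<phi> (x * y)"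
        if st: "s \<in> \<phi> ` J +>\<^bsub>B\<^esub> \<phi> x" "t \<in> \<phi> ` J +>\<^bsub>B\<^esub> \<phi> y" for s t
      proof -
        from elem[OF xy(1) st(1)] elem[OF xy(2) st(2)] obtain s' t' where
          s't': "s' \<in> FA X" "t' \<in> FA X" "s = \<phi> s'" "t = \<phi> t'" "s' - x \<in> J" "t' - y \<in> J" by blast
        have "s' * t' - x * y = s' * (t' - y) + (s' - x) * y" by (simp add: algebra_simps)
        also have "\<dots> \<in> J" using s't' xy by (intro Jc(3) Jc(5) Jc(8))
        finally show ?thesis using s't' xy by (simp add: P(4) eq)
      qed
      show ?thesis
        unfolding rcoset_mult_def using self[OF xy(1)] self[OF xy(2)] by (auto simp: *)
    qed
    show "\<phi> ` J +>\<^bsub>B\<^esub> \<phi> x = \<phi> ` J +>\<^bsub>B\<^esub> \<phi> y \<longleftrightarrow> x - y \<in> J"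
      by (rule eq[OF xy])
  next
    fix c and x :: "'x list \<Rightarrow>\<^sub>0 'k" assume x: "x \<in> FA X"
    have *: "\<phi> ` J +>\<^bsub>B\<^esub> (c \<odot>\<^bsub>B\<^esub> s) = \<phi> ` J +>\<^bsub>B\<^esub> \<phi> (scal c * x)"
      if st: "s \<in> \<phi> ` J +>\<^bsub>B\<^esub> \<phi> x" for s
    proof -
      from elem[OF x st] obtain s' where s': "s' \<in> FA X" "s = \<phi> s'" "s' - x \<in> J" by blast
      have "scal c * s' - scal c * x \<in> J"
        using Jc(4)[OF s'(3), of c] by (simp add: algebra_simps)
      then show ?thesis using s' x by (simp add: P(6) eq)
    qed
    show "(\<Union>z\<in>\<phi> ` J +>\<^bsub>B\<^esub> \<phi> x. \<phi> ` J +>\<^bsub>B\<^esub> (c \<odot>\<^bsub>B\<^esub> z)) = \<phi> ` J +>\<^bsub>B\<^esub> \<phi> (scal c * x)"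
      using self[OF x] by (auto simp: *)
  qed
qed

lemma free_proj_id: "free_proj X (\<lambda>x. x) (free_algebra X) {0}"
  by (auto simp: free_proj_def free_algebra_def FA_def mult_map_scale_conv_mult scal_def)

text \<open>Right multiplication by \<open>a\<close> carries a left ideal \<open>M\<close> minimal
  over \<open>J\<close> to \<open>M a + J\<close>. Modulo \<open>J\<close> this is a homomorphic
  image of a simple module, so it is minimal over \<open>J\<close> again or collapses to
  \<open>J\<close>. Hence the socle absorbs factors on the right.\<close>

lemma rel_soc_ideal:
  fixes J :: "('x list \<Rightarrow>\<^sub>0 'k::field) set"
  assumes J: "fa_ideal X J"
  shows "fa_ideal X (rel_soc X J)" "J \<subseteq> rel_soc X J"
proof -
  note Jc = fa_ideal_closed[OF J]
  have lJ: "fa_left_ideal X J" using J by (simp add: fa_ideal_iff)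
  have lFA: "fa_left_ideal X (FA X :: ('x list \<Rightarrow>\<^sub>0 'k) set)"
    by (simp add: fa_left_ideal_iff)
  have "rel_minimal X J M \<Longrightarrow> M \<subseteq> FA X" for M
    by (simp add: rel_minimal_def fa_left_ideal_iff)
  then have left: "fa_left_ideal X (rel_soc X J)"
    unfolding rel_soc_def using lFA Jc(1) by (intro fa_left_ideal_Inter) auto
  show "J \<subseteq> rel_soc X J" by (auto simp: rel_soc_def)
  have mult: "rel_minimal X J {m * a + j |m j. m \<in> M \<and> j \<in> J} \<or> {m * a + j |m j. m \<in> M \<and> j \<in> J} = J"
    if a: "a \<in> FA X" and M: "rel_minimal X J M" for a M
  proof -
    let ?N = "{m * a + j |m j. m \<in> M \<and> j \<in> J}"
    have lM: "fa_left_ideal X M" "J \<subseteq> M"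
      and Mmin: "\<And>K. fa_left_ideal X K \<Longrightarrow> J \<subseteq> K \<Longrightarrow> K \<subseteq> M \<Longrightarrow> K = J \<or> K = M"
      using M by (auto simp: rel_minimal_def)
    note Mc = fa_left_ideal_closed[OF lM(1)]
    have JN: "J \<subseteq> ?N"
    proof
      fix j assume "j \<in> J"
      moreover have "j = 0 * a + j" by simp
      ultimately show "j \<in> ?N" using Mc(2) by blast
    qed
    have NI: "m * a + j \<in> ?N" if "m \<in> M" "j \<in> J" for m j using that by blast
    have lN: "fa_left_ideal X ?N"
      unfolding fa_left_ideal_iff
    proof (intro conjI ballI allI)
      show "?N \<subseteq> FA X" using Mc(1) Jc(1) a by auto
      show "0 \<in> ?N" using JN Jc(2) by blast
    next
      fix x y assume "x \<in> ?N" "y \<in> ?N"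
      then obtain m j m' j' where "x = m * a + j" "y = m' * a + j'" "m \<in> M" "m' \<in> M" "j \<in> J" "j' \<in> J"
        by blast
      then show "x + y \<in> ?N"
        using NI[OF Mc(3)[of m m'] Jc(3)[of j j']] by (simp add: algebra_simps)
    next
      fix c x assume "x \<in> ?N"
      then obtain m j where "x = m * a + j" "m \<in> M" "j \<in> J" by blast
      then show "scal c * x \<in> ?N"
        using NI[OF Mc(4)[of m c] Jc(4)[of j c]] by (simp add: algebra_simps)
    next
      fix b x :: "'x list \<Rightarrow>\<^sub>0 'k" assume "b \<in> FA X" "x \<in> ?N"
      then obtain m j where "x = m * a + j" "m \<in> M" "j \<in> J" by blast
      then show "b * x \<in> ?N"
        using NI[OF Mc(5)[OF \<open>b \<in> FA X\<close>, of m] Jc(5)[OF \<open>b \<in> FA X\<close>, of j]] by (simp add: algebra_simps)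
    qed
    have "K = J \<or> K = ?N" if K: "fa_left_ideal X K" "J \<subseteq> K" "K \<subseteq> ?N" for K
    proof -
      note Kc = fa_left_ideal_closed[OF K(1)]
      \<comment> \<open>The preimage of \<open>K\<close> under right multiplication by
        \<open>a\<close> lies between \<open>J\<close> and \<open>M\<close>, so the minimality of
        \<open>M\<close> leaves two cases.\<close>
      let ?L = "{m \<in> M. m * a \<in> K}"
      have "fa_left_ideal X ?L"
        unfolding fa_left_ideal_iff
        using Mc(1-5) Kc(2-5) by (simp add: distrib_right mult.assoc subset_iff)
      moreover have "J \<subseteq> ?L" using lM(2) Jc(8)[OF a] K(2) by auto
      ultimately have "?L = J \<or> ?L = M" by (intro Mmin) auto
      then show ?thesis
      proof
        assume L: "?L = J"
        have "x \<in> J" if "x \<in> K" for x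
        proof -
          from that K(3) obtain m j where x: "x = m * a + j" "m \<in> M" "j \<in> J" by blast
          have "j \<in> K" using x(3) K(2) by blast
          then have "m * a \<in> K" using Kc(7)[OF that, of j] x(1) by simp
          then have "m \<in> J" using L x(2) by blast
          then show ?thesis unfolding x(1) by (intro Jc(3)[OF _ x(3)] Jc(8)[OF a])
        qed
        then show ?thesis using K(2) by blast
      next
        assume "?L = M"
        then have "?N \<subseteq> K" using Kc(3) K(2) by blast
        then show ?thesis using K(3) by blast
      qed
    qed
    then show ?thesis using lN JN unfolding rel_minimal_def by blast
  qed
  have "x * a \<in> rel_soc X J" if a: "a \<in> FA X" and x: "x \<in> rel_soc X J" for a x
    unfolding rel_soc_def
  proof safe
    fix K assume K: "fa_left_ideal X K" "J \<subseteq> K" "\<forall>M. rel_minimal X J M \<longrightarrow> M \<subseteq> K"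
    note Kc = fa_left_ideal_closed[OF K(1)]
    \<comment> \<open>The aim is that \<open>?L\<close>, the elements whose product with
      \<open>a\<close> lies in \<open>K\<close>, is one of the left ideals intersected in
      \<open>rel_soc\<close>.\<close>
    let ?L = "{m \<in> FA X. m * a \<in> K}"
    have "fa_left_ideal X ?L"
      unfolding fa_left_ideal_iff
      using Kc(2-5) a by (simp add: distrib_right mult.assoc subset_iff)
    moreover have "J \<subseteq> ?L" using Jc(1) Jc(8)[OF a] K(2) by blast
    moreover have "M \<subseteq> ?L" if M: "rel_minimal X J M" for M
    proof
      fix m assume m: "m \<in> M"
      have "{m * a + j |m j. m \<in> M \<and> j \<in> J} \<subseteq> K"
        using mult[OF a M] K(2,3) by (elim disjE) simp_all
      moreover have "m * a + 0 \<in> {m * a + j |m j. m \<in> M \<and> j \<in> J}"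
        using m Jc(2) by blast
      ultimately have "m * a \<in> K" by auto
      moreover have "m \<in> FA X" using m M by (auto simp: rel_minimal_def fa_left_ideal_iff)
      ultimately show "m \<in> ?L" by simp
    qed
    ultimately have "?L \<in> {I. fa_left_ideal X I \<and> J \<subseteq> I \<and> (\<forall>M. rel_minimal X J M \<longrightarrow> M \<subseteq> I)}"
      by blast
    then have "x \<in> ?L" using x unfolding rel_soc_def by (rule InterD[rotated])
    then show "x * a \<in> K" by simp
  qed
  then show "fa_ideal X (rel_soc X J)"
    using left by (simp add: fa_ideal_iff)
qed

section \<open>Generated ideals, and the socle series inside the free algebra\<close>

lemma alg_ideal_generated_ideal:
  assumes "Y \<subseteq> FA X"
  shows "fa_ideal X (alg_ideal_generated (free_algebra X) Y)" "Y \<subseteq> alg_ideal_generated (free_algebra X) Y"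
proof -
  show "Y \<subseteq> alg_ideal_generated (free_algebra X) Y"
    by (auto simp: alg_ideal_generated_def)
  show "fa_ideal X (alg_ideal_generated (free_algebra X) Y)"
    unfolding alg_ideal_generated_def using fa_ideal_FA[of X] assms by (intro fa_ideal_Inter) blast+
qed

lemma alg_ideal_generated_least:
  "alg_ideal A I \<Longrightarrow> Y \<subseteq> I \<Longrightarrow> alg_ideal_generated A Y \<subseteq> I"
  by (auto simp: alg_ideal_generated_def)

text \<open>By \<open>free_proj_quotient\<close> every quotient in the series is a quotient of
  \<open>FA X\<close> itself, and \<open>free_proj_Soc\<close> turns its socle into the socle
  relative to \<open>S n\<close>.\<close>

lemma Soc_series_vimage:
  fixes I :: "('x list \<Rightarrow>\<^sub>0 'k::field) set"
  assumes I: "fa_ideal X I"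
  defines "L \<equiv> alg_quotient (free_algebra X) I"
  defines "S \<equiv> (\<lambda>n. {x \<in> FA X. I +>\<^bsub>free_algebra X\<^esub> x \<in> Soc_series L n})"
  shows "S 0 = I" "S (Suc n) = rel_soc X (S n)" "fa_ideal X (S n)"
proof -
  have p: "free_proj X (\<lambda>x. I +>\<^bsub>free_algebra X\<^esub> x) L I"
    using free_proj_quotient[OF free_proj_id I] fa_ideal_closed(2)[OF I] by (simp add: L_def)
  note P = free_projD[OF p]
  have lI: "fa_left_ideal X I" using I by (simp add: fa_ideal_iff)
  show S0: "S 0 = I"
    using P(2) P(5)[of _ 0] fa_ideal_closed(1)[OF I] by (auto simp: S_def)
  have S: "fa_ideal X (S n) \<and> I \<subseteq> S n \<and> S (Suc n) = rel_soc X (S n) \<and> Soc_series L n \<subseteq> carrier L" for n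
  proof (induction n)
    \<comment> \<open>Index 1 is \<open>Soc L\<close> itself, without a quotient by zero, so the
      projection onto \<open>L\<close> is used directly.\<close>
    case 0
    show ?case
      using free_proj_Soc[OF p lI] I S0 by (auto simp: S_def P(1,2))
  next
    case (Suc n)
    have 1: "fa_ideal X (S (Suc n))" "I \<subseteq> S (Suc n)"
      using rel_soc_ideal[of X "S n"] Suc by auto
    have lS: "fa_left_ideal X (S (Suc n))" using 1 by (simp add: fa_ideal_iff)
    have 2: "Soc_series L (Suc n) \<subseteq> carrier L"
      using free_proj_Soc_subset[OF p] by auto
    \<comment> \<open>Presents the ideal \<open>Soc_series L (Suc n)\<close> as an image, the form
      in which \<open>free_proj_quotient\<close> describes the next quotient.\<close>
    have 3: "(\<lambda>x. I +>\<^bsub>free_algebra X\<^esub> x) ` S (Suc n) = Soc_series L (Suc n)"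
      using 2 unfolding S_def P(1) by blast
    have "S (Suc (Suc n)) = {x \<in> FA X. Soc_series L (Suc n) +>\<^bsub>L\<^esub> (I +>\<^bsub>free_algebra X\<^esub> x)
        \<in> Soc (alg_quotient L (Soc_series L (Suc n)))}"
      unfolding S_def Soc_series.simps(2)[of L "Suc n"] P(1) by auto
    also have "\<dots> = rel_soc X (S (Suc n))"
      using free_proj_Soc[OF free_proj_quotient[OF p 1] lS] by (simp only: 3)
    finally show ?case using 1 2 by (intro conjI)
  qed
  then show "S (Suc n) = rel_soc X (S n)" "fa_ideal X (S n)" by auto
qed

section \<open>The grading\<close>

definition wdeg :: "('v, 'e) lpa_gen list \<Rightarrow> int" where
  "wdeg w = (\<Sum>g\<leftarrow>w. case g of Vertex _ \<Rightarrow> 0 | Edge _ \<Rightarrow> 1 | Ghost _ \<Rightarrow> - 1)"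

lemma wdeg_plus [simp]: "wdeg (u + w) = wdeg u + wdeg w"
  by (simp add: wdeg_def plus_list_def)

definition hpart :: "int \<Rightarrow> (('v, 'e) lpa_gen list \<Rightarrow>\<^sub>0 'k::field) \<Rightarrow> (('v, 'e) lpa_gen list \<Rightarrow>\<^sub>0 'k)" where
  "hpart d x = (\<Sum>w\<in>{w \<in> Poly_Mapping.keys x. wdeg w = d}. Poly_Mapping.single w (Poly_Mapping.lookup x w))"

lemma lookup_hpart: "Poly_Mapping.lookup (hpart d x) w = (if wdeg w = d then Poly_Mapping.lookup x w else 0)"
  by (simp add: hpart_def lookup_sum lookup_single when_def in_keys_iff)

lemma hpart_0 [simp]: "hpart d 0 = 0"
  by (rule poly_mapping_eqI) (simp add: lookup_hpart)

lemma hpart_add: "hpart d (x + y) = hpart d x + hpart d y"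
  by (rule poly_mapping_eqI) (simp add: lookup_hpart lookup_add)

lemma hpart_diff: "hpart d (x - y) = hpart d x - hpart d y"
  by (rule poly_mapping_eqI) (simp add: lookup_hpart lookup_minus)

lemma hpart_sum: "hpart d (sum f A) = (\<Sum>i\<in>A. hpart d (f i))"
  by (induction A rule: infinite_finite_induct) (simp_all add: hpart_add)

lemma hpart_eq_0: "d \<notin> wdeg ` Poly_Mapping.keys x \<Longrightarrow> hpart d x = 0"
  by (auto simp: hpart_def intro!: sum.neutral)

lemma hpart_FA: "x \<in> FA X \<Longrightarrow> hpart d x \<in> FA X"
  by (force simp: FA_def in_keys_iff lookup_hpart split: if_splits)

lemma hpart_single:
  "hpart d (Poly_Mapping.single w c) = (if wdeg w = d then Poly_Mapping.single w c else 0)"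
  by (rule poly_mapping_eqI) (auto simp: lookup_hpart lookup_single when_def)

lemma sum_hpart: "(\<Sum>d\<in>wdeg ` Poly_Mapping.keys x. hpart d x) = x"
proof (rule poly_mapping_eqI)
  fix w
  have "Poly_Mapping.lookup (\<Sum>d\<in>wdeg ` Poly_Mapping.keys x. hpart d x) w =
      (\<Sum>d\<in>wdeg ` Poly_Mapping.keys x. if wdeg w = d then Poly_Mapping.lookup x w else 0)"
    by (simp add: lookup_sum lookup_hpart)
  also have "\<dots> = Poly_Mapping.lookup x w"
    by (cases "w \<in> Poly_Mapping.keys x") (auto simp: in_keys_iff)
  finally show "Poly_Mapping.lookup (\<Sum>d\<in>wdeg ` Poly_Mapping.keys x. hpart d x) w = Poly_Mapping.lookup x w" .
qed

lemma hpart_single_mult: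
  "hpart d (Poly_Mapping.single w c * x) = Poly_Mapping.single w c * hpart (d - wdeg w) x"
  "hpart d (x * Poly_Mapping.single w c) = hpart (d - wdeg w) x * Poly_Mapping.single w c"
proof -
  let ?s = "\<lambda>u. Poly_Mapping.single u (Poly_Mapping.lookup x u)"
  have *: "hpart d (Poly_Mapping.single w c * ?s u) = Poly_Mapping.single w c * hpart (d - wdeg w) (?s u)"
    "hpart d (?s u * Poly_Mapping.single w c) = hpart (d - wdeg w) (?s u) * Poly_Mapping.single w c" for u
    by (auto simp: mult_single hpart_single)
  have "hpart d (Poly_Mapping.single w c * (\<Sum>u\<in>Poly_Mapping.keys x. ?s u)) =
      Poly_Mapping.single w c * hpart (d - wdeg w) (\<Sum>u\<in>Poly_Mapping.keys x. ?s u)"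
    by (simp only: hpart_sum sum_distrib_left *)
  then show "hpart d (Poly_Mapping.single w c * x) = Poly_Mapping.single w c * hpart (d - wdeg w) x"
    by (simp only: poly_mapping_sum_singles[symmetric])
  have "hpart d ((\<Sum>u\<in>Poly_Mapping.keys x. ?s u) * Poly_Mapping.single w c) =
      hpart (d - wdeg w) (\<Sum>u\<in>Poly_Mapping.keys x. ?s u) * Poly_Mapping.single w c"
    by (simp only: hpart_sum sum_distrib_right *)
  then show "hpart d (x * Poly_Mapping.single w c) = hpart (d - wdeg w) x * Poly_Mapping.single w c"
    by (simp only: poly_mapping_sum_singles[symmetric])
qed

lemma hpart_mult:
  "hpart d (a * x) = (\<Sum>w\<in>Poly_Mapping.keys a. Poly_Mapping.single w (Poly_Mapping.lookup a w) * hpart (d - wdeg w) x)"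
  "hpart d (x * a) = (\<Sum>w\<in>Poly_Mapping.keys a. hpart (d - wdeg w) x * Poly_Mapping.single w (Poly_Mapping.lookup a w))"
proof -
  let ?a = "\<Sum>w\<in>Poly_Mapping.keys a. Poly_Mapping.single w (Poly_Mapping.lookup a w)"
  have "hpart d (?a * x) = (\<Sum>w\<in>Poly_Mapping.keys a. Poly_Mapping.single w (Poly_Mapping.lookup a w) * hpart (d - wdeg w) x)"
    by (simp only: sum_distrib_right hpart_sum hpart_single_mult)
  then show "hpart d (a * x) = (\<Sum>w\<in>Poly_Mapping.keys a. Poly_Mapping.single w (Poly_Mapping.lookup a w) * hpart (d - wdeg w) x)"
    by (simp only: poly_mapping_sum_singles[symmetric])
  have "hpart d (x * ?a) = (\<Sum>w\<in>Poly_Mapping.keys a. hpart (d - wdeg w) x * Poly_Mapping.single w (Poly_Mapping.lookup a w))"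
    by (simp only: sum_distrib_left hpart_sum hpart_single_mult)
  then show "hpart d (x * a) = (\<Sum>w\<in>Poly_Mapping.keys a. hpart (d - wdeg w) x * Poly_Mapping.single w (Poly_Mapping.lookup a w))"
    by (simp only: poly_mapping_sum_singles[symmetric])
qed

definition homogeneous :: "int \<Rightarrow> (('v, 'e) lpa_gen list \<Rightarrow>\<^sub>0 'k::field) \<Rightarrow> bool" where
  "homogeneous j a \<longleftrightarrow> (\<forall>w\<in>Poly_Mapping.keys a. wdeg w = j)"

lemma hpart_homogeneous: "homogeneous j a \<Longrightarrow> hpart d a = (if d = j then a else 0)"
  by (rule poly_mapping_eqI) (auto simp: lookup_hpart homogeneous_def in_keys_iff)

lemma homogeneous_0 [simp]: "homogeneous j 0"
  by (simp add: homogeneous_def)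

lemma homogeneous_add: "homogeneous j a \<Longrightarrow> homogeneous j b \<Longrightarrow> homogeneous j (a + b)"
  using keys_add[of a b] by (auto simp: homogeneous_def)

lemma homogeneous_diff: "homogeneous j a \<Longrightarrow> homogeneous j b \<Longrightarrow> homogeneous j (a - b)"
  by (auto simp: homogeneous_def in_keys_iff lookup_minus)

lemma homogeneous_sum: "(\<And>i. i \<in> A \<Longrightarrow> homogeneous j (f i)) \<Longrightarrow> homogeneous j (sum f A)"
  by (induction A rule: infinite_finite_induct) (simp_all add: homogeneous_add)

lemma homogeneous_mult: "homogeneous i a \<Longrightarrow> homogeneous j b \<Longrightarrow> homogeneous (i + j) (a * b)"
  using keys_mult[of a b] by (fastforce simp: homogeneous_def)

lemma homogeneous_scal: "homogeneous 0 (scal c)"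
  by (simp add: homogeneous_def scal_def zero_list_def wdeg_def)

lemma homogeneous_gen [simp]:
  "homogeneous 0 (gen (Vertex v))" "homogeneous 1 (gen (Edge e))" "homogeneous (- 1) (gen (Ghost e))"
  by (simp_all add: homogeneous_def gen_def wdeg_def)

lemma hpart_mult_homogeneous:
  assumes "homogeneous j a"
  shows "hpart d (a * x) = a * hpart (d - j) x" "hpart d (x * a) = hpart (d - j) x * a"
proof -
  let ?a = "\<Sum>w\<in>Poly_Mapping.keys a. Poly_Mapping.single w (Poly_Mapping.lookup a w)"
  have "hpart d (a * x) = ?a * hpart (d - j) x"
    using assms by (simp add: hpart_mult(1) homogeneous_def sum_distrib_right)
  then show "hpart d (a * x) = a * hpart (d - j) x"
    by (simp only: poly_mapping_sum_singles[symmetric])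
  have "hpart d (x * a) = hpart (d - j) x * ?a"
    using assms by (simp add: hpart_mult(2) homogeneous_def sum_distrib_left)
  then show "hpart d (x * a) = hpart (d - j) x * a"
    by (simp only: poly_mapping_sum_singles[symmetric])
qed

lemma homogeneous_gen_mult [simp]:
  "homogeneous 0 (gen (Vertex v) * gen (Vertex w))" "homogeneous 1 (gen (Vertex v) * gen (Edge e))"
  "homogeneous 1 (gen (Edge e) * gen (Vertex v))" "homogeneous (- 1) (gen (Vertex v) * gen (Ghost e))"
  "homogeneous (- 1) (gen (Ghost e) * gen (Vertex v))" "homogeneous 0 (gen (Ghost e) * gen (Edge f))"
  "homogeneous 0 (gen (Edge e) * gen (Ghost f))"
  by (simp_all add: homogeneous_def gen_def mult_single plus_list_def wdeg_def)

definition graded :: "(('v, 'e) lpa_gen list \<Rightarrow>\<^sub>0 'k::field) set \<Rightarrow> bool" where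
  "graded J \<longleftrightarrow> (\<forall>x\<in>J. \<forall>d. hpart d x \<in> J)"

lemma graded_alg_ideal_generated:
  fixes Y :: "(('v, 'e) lpa_gen list \<Rightarrow>\<^sub>0 'k::field) set"
  assumes Y: "Y \<subseteq> FA X" and h: "\<And>y. y \<in> Y \<Longrightarrow> \<exists>j. homogeneous j y"
  shows "graded (alg_ideal_generated (free_algebra X) Y)"
proof -
  let ?I = "alg_ideal_generated (free_algebra X) Y"
  note I = alg_ideal_generated_ideal[OF Y]
  note Ic = fa_ideal_closed[OF I(1)]
  have lI: "fa_left_ideal X ?I" using I(1) by (simp add: fa_ideal_iff)
  \<comment> \<open>The elements of \<open>?I\<close> all of whose components lie in
    \<open>?I\<close> form an ideal; since it contains the homogeneous generators, it is all of
    \<open>?I\<close>.\<close>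
  let ?T = "{x \<in> ?I. \<forall>d. hpart d x \<in> ?I}"
  have s: "Poly_Mapping.single w (Poly_Mapping.lookup a w) \<in> FA X" if "a \<in> FA X" "w \<in> Poly_Mapping.keys a" for a w
    using that by (intro FA_single) (auto simp: FA_def)
  have T: "fa_ideal X ?T"
    unfolding fa_ideal_iff fa_left_ideal_iff
  proof (intro conjI ballI allI)
    show "?T \<subseteq> FA X" using Ic(1) by blast
    show "0 \<in> ?T" using Ic(2) by simp
  next
    fix x y assume "x \<in> ?T" "y \<in> ?T"
    then show "x + y \<in> ?T" by (simp add: hpart_add Ic(3))
  next
    fix c x assume "x \<in> ?T"
    then show "scal c * x \<in> ?T" by (simp add: hpart_mult_homogeneous(1)[OF homogeneous_scal] Ic(4))
  next
    fix a x :: "('v, 'e) lpa_gen list \<Rightarrow>\<^sub>0 'k" assume a: "a \<in> FA X" and "x \<in> ?T"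
    then show "a * x \<in> ?T"
      by (auto simp: hpart_mult(1)[of _ a x] intro!: Ic(5) s fa_left_ideal_sum[OF lI])
  next
    fix a x :: "('v, 'e) lpa_gen list \<Rightarrow>\<^sub>0 'k" assume a: "a \<in> FA X" and "x \<in> ?T"
    then show "x * a \<in> ?T"
      by (auto simp: hpart_mult(2)[of _ x a] intro!: Ic(8) s fa_left_ideal_sum[OF lI])
  qed
  have "Y \<subseteq> ?T"
  proof
    fix y assume "y \<in> Y"
    moreover obtain j where "homogeneous j y" using h[OF \<open>y \<in> Y\<close>] by blast
    ultimately show "y \<in> ?T" using I(2) Ic(2) by (auto simp: hpart_homogeneous)
  qed
  from alg_ideal_generated_least[OF T this] show ?thesis
    by (auto simp: graded_def)
qed

section \<open>Vertices in ideals generated by vertices\<close>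

definition lpa_gens :: "('v, 'e) pre_digraph \<Rightarrow> ('v, 'e) lpa_gen set" where
  "lpa_gens G = Vertex ` verts G \<union> Edge ` arcs G \<union> Ghost ` arcs G"

lemma lpa_free_eq: "lpa_free G = free_algebra (lpa_gens G)"
  by (simp add: lpa_free_def lpa_gens_def)

lemma gen_in_FA [simp, intro]:
  "v \<in> verts G \<Longrightarrow> gen (Vertex v) \<in> FA (lpa_gens G)"
  "e \<in> arcs G \<Longrightarrow> gen (Edge e) \<in> FA (lpa_gens G)"
  "e \<in> arcs G \<Longrightarrow> gen (Ghost e) \<in> FA (lpa_gens G)"
  by (auto simp: lpa_gens_def)

text \<open>The preimage in the free algebra of the ideal I(Y) of the Leavitt path algebra.\<close>

definition lpa_ideal_of :: "('v, 'e) pre_digraph \<Rightarrow> 'v set \<Rightarrow> (('v, 'e) lpa_gen list \<Rightarrow>\<^sub>0 'k::field) set" where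
  "lpa_ideal_of G Y = alg_ideal_generated (lpa_free G) (lpa_relations G \<union> (\<lambda>v. gen (Vertex v)) ` Y)"

lemma lpa_relations_cases:
  assumes "x \<in> lpa_relations G"
  obtains (vv) v w where "v \<in> verts G" "w \<in> verts G"
      "x = gen (Vertex v) * gen (Vertex w) - (if v = w then gen (Vertex v) else 0)"
    | (ve) e where "e \<in> arcs G" "x = gen (Vertex (tail G e)) * gen (Edge e) - gen (Edge e)"
    | (ev) e where "e \<in> arcs G" "x = gen (Edge e) * gen (Vertex (head G e)) - gen (Edge e)"
    | (vg) e where "e \<in> arcs G" "x = gen (Vertex (head G e)) * gen (Ghost e) - gen (Ghost e)"
    | (gv) e where "e \<in> arcs G" "x = gen (Ghost e) * gen (Vertex (tail G e)) - gen (Ghost e)"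
    | (ge) e f where "e \<in> arcs G" "f \<in> arcs G"
        "x = gen (Ghost e) * gen (Edge f) - (if e = f then gen (Vertex (head G e)) else 0)"
    | (ck) v where "regular_vertex G v" "x = gen (Vertex v) - (\<Sum>e\<in>out_arcs G v. gen (Edge e) * gen (Ghost e))"
  using assms unfolding lpa_relations_def by blast

context wf_digraph
begin

lemma lpa_relations_FA: "lpa_relations G \<subseteq> FA (lpa_gens G)"
  unfolding lpa_relations_def by (auto simp: regular_vertex_def intro!: FA_diff FA_sum)

lemma lpa_relations_homogeneous:
  assumes "x \<in> lpa_relations G"
  shows "\<exists>j. homogeneous j x"
  using assms
proof (cases rule: lpa_relations_cases)
  case vv
  then show ?thesis by (auto intro!: exI[of _ 0] homogeneous_diff)
next
  case ve
  then show ?thesis by (auto intro!: exI[of _ 1] homogeneous_diff)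
next
  case ev
  then show ?thesis by (auto intro!: exI[of _ 1] homogeneous_diff)
next
  case vg
  then show ?thesis by (auto intro!: exI[of _ "- 1"] homogeneous_diff)
next
  case gv
  then show ?thesis by (auto intro!: exI[of _ "- 1"] homogeneous_diff)
next
  case ge
  then show ?thesis by (auto intro!: exI[of _ 0] homogeneous_diff)
next
  case ck
  then show ?thesis by (auto intro!: exI[of _ 0] homogeneous_diff homogeneous_sum)
qed

lemma lpa_ideal_of_ideal:
  assumes "Y \<subseteq> verts G"
  shows "fa_ideal (lpa_gens G) (lpa_ideal_of G Y)" "lpa_relations G \<subseteq> lpa_ideal_of G Y"
    "v \<in> Y \<Longrightarrow> gen (Vertex v) \<in> lpa_ideal_of G Y" "graded (lpa_ideal_of G Y)"
proof -
  have *: "lpa_relations G \<union> (\<lambda>v. gen (Vertex v)) ` Y \<subseteq> FA (lpa_gens G)"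
    using lpa_relations_FA assms by auto
  show "fa_ideal (lpa_gens G) (lpa_ideal_of G Y)" "lpa_relations G \<subseteq> lpa_ideal_of G Y"
    "v \<in> Y \<Longrightarrow> gen (Vertex v) \<in> lpa_ideal_of G Y"
    using alg_ideal_generated_ideal[OF *] by (auto simp: lpa_ideal_of_def lpa_free_eq)
  show "graded (lpa_ideal_of G Y)"
    unfolding lpa_ideal_of_def lpa_free_eq
    by (rule graded_alg_ideal_generated[OF *])
      (auto intro: lpa_relations_homogeneous exI[of _ "0 :: int"])
qed

lemma lpa_ideal_of_least:
  "fa_ideal (lpa_gens G) I \<Longrightarrow> lpa_relations G \<subseteq> I \<Longrightarrow> (\<And>v. v \<in> Y \<Longrightarrow> gen (Vertex v) \<in> I) \<Longrightarrow> lpa_ideal_of G Y \<subseteq> I"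
  unfolding lpa_ideal_of_def lpa_free_eq by (rule alg_ideal_generated_least) auto

lemma lpa_ideal_eq: "lpa_ideal G = lpa_ideal_of G {}"
  by (simp add: lpa_ideal_def lpa_ideal_of_def)

end

text \<open>
  A representation of the Leavitt path algebra on the functions on \<open>V \<times> \<nat>\<close>, where \<open>V\<close> is the set
  of vertices outside \<open>Y\<close>. The copy of \<open>\<nat>\<close> over a regular vertex \<open>v\<close> is identified with the disjoint
  union of the copies over the ranges of the edges that leave \<open>v\<close> and end outside \<open>Y\<close>; this
  identification is what makes the relation \<open>v = \<Sum> e e\<^sup>*\<close> hold.
\<close>

definition slots :: "('v, 'e) pre_digraph \<Rightarrow> 'v set \<Rightarrow> 'v \<Rightarrow> ('e \<times> nat) set" where
  "slots G Y v = {e \<in> out_arcs G v. head G e \<notin> Y} \<times> UNIV"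

text \<open>\<open>Edge e\<close> writes the values over \<open>head G e\<close> into the block of
  slots over \<open>tail G e\<close> that is labelled \<open>e\<close>, and \<open>Ghost e\<close>
  reads this block back. Vertices of \<open>Y\<close> and edges into \<open>Y\<close> act as zero.
  The functions may have infinite support.\<close>

fun gen_act :: "('v, 'e) pre_digraph \<Rightarrow> 'v set \<Rightarrow> ('v, 'e) lpa_gen \<Rightarrow> ('v \<times> nat \<Rightarrow> 'k::field) \<Rightarrow> ('v \<times> nat \<Rightarrow> 'k)" where
  "gen_act G Y (Vertex v) \<phi> (u, m) = (if u = v \<and> v \<notin> Y then \<phi> (u, m) else 0)"
| "gen_act G Y (Edge e) \<phi> (u, m) =
     (if u = tail G e \<and> head G e \<notin> Y \<and> fst (from_nat_into (slots G Y u) m) = e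
      then \<phi> (head G e, snd (from_nat_into (slots G Y u) m)) else 0)"
| "gen_act G Y (Ghost e) \<phi> (u, m) =
     (if u = head G e \<and> head G e \<notin> Y then \<phi> (tail G e, to_nat_on (slots G Y (tail G e)) (e, m)) else 0)"

definition fa_act :: "('v, 'e) pre_digraph \<Rightarrow> 'v set \<Rightarrow> (('v, 'e) lpa_gen list \<Rightarrow>\<^sub>0 'k::field) \<Rightarrow>
    ('v \<times> nat \<Rightarrow> 'k) \<Rightarrow> ('v \<times> nat \<Rightarrow> 'k)" where
  "fa_act G Y x \<phi> p = (\<Sum>w\<in>Poly_Mapping.keys x. Poly_Mapping.lookup x w * foldr (gen_act G Y) w \<phi> p)"

lemma fa_act_superset:
  "finite A \<Longrightarrow> Poly_Mapping.keys x \<subseteq> A \<Longrightarrow>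
    fa_act G Y x \<phi> p = (\<Sum>w\<in>A. Poly_Mapping.lookup x w * foldr (gen_act G Y) w \<phi> p)"
  unfolding fa_act_def by (rule sum.mono_neutral_left) (auto simp: in_keys_iff)

lemma fa_act_0 [simp]: "fa_act G Y 0 \<phi> p = 0"
  by (simp add: fa_act_def)

lemma fa_act_add: "fa_act G Y (x + y) \<phi> p = fa_act G Y x \<phi> p + fa_act G Y y \<phi> p"
  using keys_add[of x y]
  by (simp add: fa_act_superset[of "Poly_Mapping.keys x \<union> Poly_Mapping.keys y"] lookup_add distrib_right sum.distrib)

lemma fa_act_single: "fa_act G Y (Poly_Mapping.single w c) \<phi> p = c * foldr (gen_act G Y) w \<phi> p"
  by (simp add: fa_act_superset[of "{w}"])

lemma fa_act_sum: "fa_act G Y (sum f A) \<phi> p = (\<Sum>i\<in>A. fa_act G Y (f i) \<phi> p)"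
  by (induction A rule: infinite_finite_induct) (simp_all add: fa_act_add)

lemma fa_act_diff: "fa_act G Y (x - y) \<phi> p = fa_act G Y x \<phi> p - fa_act G Y y \<phi> p"
  using fa_act_add[of G Y "x - y" y \<phi> p] by simp

lemma gen_act_sum: "gen_act G Y g (\<lambda>p. \<Sum>i\<in>A. c i * \<phi> i p) = (\<lambda>p. \<Sum>i\<in>A. c i * gen_act G Y g (\<phi> i) p)"
proof
  fix p show "gen_act G Y g (\<lambda>p. \<Sum>i\<in>A. c i * \<phi> i p) p = (\<Sum>i\<in>A. c i * gen_act G Y g (\<phi> i) p)"
    by (cases p; cases g) (auto intro!: sum.neutral)
qed

lemma foldr_gen_act_sum:
  "foldr (gen_act G Y) w (\<lambda>p. \<Sum>i\<in>A. c i * \<phi> i p) = (\<lambda>p. \<Sum>i\<in>A. c i * foldr (gen_act G Y) w (\<phi> i) p)"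
  by (induction w) (simp_all add: gen_act_sum)

lemma fa_act_mult: "fa_act G Y (x * y) \<phi> p = fa_act G Y x (fa_act G Y y \<phi>) p"
proof -
  let ?s = "\<lambda>x w. Poly_Mapping.single w (Poly_Mapping.lookup x w)"
  have "fa_act G Y ((\<Sum>w\<in>Poly_Mapping.keys x. ?s x w) * (\<Sum>u\<in>Poly_Mapping.keys y. ?s y u)) \<phi> p =
      (\<Sum>w\<in>Poly_Mapping.keys x. \<Sum>u\<in>Poly_Mapping.keys y.
        Poly_Mapping.lookup x w * Poly_Mapping.lookup y u * foldr (gen_act G Y) (w @ u) \<phi> p)"
    by (simp only: sum_product fa_act_sum mult_single fa_act_single plus_list_def)
  also have "\<dots> = fa_act G Y x (fa_act G Y y \<phi>) p"
    unfolding fa_act_def[abs_def]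
    by (simp add: foldr_gen_act_sum sum_distrib_left mult.assoc)
  finally show ?thesis by (simp only: poly_mapping_sum_singles[symmetric])
qed

lemma fa_act_gen: "fa_act G Y (gen g) \<phi> = gen_act G Y g \<phi>"
  by (rule ext) (simp add: gen_def fa_act_single)

lemma fa_act_zero_fun:
  fixes x :: "('v, 'e) lpa_gen list \<Rightarrow>\<^sub>0 'k::field"
  shows "fa_act G Y x (\<lambda>_. 0) p = 0"
proof -
  have g: "gen_act G Y g (\<lambda>_. 0 :: 'k) = (\<lambda>_. 0)" for g
  proof
    fix p show "gen_act G Y g (\<lambda>_. 0) p = 0" by (cases p; cases g) simp_all
  qed
  have "foldr (gen_act G Y) w (\<lambda>_. 0 :: 'k) = (\<lambda>_. 0)" for w
    by (induction w) (simp_all add: g)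
  then show ?thesis by (simp add: fa_act_def)
qed

lemma fa_annihilator_ideal: "fa_ideal X {x \<in> FA X. \<forall>\<phi> p. fa_act G Y x \<phi> p = 0}" (is "fa_ideal X ?N")
proof -
  have "fa_act G Y (a * x) \<phi> p = 0" "fa_act G Y (x * a) \<phi> p = 0" if "x \<in> ?N" for a x \<phi> p
  proof -
    have "fa_act G Y x \<phi> = (\<lambda>_. 0)" for \<phi> using that by auto
    then show "fa_act G Y (a * x) \<phi> p = 0" "fa_act G Y (x * a) \<phi> p = 0"
      by (simp_all add: fa_act_mult fa_act_zero_fun)
  qed
  then show ?thesis
    unfolding fa_ideal_iff fa_left_ideal_iff by (auto simp: fa_act_add)
qed

definition hereditary :: "('v, 'e) pre_digraph \<Rightarrow> 'v set \<Rightarrow> bool" where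
  "hereditary G Y \<longleftrightarrow> (\<forall>e\<in>arcs G. tail G e \<in> Y \<longrightarrow> head G e \<in> Y)"

context wf_digraph
begin

text \<open>Only the relation that expands a regular vertex is more than evaluation. Its summands
  project onto the blocks of the edges, and these blocks exhaust the copy over the vertex because
  \<open>to_nat_on\<close> is a bijection from an infinite countable set of slots.\<close>

lemma lpa_relations_annihilate:
  assumes rf: "row_finite G" and her: "hereditary G Y" and sat: "saturated G Y"
    and x: "x \<in> lpa_relations G"
  shows "fa_act G Y x \<phi> p = (0 :: 'k::field)"
proof -
  obtain u m where p: "p = (u, m)" by (cases p)
  have fin: "finite (out_arcs G v)" if "v \<in> verts G" for v
    using rf that by (simp add: row_finite_def)
  have cnt: "countable (slots G Y v)" if "v \<in> verts G" for v
  proof -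
    have "finite {e \<in> out_arcs G v. head G e \<notin> Y}" 
      using fin[OF that] by (rule finite_subset[rotated]) auto
    then show ?thesis
      unfolding slots_def by (rule countable_SIGMA[OF countable_finite countableI_type])
  qed
  \<comment> \<open>Heredity: an edge that acts nontrivially has both ends outside
    \<open>Y\<close>.\<close>
  have out: "tail G e \<notin> Y" if "e \<in> arcs G" "head G e \<notin> Y" for e
    using her that by (auto simp: hereditary_def)
  have slot: "from_nat_into (slots G Y (tail G e)) (to_nat_on (slots G Y (tail G e)) (e, m)) = (e, m)"
    if "e \<in> arcs G" "head G e \<notin> Y" for e m
    using that cnt by (intro from_nat_into_to_nat_on) (auto simp: slots_def out_arcs_def)
  \<comment> \<open>Saturation: a regular vertex outside \<open>Y\<close> emits an edge that ends
    outside \<open>Y\<close>, so its slots are infinite in number.\<close>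
  have reg: "infinite (slots G Y v)" if "regular_vertex G v" "v \<notin> Y" for v
  proof -
    have "{e \<in> out_arcs G v. head G e \<notin> Y} \<noteq> {}"
      using sat that by (auto simp: saturated_def)
    then show ?thesis
      using that by (simp add: slots_def finite_cartesian_product_iff regular_vertex_def)
  qed
  note simps = fa_act_diff fa_act_mult fa_act_gen fa_act_sum p
  from x show ?thesis
  proof (cases rule: lpa_relations_cases)
    case (ck v)
    then have v: "v \<in> verts G" by (simp add: regular_vertex_def)
    let ?t = "\<lambda>e. gen_act G Y (Edge e) (gen_act G Y (Ghost e) \<phi>) (u, m)"
    have "(\<Sum>e\<in>out_arcs G v. ?t e) = gen_act G Y (Vertex v) \<phi> (u, m)"
    proof (cases "u = v \<and> v \<notin> Y")
      case True
      then have inf: "infinite (slots G Y v)" using reg ck by simp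
      \<comment> \<open>The edge whose block contains position \<open>m\<close>; it alone
        contributes to the sum.\<close>
      define f where "f = fst (from_nat_into (slots G Y v) m)"
      have mem: "from_nat_into (slots G Y v) m \<in> slots G Y v"
        using inf by (intro from_nat_into) auto
      then have f: "f \<in> out_arcs G v" "head G f \<notin> Y" "tail G f = v"
        by (auto simp: f_def slots_def out_arcs_def)
      have "(f, snd (from_nat_into (slots G Y v) m)) = from_nat_into (slots G Y v) m"
        by (simp add: f_def)
      then have tf: "?t f = \<phi> (u, m)"
        using True f to_nat_on_from_nat_into_infinite[OF cnt[OF v] inf, of m]
        by (simp add: f_def)
      have te: "?t e = (if e = f then \<phi> (u, m) else 0)" for e
        using tf True by (auto simp: f_def)
      have "(\<Sum>e\<in>out_arcs G v. ?t e) = \<phi> (u, m)"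
        unfolding te using f(1) fin[OF v] by simp
      then show ?thesis using True by simp
    next
      case False
      then have "?t e = 0" if "e \<in> out_arcs G v" for e
        using that out[of e] by (auto simp: out_arcs_def)
      then have "(\<Sum>e\<in>out_arcs G v. ?t e) = 0" by (simp only: sum.neutral_const cong: sum.cong)
      then show ?thesis using False by auto
    qed
    then show ?thesis using ck by (simp add: simps del: gen_act.simps)
  qed (auto simp: simps slot dest: out)
qed

lemma lpa_ideal_of_vertex:
  assumes rf: "row_finite G" and her: "hereditary G Y" and sat: "saturated G Y"
    and v: "v \<in> verts G" "gen (Vertex v) \<in> (lpa_ideal_of G Y :: (('a, 'b) lpa_gen list \<Rightarrow>\<^sub>0 'k::field) set)"
  shows "v \<in> Y"
proof (rule ccontr)
  assume nv: "v \<notin> Y"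
  let ?N = "{x \<in> FA (lpa_gens G). \<forall>\<phi> p. fa_act G Y x \<phi> p = (0 :: 'k)}"
  have "Y \<subseteq> verts G" using sat by (simp add: saturated_def)
  then have "gen (Vertex w) \<in> ?N" if "w \<in> Y" for w
    using that by (auto simp: fa_act_gen)
  then have "lpa_ideal_of G Y \<subseteq> ?N"
    using lpa_relations_FA lpa_relations_annihilate[OF rf her sat]
    by (intro lpa_ideal_of_least fa_annihilator_ideal) auto
  \<comment> \<open>On the constant function 1 the vertex \<open>v\<close> acts as the indicator
    function of its own copy, so this value is also 1.\<close>
  then have "fa_act G Y (gen (Vertex v)) (\<lambda>_. 1) (v, 0) = (0 :: 'k)"
    using v by blast
  then show False using nv by (simp add: fa_act_gen)
qed

end

section \<open>Path calculus modulo a graded ideal\<close>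

text \<open>The end vertex is kept as the last factor because there is no unit in the algebra to
  stand for an empty path. In \<open>ghost_path\<close> it is the first factor.\<close>

primrec real_path :: "'e list \<Rightarrow> 'v \<Rightarrow> (('v, 'e) lpa_gen list \<Rightarrow>\<^sub>0 'k::field)" where
  "real_path [] w = gen (Vertex w)"
| "real_path (e # p) w = gen (Edge e) * real_path p w"

primrec ghost_path :: "'e list \<Rightarrow> 'v \<Rightarrow> (('v, 'e) lpa_gen list \<Rightarrow>\<^sub>0 'k::field)" where
  "ghost_path [] w = gen (Vertex w)"
| "ghost_path (e # p) w = ghost_path p w * gen (Ghost e)"

lemma homogeneous_real_path: "homogeneous (int (length p)) (real_path p w)"
proof (induction p)
  case (Cons e p)
  then show ?case using homogeneous_mult[OF homogeneous_gen(2) Cons, of e] by simp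
qed simp

lemma single_Nil: "Poly_Mapping.single [] 1 = 1"
  by (metis single_one zero_list_def)

lemma single_Cons: "Poly_Mapping.single (g # w) 1 = gen g * Poly_Mapping.single w 1"
  by (simp add: gen_def mult_single plus_list_def)

text \<open>Applied to two ideals: the one generated by the current vertices, over which minimal
  left ideals are analysed, and the one generated by the next set of vertices, whose vertices are
  shown to be saturated.\<close>

locale lpa_quotient = wf_digraph +
  fixes J :: "(('a, 'b) lpa_gen list \<Rightarrow>\<^sub>0 'k::field) set"
  assumes row_fin: "row_finite G"
    and J: "fa_ideal (lpa_gens G) J"
    and rel_J: "lpa_relations G \<subseteq> J"
    and graded_J: "graded J"
begin

abbreviation F :: "(('a, 'b) lpa_gen list \<Rightarrow>\<^sub>0 'k) set" where "F \<equiv> FA (lpa_gens G)"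
abbreviation V :: "'a \<Rightarrow> (('a, 'b) lpa_gen list \<Rightarrow>\<^sub>0 'k)" where "V v \<equiv> gen (Vertex v)"
abbreviation Ed :: "'b \<Rightarrow> (('a, 'b) lpa_gen list \<Rightarrow>\<^sub>0 'k)" where "Ed e \<equiv> gen (Edge e)"
abbreviation Gh :: "'b \<Rightarrow> (('a, 'b) lpa_gen list \<Rightarrow>\<^sub>0 'k)" where "Gh e \<equiv> gen (Ghost e)"
abbreviation rp :: "'b list \<Rightarrow> 'a \<Rightarrow> (('a, 'b) lpa_gen list \<Rightarrow>\<^sub>0 'k)" where "rp \<equiv> real_path"
abbreviation gp :: "'b list \<Rightarrow> 'a \<Rightarrow> (('a, 'b) lpa_gen list \<Rightarrow>\<^sub>0 'k)" where "gp \<equiv> ghost_path"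

lemmas Jc = fa_ideal_closed[OF J]

lemma lJ: "fa_left_ideal (lpa_gens G) J"
  using J by (simp add: fa_ideal_iff)

section \<open>Congruence modulo the ideal and the Leavitt relations\<close>

definition cg :: "(('a, 'b) lpa_gen list \<Rightarrow>\<^sub>0 'k) \<Rightarrow> (('a, 'b) lpa_gen list \<Rightarrow>\<^sub>0 'k) \<Rightarrow> bool" (infix \<open>\<approx>\<close> 50) where
  "x \<approx> y \<longleftrightarrow> x - y \<in> J"

lemma cg_refl [simp, intro]: "x \<approx> x"
  by (simp add: cg_def Jc(2))

lemma cg_sym: "x \<approx> y \<Longrightarrow> y \<approx> x"
  using Jc(6)[of "x - y"] by (simp add: cg_def)

lemma cg_trans [trans]: "x \<approx> y \<Longrightarrow> y \<approx> z \<Longrightarrow> x \<approx> z"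
  using Jc(3)[of "x - y" "y - z"] by (simp add: cg_def)

lemma cg_0: "x \<approx> 0 \<longleftrightarrow> x \<in> J"
  by (simp add: cg_def)

lemma cg_mem: "x \<approx> y \<Longrightarrow> x \<in> J \<longleftrightarrow> y \<in> J"
  using cg_trans cg_sym cg_0 by blast

lemma cg_add: "x \<approx> y \<Longrightarrow> x' \<approx> y' \<Longrightarrow> x + x' \<approx> y + y'"
  using Jc(3)[of "x - y" "x' - y'"] by (simp add: cg_def algebra_simps)

lemma cg_diff: "x \<approx> y \<Longrightarrow> x' \<approx> y' \<Longrightarrow> x - x' \<approx> y - y'"
  using Jc(7)[of "x - y" "x' - y'"] by (simp add: cg_def algebra_simps)

lemma cg_scal: "x \<approx> y \<Longrightarrow> scal c * x \<approx> scal c * y"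
  using Jc(4)[of "x - y" c] by (simp add: cg_def algebra_simps)

lemma cg_left: "x \<approx> y \<Longrightarrow> a \<in> F \<Longrightarrow> a * x \<approx> a * y"
  using Jc(5)[of a "x - y"] by (simp add: cg_def algebra_simps)

lemma cg_right: "x \<approx> y \<Longrightarrow> a \<in> F \<Longrightarrow> x * a \<approx> y * a"
  using Jc(8)[of a "x - y"] by (simp add: cg_def algebra_simps)

lemma cg_sum: "(\<And>i. i \<in> A \<Longrightarrow> f i \<approx> g i) \<Longrightarrow> sum f A \<approx> sum g A"
  by (induction A rule: infinite_finite_induct) (auto intro: cg_add)

lemma cg_hpart: "x \<approx> y \<Longrightarrow> hpart d x \<approx> hpart d y"
  using graded_J by (simp add: cg_def graded_def flip: hpart_diff)

lemma scal_J_iff: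
  assumes "c \<noteq> 0"
  shows "scal c * x \<in> J \<longleftrightarrow> x \<in> J"
proof
  assume "scal c * x \<in> J"
  from Jc(4)[OF this, of "inverse c"] show "x \<in> J"
    using assms by (simp add: scal_mult flip: mult.assoc)
qed (rule Jc(4))

lemma
  shows VV: "v \<in> verts G \<Longrightarrow> V v * V v \<approx> V v"
    and VV_ne: "v \<in> verts G \<Longrightarrow> w \<in> verts G \<Longrightarrow> v \<noteq> w \<Longrightarrow> V v * V w \<approx> 0"
    and VE: "e \<in> arcs G \<Longrightarrow> V (tail G e) * Ed e \<approx> Ed e"
    and EV: "e \<in> arcs G \<Longrightarrow> Ed e * V (head G e) \<approx> Ed e"
    and VG: "e \<in> arcs G \<Longrightarrow> V (head G e) * Gh e \<approx> Gh e"
    and GV: "e \<in> arcs G \<Longrightarrow> Gh e * V (tail G e) \<approx> Gh e"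
    and GE: "e \<in> arcs G \<Longrightarrow> Gh e * Ed e \<approx> V (head G e)"
    and GE_ne: "e \<in> arcs G \<Longrightarrow> f \<in> arcs G \<Longrightarrow> e \<noteq> f \<Longrightarrow> Gh e * Ed f \<approx> 0"
    and CK: "regular_vertex G v \<Longrightarrow> V v \<approx> (\<Sum>e\<in>out_arcs G v. Ed e * Gh e)"
proof -
  have R: "x - y \<in> lpa_relations G \<Longrightarrow> x \<approx> y" for x y
    using rel_J by (auto simp: cg_def)
  show "v \<in> verts G \<Longrightarrow> V v * V v \<approx> V v"
    by (rule R) (auto simp: lpa_relations_def intro: exI[of _ v])
  show "v \<in> verts G \<Longrightarrow> w \<in> verts G \<Longrightarrow> v \<noteq> w \<Longrightarrow> V v * V w \<approx> 0"
  proof (rule R)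
    assume "v \<in> verts G" "w \<in> verts G" and "v \<noteq> w"
    then have "V v * V w - (if v = w then V v else 0) \<in> lpa_relations G"
      unfolding lpa_relations_def by blast
    then show "V v * V w - 0 \<in> lpa_relations G" using \<open>v \<noteq> w\<close> by simp
  qed
  show "e \<in> arcs G \<Longrightarrow> V (tail G e) * Ed e \<approx> Ed e" "e \<in> arcs G \<Longrightarrow> Ed e * V (head G e) \<approx> Ed e"
    "e \<in> arcs G \<Longrightarrow> V (head G e) * Gh e \<approx> Gh e" "e \<in> arcs G \<Longrightarrow> Gh e * V (tail G e) \<approx> Gh e"
    by (rule R; auto simp: lpa_relations_def)+
  show "e \<in> arcs G \<Longrightarrow> Gh e * Ed e \<approx> V (head G e)"
    by (rule R) (auto simp: lpa_relations_def intro: exI[of _ e])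
  show "e \<in> arcs G \<Longrightarrow> f \<in> arcs G \<Longrightarrow> e \<noteq> f \<Longrightarrow> Gh e * Ed f \<approx> 0"
  proof (rule R)
    assume "e \<in> arcs G" "f \<in> arcs G" and "e \<noteq> f"
    then have "Gh e * Ed f - (if e = f then V (head G e) else 0) \<in> lpa_relations G"
      unfolding lpa_relations_def by blast
    then show "Gh e * Ed f - 0 \<in> lpa_relations G" using \<open>e \<noteq> f\<close> by simp
  qed
  show "regular_vertex G v \<Longrightarrow> V v \<approx> (\<Sum>e\<in>out_arcs G v. Ed e * Gh e)"
    by (rule R) (unfold lpa_relations_def, blast)
qed

section \<open>Real and ghost paths\<close>

lemma rp_F: "awalk u p w \<Longrightarrow> rp p w \<in> F"
  by (induction p arbitrary: u) (auto simp: awalk_Cons_iff awalk_Nil_iff)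

lemma gp_F: "awalk u p w \<Longrightarrow> gp p w \<in> F"
  by (induction p arbitrary: u) (auto simp: awalk_Cons_iff awalk_Nil_iff)

lemma V_rp: "awalk u p w \<Longrightarrow> V u * rp p w \<approx> rp p w"
  using cg_right[OF VE rp_F, of "hd p" _ "tl p"]
  by (cases p) (auto simp: awalk_Cons_iff awalk_Nil_iff VV mult.assoc)

lemma V_rp_ne:
  assumes "awalk u p w" "v \<in> verts G" "v \<noteq> u"
  shows "V v * rp p w \<approx> 0"
proof -
  have u: "u \<in> verts G" using assms(1) by (rule awalk_hd_in_verts)
  have "V v * rp p w \<approx> V v * (V u * rp p w)"
    using cg_sym[OF V_rp[OF assms(1)]] assms(2) by (intro cg_left) auto
  also have "V v * (V u * rp p w) = (V v * V u) * rp p w" by (simp add: mult.assoc)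
  also have "\<dots> \<approx> 0 * rp p w"
    using assms u by (intro cg_right VV_ne rp_F[OF assms(1)]) auto
  finally show ?thesis by simp
qed

lemma rp_V: "awalk u p w \<Longrightarrow> rp p w * V w \<approx> rp p w"
proof (induction p arbitrary: u)
  case (Cons e p)
  then have "rp p w * V w \<approx> rp p w" "e \<in> arcs G" by (auto simp: awalk_Cons_iff)
  then show ?case using cg_left[of "rp p w * V w" "rp p w" "Ed e"] by (simp add: mult.assoc)
qed (auto simp: awalk_Nil_iff VV)

lemma V_gp: "awalk u p w \<Longrightarrow> V w * gp p w \<approx> gp p w"
proof (induction p arbitrary: u)
  case (Cons e p)
  then have "V w * gp p w \<approx> gp p w" "e \<in> arcs G" by (auto simp: awalk_Cons_iff)
  then show ?case using cg_right[of "V w * gp p w" "gp p w" "Gh e"] by (simp add: mult.assoc)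
qed (auto simp: awalk_Nil_iff VV)

lemma gp_V: "awalk u p w \<Longrightarrow> gp p w * V u \<approx> gp p w"
  using cg_left[OF GV gp_F, of "hd p" _ "tl p"]
  by (cases p) (auto simp: awalk_Cons_iff awalk_Nil_iff VV mult.assoc)

lemma rp_append:
  assumes "awalk u p v" "awalk v q w"
  shows "rp p v * rp q w \<approx> rp (p @ q) w"
  using assms(1)
proof (induction p arbitrary: u)
  case Nil
  then show ?case using V_rp[OF assms(2)] by (simp add: awalk_Nil_iff)
next
  case (Cons e p)
  then have "rp p v * rp q w \<approx> rp (p @ q) w" "e \<in> arcs G" by (auto simp: awalk_Cons_iff)
  then show ?case using cg_left[of "rp p v * rp q w" "rp (p @ q) w" "Ed e"] by (simp add: mult.assoc)
qed

text \<open>Matching edges cancel by \<open>GE\<close>, and a mismatch gives zero by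
  \<open>GE_ne\<close>. The \<open>awalk\<close> condition decides the case of an empty
  \<open>p\<close>, where \<open>V v\<close> survives only in front of a walk that starts at
  \<open>v\<close>; for nonempty \<open>p\<close> it follows from the prefix condition.\<close>

lemma gp_rp_strip:
  assumes "awalk u p v" "awalk u' p' w" "length p \<le> length p'"
  shows "gp p v * rp p' w \<approx>
    (if take (length p) p' = p \<and> awalk v (drop (length p) p') w then rp (drop (length p) p') w else 0)"
  using assms
proof (induction p arbitrary: u u' p')
  case Nil
  then have v: "u = v" "v \<in> verts G" by (auto simp: awalk_Nil_iff)
  show ?case
  proof (cases "v = u'")
    case True
    then show ?thesis using V_rp[OF Nil(2)] Nil(2) by simp
  next
    case False
    then have "\<not> awalk v p' w"
      using Nil(2) by (cases p') (auto simp: awalk_Cons_iff awalk_Nil_iff)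
    then show ?thesis using V_rp_ne[OF Nil(2) v(2) False] by simp
  qed
next
  case (Cons e p)
  then obtain f q where p': "p' = f # q" by (cases p') auto
  have e: "e \<in> arcs G" "awalk (head G e) p v" and f: "f \<in> arcs G" "awalk (head G f) q w"
    using Cons.prems p' by (auto simp: awalk_Cons_iff)
  have eq: "gp (e # p) v * rp p' w = gp p v * (Gh e * Ed f) * rp q w"
    by (simp add: p' mult.assoc)
  show ?case
  proof (cases "e = f")
    case True
    have "gp (e # p) v * rp p' w \<approx> gp p v * V (head G e) * rp q w"
      unfolding eq using GE[OF e(1)] True
      by (auto intro!: cg_right cg_left gp_F[OF e(2)] rp_F[OF f(2)])
    also have "\<dots> \<approx> gp p v * rp q w"
      by (intro cg_right gp_V[OF e(2)] rp_F[OF f(2)])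
    also have "\<dots> \<approx> (if take (length p) q = p \<and> awalk v (drop (length p) q) w then rp (drop (length p) q) w else 0)"
      using Cons.prems p' by (intro Cons.IH[OF e(2) f(2)]) auto
    finally show ?thesis using True by (auto simp: p' simp del: ghost_path.simps real_path.simps split: if_splits)
  next
    case False
    have "gp (e # p) v * rp p' w \<approx> gp p v * 0 * rp q w"
      unfolding eq using GE_ne[OF e(1) f(1) False]
      by (intro cg_right cg_left gp_F[OF e(2)] rp_F[OF f(2)])
    then show ?thesis using False by (simp add: p')
  qed
qed

lemma gp_rp: "awalk u p w \<Longrightarrow> gp p w * rp p w \<approx> V w"
  using gp_rp_strip[of u p w u p w] by (simp add: awalk_Nil_iff awalk_last_in_verts)

text \<open>Holds because \<open>gp p w * V u * rp p w\<close> is congruent to \<open>V w\<close>;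
  so the vertices in \<open>J\<close> form a hereditary set.\<close>

lemma V_J_walk:
  assumes "awalk u p w" "V u \<in> J"
  shows "V w \<in> J"
proof -
  have "V u * rp p w \<in> J" using Jc(8)[OF rp_F[OF assms(1)] assms(2)] .
  then have "rp p w \<in> J" using cg_mem[OF V_rp[OF assms(1)]] by simp
  then have "gp p w * rp p w \<in> J" by (rule Jc(5)[OF gp_F[OF assms(1)]])
  then show ?thesis using cg_mem[OF gp_rp[OF assms(1)]] by simp
qed

section \<open>Reduction of an element to a vertex plus closed paths\<close>

lemma gen_rp:
  assumes g: "g \<in> lpa_gens G" and p: "awalk v p z" and n: "p \<noteq> [] \<or> out_arcs G z = {}"
  shows "gen g * rp p z \<approx> 0 \<or>
    (\<exists>u p'. awalk u p' z \<and> length p \<le> Suc (length p') \<and> gen g * rp p z \<approx> rp p' z)"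
proof -
  have z: "z \<in> verts G" using p by (rule awalk_last_in_verts)
  consider (v) u where "g = Vertex u" "u \<in> verts G" | (e) e where "g = Edge e" "e \<in> arcs G"
    | (h) e where "g = Ghost e" "e \<in> arcs G"
    using g by (auto simp: lpa_gens_def)
  then show ?thesis
  proof cases
    case v
    show ?thesis
    proof (cases "u = v")
      case True
      then show ?thesis using V_rp[OF p] p v by auto
    next
      case False
      then show ?thesis using V_rp_ne[OF p v(2)] v by simp
    qed
  next
    case e
    show ?thesis
    proof (cases "head G e = v")
      case True
      then have "awalk (tail G e) (e # p) z" using p e by (simp add: awalk_Cons_iff)
      then show ?thesis
        using e by (intro disjI2 exI[of _ "tail G e"] exI[of _ "e # p"]) simp
    next
      case False
      have "Ed e * rp p z \<approx> Ed e * V (head G e) * rp p z"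
        using cg_sym[OF EV[OF e(2)]] by (intro cg_right rp_F[OF p])
      also have "\<dots> = Ed e * (V (head G e) * rp p z)" by (simp add: mult.assoc)
      also have "\<dots> \<approx> Ed e * 0" using False e by (intro cg_left V_rp_ne[OF p]) auto
      finally show ?thesis using e by simp
    qed
  next
    case h
    show ?thesis
    proof (cases p)
      case Nil
      then have "v = z" "tail G e \<noteq> z" using p n h by (auto simp: awalk_Nil_iff)
      then have "V (tail G e) * rp p z \<approx> 0" using h by (intro V_rp_ne[OF p]) auto
      then have "Gh e * (V (tail G e) * rp p z) \<approx> Gh e * 0" using h by (intro cg_left) auto
      then have 0: "Gh e * V (tail G e) * rp p z \<approx> 0" by (simp add: mult.assoc)
      have "Gh e * V (tail G e) * rp p z \<approx> Gh e * rp p z"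
        by (rule cg_right[OF GV[OF h(2)] rp_F[OF p]])
      from cg_trans[OF cg_sym[OF this] 0] show ?thesis using h(1) by simp
    next
      case (Cons f q)
      then have f: "f \<in> arcs G" "awalk (head G f) q z" using p by (auto simp: awalk_Cons_iff)
      have eq: "gen g * rp p z = Gh e * Ed f * rp q z" by (simp add: h Cons mult.assoc)
      show ?thesis
      proof (cases "e = f")
        case True
        have "Gh e * Ed f * rp q z \<approx> V (head G f) * rp q z"
          using GE[OF f(1)] True by (intro cg_right rp_F[OF f(2)]) simp
        also have "\<dots> \<approx> rp q z" by (rule V_rp[OF f(2)])
        finally show ?thesis using f(2) eq Cons by auto
      next
        case False
        have "Gh e * Ed f * rp q z \<approx> 0 * rp q z"
          by (rule cg_right[OF GE_ne[OF h(2) f(1) False] rp_F[OF f(2)]])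
        then show ?thesis using eq by simp
      qed
    qed
  qed
qed

text \<open>Each letter removes at most one edge, so a path at least as long as the word is still
  nonempty when any ghost edge meets it. The inequality between \<open>p\<close> and
  \<open>p'\<close> keeps this account during the induction.\<close>

lemma word_rp:
  assumes w: "w \<in> lists (lpa_gens G)" and p: "awalk v p z" and n: "length w \<le> length p \<or> out_arcs G z = {}"
  shows "Poly_Mapping.single w 1 * rp p z \<approx> 0 \<or>
    (\<exists>u p'. awalk u p' z \<and> length p \<le> length w + length p' \<and> Poly_Mapping.single w 1 * rp p z \<approx> rp p' z)"
  using w n
proof (induction w)
  case Nil
  have "Poly_Mapping.single [] 1 * rp p z = rp p z" by (simp add: single_Nil)
  then show ?case using p by auto
next
  case (Cons g w)
  have g: "g \<in> lpa_gens G" using Cons by simp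
  have eq: "Poly_Mapping.single (g # w) 1 * rp p z = gen g * (Poly_Mapping.single w 1 * rp p z)"
    by (simp only: single_Cons mult.assoc)
  have gF: "gen g \<in> F" using g by simp
  consider "Poly_Mapping.single w 1 * rp p z \<approx> 0"
    | u p' where "awalk u p' z" "length p \<le> length w + length p'" "Poly_Mapping.single w 1 * rp p z \<approx> rp p' z"
    using Cons by auto
  then show ?case
  proof cases
    case 1
    then show ?thesis using cg_left[OF 1 gF] by (simp add: eq)
  next
    case 2
    have "p' \<noteq> [] \<or> out_arcs G z = {}" using 2(2) Cons.prems by auto
    from gen_rp[OF g 2(1) this] show ?thesis
    proof (elim disjE exE conjE)
      assume "gen g * rp p' z \<approx> 0"
      then show ?thesis using cg_trans[OF cg_left[OF 2(3) gF]] by (simp add: eq)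
    next
      fix u' q assume "awalk u' q z" "length p' \<le> Suc (length q)" "gen g * rp p' z \<approx> rp q z"
      then show ?thesis using cg_trans[OF cg_left[OF 2(3) gF]] 2(2) unfolding eq by fastforce
    qed
  qed
qed

lemma real_path_expansion:
  assumes x: "x \<in> F" and p: "awalk v p z"
    and n: "(\<forall>w\<in>Poly_Mapping.keys x. length w \<le> length p) \<or> out_arcs G z = {}"
  obtains S c where "finite S" "\<And>q. q \<in> S \<Longrightarrow> c q \<noteq> 0 \<and> (\<exists>u. awalk u q z)"
    "x * rp p z \<approx> (\<Sum>q\<in>S. scal (c q) * rp q z)"
proof -
  let ?l = "Poly_Mapping.lookup x"
  let ?s = "\<lambda>w. Poly_Mapping.single w (1 :: 'k) * rp p z"
  define K where "K = {w \<in> Poly_Mapping.keys x. \<not> ?s w \<approx> 0}"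
  have "\<exists>q. (\<exists>u. awalk u q z) \<and> ?s w \<approx> rp q z" if "w \<in> K" for w
    using word_rp[of w v p z] that x p n by (auto simp: K_def FA_def)
  then obtain f where f: "\<And>w. w \<in> K \<Longrightarrow> (\<exists>u. awalk u (f w) z) \<and> ?s w \<approx> rp (f w) z" by metis
  have finK: "finite K" by (simp add: K_def)
  \<comment> \<open>Different words may turn into the same path, so their coefficients are
    collected.\<close>
  define c where "c q = (\<Sum>w\<in>{w \<in> K. f w = q}. ?l w)" for q
  have "x * rp p z = (\<Sum>w\<in>Poly_Mapping.keys x. Poly_Mapping.single w (?l w) * rp p z)"
    by (subst (1) poly_mapping_sum_singles[of x]) (rule sum_distrib_right)
  also have "\<dots> = (\<Sum>w\<in>Poly_Mapping.keys x. scal (?l w) * ?s w)"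
    by (simp add: scal_mult_single flip: mult.assoc)
  also have "\<dots> \<approx> (\<Sum>w\<in>Poly_Mapping.keys x. if w \<in> K then scal (?l w) * rp (f w) z else 0)"
    using f cg_scal[of _ 0] cg_scal by (intro cg_sum) (fastforce simp: K_def)
  also have "\<dots> = (\<Sum>w\<in>K. scal (?l w) * rp (f w) z)"
    by (simp add: K_def sum.inter_filter)
  also have "\<dots> = (\<Sum>q\<in>f ` K. \<Sum>w\<in>{w \<in> K. f w = q}. scal (?l w) * rp (f w) z)"
    by (rule sum.image_gen[OF finK])
  also have "\<dots> = (\<Sum>q\<in>f ` K. scal (c q) * rp q z)"
    by (intro sum.cong refl) (simp add: c_def scal_sum sum_distrib_right)
  \<comment> \<open>Paths whose coefficients cancel are dropped: \<open>reduction\<close> needs a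
    nonzero coefficient at a shortest path.\<close>
  also have "\<dots> = (\<Sum>q\<in>{q \<in> f ` K. c q \<noteq> 0}. scal (c q) * rp q z)"
    using finK by (intro sum.mono_neutral_right) auto
  finally have "x * rp p z \<approx> (\<Sum>q\<in>{q \<in> f ` K. c q \<noteq> 0}. scal (c q) * rp q z)" .
  then show ?thesis using f finK by (intro that[of "{q \<in> f ` K. c q \<noteq> 0}" c]) auto
qed

text \<open>Row-finiteness makes every vertex that emits an edge regular. There
  \<open>x * rp p z\<close> is congruent to the sum of its products with \<open>Ed e * Gh e\<close>,
  one of which lies outside \<open>J\<close>; following that edge lengthens the walk. Only a sink
  can stop it.\<close>

lemma extend_walk:
  assumes x: "x \<in> F" and v: "v \<in> verts G" "x * V v \<notin> J"
  shows "\<exists>p z. awalk v p z \<and> x * rp p z \<notin> J \<and> (n \<le> length p \<or> out_arcs G z = {})"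
proof (induction n)
  case 0
  show ?case using v by (intro exI[of _ "[]"] exI[of _ v]) (auto simp: awalk_Nil_iff)
next
  case (Suc n)
  then obtain p z where p: "awalk v p z" "x * rp p z \<notin> J" "n \<le> length p \<or> out_arcs G z = {}" by blast
  show ?case
  proof (cases "out_arcs G z = {}")
    case True
    then show ?thesis using p by blast
  next
    case False
    have z: "z \<in> verts G" using p(1) by (rule awalk_last_in_verts)
    have xF: "x * rp p z \<in> F" using x rp_F[OF p(1)] by blast
    have reg: "regular_vertex G z" using z False row_fin by (simp add: regular_vertex_def row_finite_def)
    have "x * rp p z \<approx> x * (rp p z * V z)" using cg_sym[OF rp_V[OF p(1)]] x by (intro cg_left)
    also have "x * (rp p z * V z) = x * rp p z * V z" by (simp add: mult.assoc)
    also have "\<dots> \<approx> x * rp p z * (\<Sum>e\<in>out_arcs G z. Ed e * Gh e)" by (intro cg_left CK reg xF)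
    also have "\<dots> = (\<Sum>e\<in>out_arcs G z. x * rp p z * Ed e * Gh e)" by (simp add: sum_distrib_left mult.assoc)
    finally have "(\<Sum>e\<in>out_arcs G z. x * rp p z * Ed e * Gh e) \<notin> J"
      using p(2) by (simp add: cg_mem)
    then have "\<exists>e\<in>out_arcs G z. x * rp p z * Ed e * Gh e \<notin> J"
      using fa_left_ideal_sum[OF lJ, of "out_arcs G z" "\<lambda>e. x * rp p z * Ed e * Gh e"] by blast
    then obtain e where e: "e \<in> out_arcs G z" "x * rp p z * Ed e * Gh e \<notin> J" by blast
    have eG: "e \<in> arcs G" "tail G e = z" using e by auto
    have we: "awalk z [e] (head G e)" using eG by (simp add: awalk_Cons_iff awalk_Nil_iff)
    have 1: "x * rp p z * Ed e \<notin> J" using e(2) Jc(8)[of "Gh e"] eG by auto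
    have "x * rp p z * Ed e \<approx> x * rp (p @ [e]) (head G e)"
    proof -
      have "rp p z * Ed e \<approx> rp p z * (Ed e * V (head G e))"
        using cg_sym[OF EV[OF eG(1)]] by (intro cg_left rp_F[OF p(1)])
      also have "\<dots> \<approx> rp (p @ [e]) (head G e)" using rp_append[OF p(1) we] by simp
      finally show ?thesis using cg_left[OF _ x] by (simp add: mult.assoc)
    qed
    from cg_mem[OF this] 1 have "x * rp (p @ [e]) (head G e) \<notin> J" by simp
    moreover have "awalk v (p @ [e]) (head G e)" using p(1) we by auto
    moreover have "Suc n \<le> length (p @ [e])" using p(3) False by simp
    ultimately show ?thesis by blast
  qed
qed

text \<open>A path on the right that is as long as the longest word of \<open>x\<close>, or ends in
  a sink, absorbs all ghost edges and leaves a combination of real paths into \<open>z\<close>.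
  Stripping a shortest of them from the left turns it into \<open>V z\<close>, and every other path
  into zero or a nontrivial closed path at \<open>z\<close>.\<close>

lemma reduction:
  assumes x: "x \<in> F" and v: "v \<in> verts G" "x * V v \<notin> J"
  obtains p u p1 z c Q k where "awalk v p z" "awalk u p1 z" "c \<noteq> 0" "finite Q"
    "\<forall>q\<in>Q. awalk z q z \<and> q \<noteq> []" "V z \<notin> J"
    "gp p1 z * x * rp p z \<approx> scal c * V z + (\<Sum>q\<in>Q. scal (k q) * rp q z)"
proof -
  define n where "n = Max (insert 0 (length ` Poly_Mapping.keys x))"
  have n: "length w \<le> n" if "w \<in> Poly_Mapping.keys x" for w
    unfolding n_def using that by (intro Max_ge) auto
  obtain p z where p: "awalk v p z" "x * rp p z \<notin> J" "n \<le> length p \<or> out_arcs G z = {}"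
    using extend_walk[OF x v] by blast
  have nn: "(\<forall>w\<in>Poly_Mapping.keys x. length w \<le> length p) \<or> out_arcs G z = {}"
    using n p(3) by (meson le_trans)
  obtain S c where S: "finite S" "\<And>q. q \<in> S \<Longrightarrow> c q \<noteq> 0 \<and> (\<exists>u. awalk u q z)"
    "x * rp p z \<approx> (\<Sum>q\<in>S. scal (c q) * rp q z)"
    by (rule real_path_expansion[OF x p(1) nn]) blast
  have z: "z \<in> verts G" using p(1) by (rule awalk_last_in_verts)
  have "V z \<notin> J"
  proof
    assume "V z \<in> J"
    then have "x * rp p z * V z \<in> J" using x rp_F[OF p(1)] by (intro Jc(5)) auto
    moreover have "x * rp p z * V z \<approx> x * rp p z"
      using cg_left[OF rp_V[OF p(1)] x] by (simp add: mult.assoc)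
    ultimately show False using p(2) by (simp add: cg_mem)
  qed
  have "S \<noteq> {}"
  proof
    assume "S = {}"
    then have "x * rp p z \<approx> 0" using S(3) by simp
    then show False using p(2) by (simp add: cg_0)
  qed
  \<comment> \<open>Minimal length is what \<open>gp_rp_strip\<close> requires for all paths in
    \<open>S\<close> at once.\<close>
  then obtain p1 where p1: "p1 \<in> S" "\<And>q. q \<in> S \<Longrightarrow> length p1 \<le> length q"
    using ex_has_least_nat[of "\<lambda>q. q \<in> S" _ length] by blast
  obtain u where u: "awalk u p1 z" using S(2)[OF p1(1)] by blast
  \<comment> \<open>What remains of the longer paths: they end at \<open>z\<close> like
    \<open>p1\<close>, so the remainders are closed.\<close>
  define Q where "Q = {q. q \<noteq> [] \<and> awalk z q z \<and> p1 @ q \<in> S}"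
  have Qim: "Q \<subseteq> drop (length p1) ` S"
    unfolding Q_def by (force simp: image_iff)
  let ?t = "\<lambda>q. if take (length p1) q = p1 \<and> awalk z (drop (length p1) q) z
      then scal (c q) * rp (drop (length p1) q) z else 0"
  let ?S = "{q \<in> S. take (length p1) q = p1 \<and> awalk z (drop (length p1) q) z}"
  have "gp p1 z * x * rp p z = gp p1 z * (x * rp p z)" by (simp add: mult.assoc)
  also have "\<dots> \<approx> gp p1 z * (\<Sum>q\<in>S. scal (c q) * rp q z)"
    by (rule cg_left[OF S(3) gp_F[OF u]])
  also have "\<dots> = (\<Sum>q\<in>S. scal (c q) * (gp p1 z * rp q z))"
    by (simp add: sum_distrib_left mult_scal_left)
  also have "\<dots> \<approx> (\<Sum>q\<in>S. ?t q)"
  proof (rule cg_sum)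
    fix q assume q: "q \<in> S"
    then obtain u' where u': "awalk u' q z" using S(2) by blast
    have "scal (c q) * (gp p1 z * rp q z) \<approx>
      scal (c q) * (if take (length p1) q = p1 \<and> awalk z (drop (length p1) q) z then rp (drop (length p1) q) z else 0)"
      by (rule cg_scal[OF gp_rp_strip[OF u u' p1(2)[OF q]]])
    then show "scal (c q) * (gp p1 z * rp q z) \<approx> ?t q" by (auto split: if_splits)
  qed
  finally have 1: "gp p1 z * x * rp p z \<approx> (\<Sum>q\<in>S. ?t q)" .
  have 2: "(\<Sum>q\<in>S. ?t q) = (\<Sum>q\<in>?S. scal (c q) * rp (drop (length p1) q) z)"
    by (rule sum.inter_filter[OF S(1), symmetric])
  have 3: "?S = insert p1 ((\<lambda>q. p1 @ q) ` Q)"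
  proof (intro Set.set_eqI iffI)
    fix q assume q: "q \<in> ?S"
    then have eq: "q = p1 @ drop (length p1) q" using append_take_drop_id[of "length p1" q] by simp
    show "q \<in> insert p1 ((\<lambda>q. p1 @ q) ` Q)"
    proof (cases "drop (length p1) q = []")
      case True
      then show ?thesis using eq by simp
    next
      case False
      then have "drop (length p1) q \<in> Q" using q eq by (simp add: Q_def)
      then show ?thesis using eq by blast
    qed
  next
    fix q assume "q \<in> insert p1 ((\<lambda>q. p1 @ q) ` Q)"
    then show "q \<in> ?S" using p1(1) z by (auto simp: Q_def awalk_Nil_iff)
  qed
  have 4: "(\<Sum>q\<in>insert p1 ((\<lambda>q. p1 @ q) ` Q). scal (c q) * rp (drop (length p1) q) z) =
      scal (c p1) * V z + (\<Sum>q\<in>Q. scal (c (p1 @ q)) * rp q z)"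
  proof -
    have "finite Q" using Qim S(1) finite_surj by blast
    moreover have "p1 \<notin> (\<lambda>q. p1 @ q) ` Q" by (auto simp: Q_def)
    ultimately show ?thesis by (simp add: sum.reindex inj_on_def)
  qed
  have "gp p1 z * x * rp p z \<approx> scal (c p1) * V z + (\<Sum>q\<in>Q. scal (c (p1 @ q)) * rp q z)"
    using 1 unfolding 2 3 4 .
  moreover have "finite Q" using Qim S(1) finite_surj by blast
  moreover have "\<forall>q\<in>Q. awalk z q z \<and> q \<noteq> []" by (simp add: Q_def)
  ultimately show ?thesis
    using that[OF p(1) u, of "c p1" Q "\<lambda>q. c (p1 @ q)"] S(2)[OF p1(1)] \<open>V z \<notin> J\<close> by blast
qed

text \<open>Distinct vertices are orthogonal idempotents modulo \<open>J\<close>, so the sum of the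
  vertices that fix the first or the last letters of the words of \<open>x\<close> acts as a unit on
  \<open>x\<close>.\<close>

lemma local_units:
  assumes "x \<in> F"
  shows "\<exists>A. finite A \<and> A \<subseteq> verts G \<and> sum V A * x \<approx> x \<and> x * sum V A \<approx> x"
proof -
  have g: "\<exists>u\<in>verts G. \<exists>v\<in>verts G. V u * gen g \<approx> gen g \<and> gen g * V v \<approx> gen g"
    if "g \<in> lpa_gens G" for g
    using that VV VE EV VG GV unfolding lpa_gens_def
    by (elim UnE imageE) (use tail_in_verts head_in_verts in blast)+
  then obtain s t where st: "\<And>g. g \<in> lpa_gens G \<Longrightarrow> s g \<in> verts G \<and> t g \<in> verts G \<and>
      V (s g) * gen g \<approx> gen g \<and> gen g * V (t g) \<approx> gen g"
    by metis
  define K where "K = Poly_Mapping.keys x"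
  have K: "w \<noteq> []" "hd w \<in> lpa_gens G" "last w \<in> lpa_gens G" "w \<in> lists (lpa_gens G)" if "w \<in> K" for w
  proof -
    show w: "w \<noteq> []" "w \<in> lists (lpa_gens G)"
      using assms that by (auto simp: K_def FA_def)
    then show "hd w \<in> lpa_gens G" "last w \<in> lpa_gens G"
      using hd_in_set[OF w(1)] last_in_set[OF w(1)] by auto
  qed
  define A where "A = (s \<circ> hd) ` K \<union> (t \<circ> last) ` K"
  have A: "finite A" "A \<subseteq> verts G" using st K by (auto simp: A_def K_def)
  have unit: "V a * sum V A \<approx> V a" "sum V A * V a \<approx> V a" if "a \<in> A" for a
  proof -
    have "V a * sum V A = (\<Sum>b\<in>A. V a * V b)" by (rule sum_distrib_left)
    also have "\<dots> \<approx> (\<Sum>b\<in>A. if b = a then V a else 0)"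
      using that A(2) by (intro cg_sum) (auto simp: subset_iff intro: VV VV_ne)
    also have "\<dots> = V a" using that A by simp
    finally show "V a * sum V A \<approx> V a" .
    have "sum V A * V a = (\<Sum>b\<in>A. V b * V a)" by (rule sum_distrib_right)
    also have "\<dots> \<approx> (\<Sum>b\<in>A. if b = a then V a else 0)"
      using that A(2) by (intro cg_sum) (auto simp: subset_iff intro: VV VV_ne)
    also have "\<dots> = V a" using that A by simp
    finally show "sum V A * V a \<approx> V a" .
  qed
  have AF: "sum V A \<in> F" using A by (intro FA_sum) auto
  let ?S = "\<lambda>w. Poly_Mapping.single w (Poly_Mapping.lookup x w)"
  have left: "sum V A * ?S w \<approx> ?S w" and right: "?S w * sum V A \<approx> ?S w" if w: "w \<in> K" for w
  proof -
    note Kw = K[OF w]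
    have SF: "?S w \<in> F" using Kw by (intro FA_single) auto
    have e: "s (hd w) \<in> A" "t (last w) \<in> A" using w by (auto simp: A_def)
    have hd: "?S w = gen (hd w) * Poly_Mapping.single (tl w) (Poly_Mapping.lookup x w)"
      using Kw by (simp add: gen_def mult_single plus_list_def)
    have l: "?S w = Poly_Mapping.single (butlast w) (Poly_Mapping.lookup x w) * gen (last w)"
      using Kw by (simp add: gen_def mult_single plus_list_def)
    have 1: "V (s (hd w)) * ?S w \<approx> ?S w"
    \<comment> \<open>For a one-letter word the rest is a nonzero scalar, which is not in
      \<open>F\<close>, so \<open>cg_right\<close> does not apply to it.\<close>
    proof (cases "tl w = []")
      case True
      then have "?S w = scal (Poly_Mapping.lookup x w) * gen (hd w)"
        unfolding hd by (simp add: scal_def zero_list_def mult_single gen_def plus_list_def)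
      then show ?thesis using cg_scal[of "V (s (hd w)) * gen (hd w)" "gen (hd w)" "Poly_Mapping.lookup x w"] st[OF Kw(2)]
        by (simp add: mult_scal_left)
    next
      case False
      then have "Poly_Mapping.single (tl w) (Poly_Mapping.lookup x w) \<in> F"
        using Kw by (intro FA_single) (auto dest: list.set_sel)
      then show ?thesis using st[OF Kw(2)] unfolding hd
        by (auto simp flip: mult.assoc intro: cg_right)
    qed
    have 2: "?S w * V (t (last w)) \<approx> ?S w"
    proof (cases "butlast w = []")
      case True
      then have "?S w = scal (Poly_Mapping.lookup x w) * gen (last w)"
        unfolding l by (simp add: scal_def zero_list_def mult_single gen_def plus_list_def)
      then show ?thesis using cg_scal[of "gen (last w) * V (t (last w))" "gen (last w)" "Poly_Mapping.lookup x w"] st[OF Kw(3)]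
        by (simp add: mult.assoc)
    next
      case False
      then have "Poly_Mapping.single (butlast w) (Poly_Mapping.lookup x w) \<in> F"
        using Kw by (intro FA_single) (auto dest: in_set_butlastD)
      then show ?thesis using st[OF Kw(3)] unfolding l by (auto simp: mult.assoc intro: cg_left)
    qed
    have "sum V A * ?S w \<approx> sum V A * (V (s (hd w)) * ?S w)"
      by (rule cg_left[OF cg_sym[OF 1] AF])
    also have "\<dots> = sum V A * V (s (hd w)) * ?S w" by (simp add: mult.assoc)
    also have "\<dots> \<approx> V (s (hd w)) * ?S w" by (rule cg_right[OF unit(2)[OF e(1)] SF])
    also note 1
    finally show "sum V A * ?S w \<approx> ?S w" .
    have "?S w * sum V A \<approx> ?S w * V (t (last w)) * sum V A"
      by (rule cg_right[OF cg_sym[OF 2] AF])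
    also have "\<dots> = ?S w * (V (t (last w)) * sum V A)" by (simp add: mult.assoc)
    also have "\<dots> \<approx> ?S w * V (t (last w))" by (rule cg_left[OF unit(1)[OF e(2)] SF])
    also note 2
    finally show "?S w * sum V A \<approx> ?S w" .
  qed
  have x: "(\<Sum>w\<in>K. ?S w) = x"
    unfolding K_def by (rule poly_mapping_sum_singles[symmetric])
  have "sum V A * (\<Sum>w\<in>K. ?S w) \<approx> (\<Sum>w\<in>K. ?S w)"
    unfolding sum_distrib_left by (rule cg_sum) (rule left)
  moreover have "(\<Sum>w\<in>K. ?S w) * sum V A \<approx> (\<Sum>w\<in>K. ?S w)"
    unfolding sum_distrib_right by (rule cg_sum) (rule right)
  ultimately show ?thesis using A unfolding x by blast
qed

text \<open>Take the least degree d with \<open>hpart d a * V z \<notin> J\<close>. In degree d of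
  \<open>a * Y\<close> this component meets only \<open>scal c * V z\<close>; a closed path of
  length l > 0 meets the component of degree d - l, and that product lies in \<open>J\<close> by the
  choice of d. As \<open>J\<close> is graded, the remaining term must lie in \<open>J\<close> too, a
  contradiction.\<close>

lemma lowest_degree_cancel:
  assumes z: "z \<in> verts G" and c: "c \<noteq> 0" and Q: "\<forall>q\<in>Q. awalk z q z \<and> q \<noteq> []"
    and Y: "Y \<approx> scal c * V z + (\<Sum>q\<in>Q. scal (k q) * rp q z)"
    and a: "a \<in> F" "a * Y \<in> J"
  shows "a * V z \<in> J"
proof (rule ccontr)
  assume not: "a * V z \<notin> J"
  define D where "D = {d \<in> wdeg ` Poly_Mapping.keys a. hpart d a * V z \<notin> J}"
  have "D \<noteq> {}"
  proof
    assume "D = {}"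
    then have "(\<Sum>d\<in>wdeg ` Poly_Mapping.keys a. hpart d a * V z) \<in> J"
      by (intro fa_left_ideal_sum[OF lJ]) (auto simp: D_def)
    then show False using not by (simp add: sum_hpart flip: sum_distrib_right)
  qed
  moreover have fin: "finite D" by (simp add: D_def)
  ultimately have d: "Min D \<in> D" by (rule Min_in[rotated])
  let ?d = "Min D"
  have low: "hpart i a * V z \<in> J" if "i < ?d" for i
  proof (cases "i \<in> wdeg ` Poly_Mapping.keys a")
    case True
    moreover have "i \<notin> D" using that Min_le[OF fin, of i] by force
    ultimately show ?thesis by (simp add: D_def)
  next
    case False
    then have "hpart i a = 0" by (rule hpart_eq_0)
    then show ?thesis using Jc(2) by simp
  qed
  have "a * (scal c * V z + (\<Sum>q\<in>Q. scal (k q) * rp q z)) \<in> J"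
    using cg_mem[OF cg_left[OF Y a(1)]] a(2) by simp
  then have "hpart ?d (a * (scal c * V z + (\<Sum>q\<in>Q. scal (k q) * rp q z))) \<in> J"
    using graded_J by (simp add: graded_def)
  moreover have "hpart ?d (a * (scal c * V z + (\<Sum>q\<in>Q. scal (k q) * rp q z))) =
      scal c * (hpart ?d a * V z) + (\<Sum>q\<in>Q. scal (k q) * (hpart (?d - int (length q)) a * rp q z))"
    by (simp add: distrib_left sum_distrib_left mult_scal_left hpart_add hpart_sum
        hpart_mult_homogeneous(1)[OF homogeneous_scal] hpart_mult_homogeneous(2)[OF homogeneous_gen(1)]
        hpart_mult_homogeneous(2)[OF homogeneous_real_path])
  moreover have "(\<Sum>q\<in>Q. scal (k q) * (hpart (?d - int (length q)) a * rp q z)) \<in> J"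
  proof (intro fa_left_ideal_sum[OF lJ] Jc(4))
    fix q assume q: "q \<in> Q"
    have aF: "hpart (?d - int (length q)) a \<in> F" by (rule hpart_FA[OF a(1)])
    have rF: "rp q z \<in> F" using Q q rp_F by blast
    have "hpart (?d - int (length q)) a * V z \<in> J" using Q q by (intro low) auto
    then have "hpart (?d - int (length q)) a * V z * rp q z \<in> J" by (rule Jc(8)[OF rF])
    moreover have "hpart (?d - int (length q)) a * V z * rp q z \<approx> hpart (?d - int (length q)) a * rp q z"
      using cg_left[OF V_rp aF] Q q by (simp add: mult.assoc)
    ultimately show "hpart (?d - int (length q)) a * rp q z \<in> J" by (simp add: cg_mem)
  qed
  ultimately have "scal c * (hpart ?d a * V z) \<in> J"
    using Jc(7)[of "scal c * (hpart ?d a * V z) + (\<Sum>q\<in>Q. scal (k q) * (hpart (?d - int (length q)) a * rp q z))"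
        "\<Sum>q\<in>Q. scal (k q) * (hpart (?d - int (length q)) a * rp q z)"] by simp
  then have "hpart ?d a * V z \<in> J" using scal_J_iff[OF c] by simp
  then show False using d by (simp add: D_def)
qed

section \<open>Vertices that generate minimal left ideals\<close>

text \<open>Minimality over \<open>J\<close> of the left ideal of \<open>V w\<close>, put
  elementwise: whatever is outside \<open>J\<close> can be multiplied back to \<open>V w\<close>. In
  this form it moves along walks and can be tested on a concrete \<open>b\<close>.\<close>

definition min_vertex :: "'a \<Rightarrow> bool" where
  "min_vertex w \<longleftrightarrow> w \<in> verts G \<and> V w \<notin> J \<and>
     (\<forall>b\<in>F. b * V w \<notin> J \<longrightarrow> (\<exists>a\<in>F. V w \<approx> a * (b * V w)))"

text \<open>The left ideal \<open>F y + J\<close> is squeezed between \<open>J\<close> and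
  \<open>M\<close>. Local units, in place of a unit, show that it contains \<open>y\<close>.\<close>

lemma rel_minimal_generated:
  assumes M: "rel_minimal (lpa_gens G) J M" and y: "y \<in> M" "y \<notin> J" and x: "x \<in> M"
  shows "\<exists>a\<in>F. x \<approx> a * y"
proof -
  have lM: "fa_left_ideal (lpa_gens G) M" "J \<subseteq> M"
    and Mmin: "\<And>K. fa_left_ideal (lpa_gens G) K \<Longrightarrow> J \<subseteq> K \<Longrightarrow> K \<subseteq> M \<Longrightarrow> K = J \<or> K = M"
    using M by (auto simp: rel_minimal_def)
  note Mc = fa_left_ideal_closed[OF lM(1)]
  have yF: "y \<in> F" using y(1) by (rule Mc(1))
  let ?N = "{x \<in> F. \<exists>a\<in>F. x \<approx> a * y}"
  have JN: "J \<subseteq> ?N"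
  proof
    fix j assume "j \<in> J"
    then show "j \<in> ?N" using Jc(1) by (auto simp: cg_0 intro!: bexI[of _ 0])
  qed
  have "fa_left_ideal (lpa_gens G) ?N"
    unfolding fa_left_ideal_iff
  proof (intro conjI ballI allI)
    show "?N \<subseteq> F" by blast
    show "0 \<in> ?N" using JN Jc(2) by blast
  next
    fix s t assume "s \<in> ?N" "t \<in> ?N"
    then obtain a b where "s \<in> F" "t \<in> F" "a \<in> F" "b \<in> F" "s \<approx> a * y" "t \<approx> b * y" by blast
    then show "s + t \<in> ?N" using cg_add[of s "a * y" t "b * y"]
      by (auto simp: distrib_right intro!: bexI[of _ "a + b"])
  next
    fix d s assume "s \<in> ?N"
    then obtain a where "s \<in> F" "a \<in> F" "s \<approx> a * y" by blast
    then show "scal d * s \<in> ?N" using cg_scal[of s "a * y" d]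
      by (auto simp: mult.assoc intro!: bexI[of _ "scal d * a"])
  next
    fix b s :: "('a, 'b) lpa_gen list \<Rightarrow>\<^sub>0 'k" assume "b \<in> F" "s \<in> ?N"
    then obtain a where "b \<in> F" "s \<in> F" "a \<in> F" "s \<approx> a * y" by blast
    then show "b * s \<in> ?N" using cg_left[of s "a * y" b]
      by (auto simp: mult.assoc intro!: bexI[of _ "b * a"])
  qed
  moreover have "?N \<subseteq> M"
  proof
    fix s assume "s \<in> ?N"
    then obtain a where a: "a \<in> F" "s \<approx> a * y" by blast
    then have "s - a * y \<in> M" using lM(2) by (auto simp: cg_def)
    from Mc(3)[OF this Mc(5)[OF a(1) y(1)]] show "s \<in> M" by simp
  qed
  ultimately have "?N = J \<or> ?N = M" using JN by (intro Mmin)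
  moreover have "y \<in> ?N"
  proof -
    obtain A where A: "finite A" "A \<subseteq> verts G" "sum V A * y \<approx> y" using local_units[OF yF] by blast
    then have "sum V A \<in> F" by (intro FA_sum) auto
    then show ?thesis using cg_sym[OF A(3)] yF by blast
  qed
  ultimately have "?N = M" using y(2) by blast
  then show ?thesis using x by blast
qed

text \<open>Reduction of some \<open>x\<close> in \<open>M\<close> gives
  \<open>y = gp p1 z * x\<close> in \<open>M\<close>, whereas \<open>y * rp p z\<close> may lie
  outside the left ideal \<open>M\<close>. Minimality is therefore applied to \<open>y\<close>; only
  the resulting relation modulo \<open>J\<close> is multiplied by \<open>rp p z\<close>, and then
  cancelled down to \<open>V z\<close>.\<close>

lemma rel_minimal_min_vertex:
  assumes M: "rel_minimal (lpa_gens G) J M"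
  obtains y w where "y \<in> M" "y \<notin> J" "min_vertex w" "V w * y \<approx> y"
proof -
  have lM: "fa_left_ideal (lpa_gens G) M" "J \<subseteq> M" "M \<noteq> J"
    using M by (auto simp: rel_minimal_def)
  note Mc = fa_left_ideal_closed[OF lM(1)]
  obtain x where x: "x \<in> M" "x \<notin> J" using lM by blast
  have xF: "x \<in> F" using x(1) by (rule Mc(1))
  obtain A where A: "finite A" "A \<subseteq> verts G" "x * sum V A \<approx> x" using local_units[OF xF] by blast
  have "x * sum V A \<notin> J" using cg_mem[OF A(3)] x(2) by simp
  then have "\<exists>v\<in>A. x * V v \<notin> J"
    using fa_left_ideal_sum[OF lJ, of A "\<lambda>v. x * V v"] unfolding sum_distrib_left by blast
  then obtain v where v: "v \<in> verts G" "x * V v \<notin> J" using A by blast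
  obtain p u p1 z c Q k where r: "awalk v p z" "awalk u p1 z" "c \<noteq> 0" "finite Q"
    "\<forall>q\<in>Q. awalk z q z \<and> q \<noteq> []" "V z \<notin> J"
    "gp p1 z * x * rp p z \<approx> scal c * V z + (\<Sum>q\<in>Q. scal (k q) * rp q z)"
    by (rule reduction[OF xF v])
  have z: "z \<in> verts G" using r(1) by (rule awalk_last_in_verts)
  have pF: "rp p z \<in> F" by (rule rp_F[OF r(1)])
  have gF: "gp p1 z \<in> F" by (rule gp_F[OF r(2)])
  define y where "y = gp p1 z * x"
  have yM: "y \<in> M" unfolding y_def by (rule Mc(5)[OF gF x(1)])
  have yF: "y \<in> F" using yM by (rule Mc(1))
  note cancel = lowest_degree_cancel[OF z r(3,5,7)[folded y_def]]
  have VVn: "V z * V z \<notin> J" using cg_mem[OF VV[OF z]] r(6) by simp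
  have ynJ: "y \<notin> J"
  proof
    assume "y \<in> J"
    then have "V z * (y * rp p z) \<in> J" using z Jc(5)[OF _ Jc(8)[OF pF]] by simp
    then have "V z * V z \<in> J" using z by (intro cancel) auto
    then show False using VVn by simp
  qed
  have Vy: "V z * y \<approx> y"
    using cg_right[OF V_gp[OF r(2)] xF] by (simp add: y_def mult.assoc)
  have "\<exists>a\<in>F. V z \<approx> a * (b * V z)" if b: "b \<in> F" "b * V z \<notin> J" for b
  proof -
    have "b * (y * rp p z) \<notin> J" using cancel[of b] b by blast
    then have bn: "b * y \<notin> J" using Jc(8)[OF pF, of "b * y"] by (auto simp: mult.assoc)
    obtain a where a: "a \<in> F" "y \<approx> a * (b * y)"
      using rel_minimal_generated[OF M Mc(5)[OF b(1) yM] bn yM] by blast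
    have "V z * y - a * (b * y) \<approx> y - y" using Vy cg_sym[OF a(2)] by (rule cg_diff)
    then have "(V z - a * b) * y \<in> J" by (simp add: cg_0 left_diff_distrib mult.assoc)
    then have "(V z - a * b) * (y * rp p z) \<in> J"
      using Jc(8)[OF pF, of "(V z - a * b) * y"] by (simp add: mult.assoc)
    then have "(V z - a * b) * V z \<in> J" using a b z by (intro cancel) auto
    then have "V z * V z \<approx> a * (b * V z)" by (simp add: cg_def left_diff_distrib mult.assoc)
    then show ?thesis using a(1) cg_trans[OF cg_sym[OF VV[OF z]]] by blast
  qed
  then have "min_vertex z" using z r(6) by (simp add: min_vertex_def)
  then show ?thesis using that yM ynJ Vy by blast
qed

text \<open>If \<open>b * V z\<close> is outside \<open>J\<close>, so is
  \<open>b * gp p z * V w\<close>. Multiplying it back to \<open>V w\<close> and placing the result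
  between \<open>gp p z\<close> and \<open>rp p z\<close> recovers \<open>V z\<close>.\<close>

lemma min_vertex_walk:
  assumes w: "min_vertex w" and p: "awalk w p z" and z: "V z \<notin> J"
  shows "min_vertex z"
  unfolding min_vertex_def
proof (intro conjI ballI impI)
  show "z \<in> verts G" using p by (rule awalk_last_in_verts)
  show "V z \<notin> J" by (rule z)
  have rF: "rp p z \<in> F" by (rule rp_F[OF p])
  have gF: "gp p z \<in> F" by (rule gp_F[OF p])
  fix b assume b: "b \<in> F" "b * V z \<notin> J"
  have "b * gp p z * V w \<notin> J"
  proof
    assume "b * gp p z * V w \<in> J"
    moreover have "b * gp p z * V w \<approx> b * gp p z"
      using cg_left[OF gp_V[OF p] b(1)] by (simp add: mult.assoc)
    ultimately have "b * gp p z \<in> J" by (simp add: cg_mem)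
    then have "b * gp p z * rp p z \<in> J" by (rule Jc(8)[OF rF])
    moreover have "b * gp p z * rp p z \<approx> b * V z"
      using cg_left[OF gp_rp[OF p] b(1)] by (simp add: mult.assoc)
    ultimately show False using b(2) by (simp add: cg_mem)
  qed
  then obtain a where a: "a \<in> F" "V w \<approx> a * (b * gp p z * V w)"
    using w FA_mult[OF b(1) gF] unfolding min_vertex_def by blast
  have "V z \<approx> gp p z * rp p z" by (rule cg_sym[OF gp_rp[OF p]])
  also have "gp p z * rp p z \<approx> gp p z * V w * rp p z"
    by (rule cg_right[OF cg_sym[OF gp_V[OF p]] rF])
  also have "\<dots> \<approx> gp p z * (a * (b * gp p z * V w)) * rp p z"
    by (rule cg_right[OF cg_left[OF a(2) gF] rF])
  also have "\<dots> = gp p z * a * b * (gp p z * (V w * rp p z))" by (simp add: mult.assoc)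
  also have "\<dots> \<approx> gp p z * a * b * (gp p z * rp p z)"
    using a b gF by (intro cg_left V_rp[OF p]) auto
  also have "\<dots> \<approx> gp p z * a * b * V z"
    using a b gF by (intro cg_left gp_rp[OF p]) auto
  also have "\<dots> = gp p z * a * (b * V z)" by (simp add: mult.assoc)
  finally show "\<exists>a\<in>F. V z \<approx> a * (b * V z)" using a gF by blast
qed

lemma Ed_notin_J:
  assumes "e \<in> arcs G" "V (head G e) \<notin> J"
  shows "Ed e \<notin> J" "Ed e * Gh e \<notin> J"
proof -
  show E: "Ed e \<notin> J"
    using Jc(5)[of "Gh e" "Ed e"] cg_mem[OF GE[OF assms(1)]] assms by auto
  show "Ed e * Gh e \<notin> J"
  proof
    assume "Ed e * Gh e \<in> J"
    then have "Ed e * Gh e * Ed e \<in> J" using Jc(8)[of "Ed e" "Ed e * Gh e"] assms by simp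
    moreover have "Ed e * Gh e * Ed e \<approx> Ed e * V (head G e)"
      using cg_left[OF GE, of e "Ed e"] assms by (simp add: mult.assoc)
    moreover have "Ed e * V (head G e) \<approx> Ed e" using assms by (intro EV)
    ultimately show False using E by (simp add: cg_mem)
  qed
qed

text \<open>Test minimality on the idempotent \<open>Ed e * Gh e\<close>, which generates all of
  \<open>V w\<close> from the left. A different edge \<open>f\<close> then becomes
  \<open>a * Ed e * Gh e * Ed f\<close>, which is zero modulo \<open>J\<close>, although
  \<open>Ed f\<close> is not in \<open>J\<close>.\<close>

lemma min_vertex_edge:
  assumes w: "min_vertex w" and e: "e \<in> out_arcs G w" "V (head G e) \<notin> J"
    and f: "f \<in> out_arcs G w" "V (head G f) \<notin> J"
  shows "e = f"
proof (rule ccontr)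
  assume ne: "e \<noteq> f"
  have eG: "e \<in> arcs G" "tail G e = w" and fG: "f \<in> arcs G" "tail G f = w" using e f by auto
  have b: "Ed e * Gh e * V w \<approx> Ed e * Gh e"
    using cg_left[OF GV, of e "Ed e"] eG by (simp add: mult.assoc)
  then have "Ed e * Gh e * V w \<notin> J" using Ed_notin_J(2)[OF eG(1) e(2)] by (simp add: cg_mem)
  moreover have "Ed e * Gh e \<in> F" using eG by auto
  ultimately obtain a where a: "a \<in> F" "V w \<approx> a * (Ed e * Gh e * V w)"
    using w unfolding min_vertex_def by blast
  have "Ed f \<approx> V w * Ed f" using cg_sym[OF VE[OF fG(1)]] fG by simp
  also have "\<dots> \<approx> a * (Ed e * Gh e * V w) * Ed f" using fG by (intro cg_right[OF a(2)]) auto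
  also have "\<dots> = a * Ed e * Gh e * (V w * Ed f)" by (simp add: mult.assoc)
  also have "\<dots> \<approx> a * Ed e * Gh e * Ed f" using a eG VE[OF fG(1)] fG by (intro cg_left) auto
  also have "\<dots> = a * Ed e * (Gh e * Ed f)" by (simp add: mult.assoc)
  also have "\<dots> \<approx> a * Ed e * 0" using a eG fG ne by (intro cg_left GE_ne) auto
  finally have "Ed f \<in> J" by (simp add: cg_0)
  then show False using Ed_notin_J(1)[OF fG(1) f(2)] by simp
qed

text \<open>
  If \<open>V w - c\<close> has a left inverse \<open>a\<close> for a cycle \<open>c\<close>, then the components of \<open>a\<close> satisfy
  \<open>a\<^sub>d = a\<^sub>d\<^sub>-\<^sub>n c + \<delta>\<^sub>d\<close>, so every power of \<open>c\<close> occurs in \<open>a\<close>, a contradiction.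
\<close>

lemma min_vertex_no_cycle:
  assumes w: "min_vertex w" and q: "awalk w q w" "q \<noteq> []"
  shows False
proof -
  have wv: "w \<in> verts G" and wJ: "V w \<notin> J" using w by (auto simp: min_vertex_def)
  define n where "n = int (length q)"
  have n: "n > 0" using q by (simp add: n_def)
  have qF: "rp q w \<in> F" by (rule rp_F[OF q(1)])
  have hq: "homogeneous n (rp q w)" unfolding n_def by (rule homogeneous_real_path)
  define b where "b = V w - rp q w"
  have bF: "b \<in> F" using wv qF by (simp add: b_def)
  have bV: "b * V w \<approx> b" unfolding b_def left_diff_distrib by (rule cg_diff[OF VV[OF wv] rp_V[OF q(1)]])
  have "hpart 0 b = V w"
    using n by (simp add: b_def hpart_diff hpart_homogeneous[OF hq] hpart_homogeneous[OF homogeneous_gen(1)])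
  moreover have "hpart 0 b \<in> J" if "b \<in> J" using graded_J that unfolding graded_def by blast
  ultimately have "b \<notin> J" using wJ by auto
  then have "b * V w \<notin> J" using bV by (simp add: cg_mem)
  then obtain a where a: "a \<in> F" "V w \<approx> a * (b * V w)" using w bF unfolding min_vertex_def by blast
  define B where "B d = hpart d a * V w" for d
  have BF: "B d \<in> F" for d using hpart_FA[OF a(1)] wv by (auto simp: B_def)
  have "a * (b * V w) \<approx> a * b" by (rule cg_left[OF bV a(1)])
  also have "a * b = a * V w - a * rp q w" by (simp add: b_def right_diff_distrib)
  also have "\<dots> \<approx> a * V w - a * (V w * rp q w)"
    by (intro cg_diff cg_refl cg_left[OF cg_sym[OF V_rp[OF q(1)]] a(1)])
  finally have "V w \<approx> a * V w - a * (V w * rp q w)" by (rule cg_trans[OF a(2)])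
  then have "hpart d (V w) \<approx> hpart d (a * V w - a * V w * rp q w)" for d
    by (intro cg_hpart) (simp add: mult.assoc)
  moreover have "hpart d (a * V w - a * V w * rp q w) = B d - B (d - n) * rp q w" for d
    by (simp add: hpart_diff B_def hpart_mult_homogeneous(2)[OF hq] hpart_mult_homogeneous(2)[OF homogeneous_gen(1)])
  ultimately have rec: "hpart d (V w) \<approx> B d - B (d - n) * rp q w" for d by simp
  have B0: "B d = 0" if "d \<notin> wdeg ` Poly_Mapping.keys a" for d
    using that by (simp add: B_def hpart_eq_0)
  have step: "B d \<approx> B (d - n) * rp q w" if "d \<noteq> 0" for d
    using cg_sym[OF rec[of d]] that by (simp add: hpart_homogeneous[OF homogeneous_gen(1)] cg_def)
  obtain m where m: "\<And>d. d \<in> wdeg ` Poly_Mapping.keys a \<Longrightarrow> - int m < d \<and> d < int m"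
  proof -
    have "finite (wdeg ` Poly_Mapping.keys a)" by simp
    then obtain m where "\<And>d. d \<in> wdeg ` Poly_Mapping.keys a \<Longrightarrow> nat \<bar>d\<bar> < m"
      using finite_nat_set_iff_bounded[of "(\<lambda>d. nat \<bar>d\<bar>) ` wdeg ` Poly_Mapping.keys a"] by auto
    then have "- int m < d \<and> d < int m" if "d \<in> wdeg ` Poly_Mapping.keys a" for d
      using that by fastforce
    then show ?thesis by (rule that)
  qed
  \<comment> \<open>Degrees up to \<open>- m\<close> are outside the support of \<open>a\<close>,
    and the recursion carries the vanishing modulo \<open>J\<close> upwards. The index
    \<open>i\<close> counts how far it has risen; it stops before degree 0, where \<open>V w\<close>
    enters.\<close>
  have neg: "d < 0 \<Longrightarrow> d < int i - int m \<Longrightarrow> B d \<in> J" for i :: nat and d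
  proof (induction i arbitrary: d)
    case 0
    then have "B d = 0" using m[of d] by (intro B0) auto
    then show ?case using Jc(2) by simp
  next
    case (Suc i)
    then have "B (d - n) \<in> J" using n by (intro Suc.IH) auto
    then have "B (d - n) * rp q w \<in> J" by (rule Jc(8)[OF qF])
    then show ?case using cg_mem[OF step[of d]] Suc.prems by simp
  qed
  have "\<exists>r. awalk w r w \<and> B (int i * n) \<approx> rp r w" for i :: nat
  proof (induction i)
    case 0
    have "B (0 - n) \<in> J" using n by (intro neg[where i = m]) auto
    then have "B (0 - n) * rp q w \<in> J" by (rule Jc(8)[OF qF])
    from Jc(6)[OF this] have "B 0 - B (0 - n) * rp q w \<approx> B 0" by (simp add: cg_def)
    from cg_trans[OF rec[of 0] this] have "V w \<approx> B 0"
      by (simp add: hpart_homogeneous[OF homogeneous_gen(1)])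
    from cg_sym[OF this] show ?case using wv by (intro exI[of _ "[]"]) (simp add: awalk_Nil_iff)
  next
    case (Suc i)
    then obtain r where r: "awalk w r w" "B (int i * n) \<approx> rp r w" by blast
    have 1: "int (Suc i) * n \<noteq> 0" using n by simp
    have 2: "int (Suc i) * n - n = int i * n" by (simp add: algebra_simps)
    have "B (int (Suc i) * n) \<approx> B (int i * n) * rp q w" using step[OF 1] unfolding 2 .
    also have "\<dots> \<approx> rp r w * rp q w" by (rule cg_right[OF r(2) qF])
    also have "\<dots> \<approx> rp (r @ q) w" by (rule rp_append[OF r(1) q(1)])
    finally show ?case using r q by (intro exI[of _ "r @ q"]) auto
  qed
  then obtain r where r: "awalk w r w" "B (int m * n) \<approx> rp r w" by blast
  \<comment> \<open>Degree \<open>m * n\<close> is beyond the support of \<open>a\<close>, yet this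
    component is congruent to a closed path, whose ghost path would bring \<open>V w\<close> into
    \<open>J\<close>.\<close>
  have "int m \<le> int m * n" using n by (simp add: mult_le_cancel_left1)
  then have "B (int m * n) = 0" using m[of "int m * n"] by (intro B0) auto
  then have "rp r w \<in> J" using cg_mem[OF r(2)] Jc(2) by simp
  then have "gp r w * rp r w \<in> J" by (rule Jc(5)[OF gp_F[OF r(1)]])
  then show False using gp_rp[OF r(1)] wJ by (simp add: cg_mem)
qed

text \<open>The edge taken at each vertex of the walk leads on to \<open>z\<close> and so ends
  outside \<open>J\<close>. By \<open>line\<close> all other edges there end in \<open>J\<close>,
  and the expansion of the vertex reduces to the single summand \<open>Ed e * Gh e\<close>.\<close>

lemma line_walk:
  assumes p: "awalk v p z" and z: "V z \<notin> J"
    and line: "\<And>u q e f. awalk v q u \<Longrightarrow> e \<in> out_arcs G u \<Longrightarrow> f \<in> out_arcs G u \<Longrightarrow>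
      V (head G e) \<notin> J \<Longrightarrow> V (head G f) \<notin> J \<Longrightarrow> e = f"
  shows "rp p z * gp p z \<approx> V v"
  using p line
proof (induction p arbitrary: v)
  case Nil
  then show ?case by (auto simp: awalk_Nil_iff VV)
next
  case (Cons e p)
  then have e: "e \<in> arcs G" "tail G e = v" "awalk (head G e) p z" by (auto simp: awalk_Cons_iff)
  have vG: "v \<in> verts G" using e by auto
  have hn: "V (head G e) \<notin> J" using V_J_walk[OF e(3)] z by blast
  have IH: "rp p z * gp p z \<approx> V (head G e)"
  proof (rule Cons.IH[OF e(3)])
    fix u q e' f' assume a: "awalk (head G e) q u" "e' \<in> out_arcs G u" "f' \<in> out_arcs G u"
      "V (head G e') \<notin> J" "V (head G f') \<notin> J"
    have "awalk v (e # q) u" using a(1) e by (simp add: awalk_Cons_iff)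
    then show "e' = f'" by (rule Cons.prems(2)[OF _ a(2-5)])
  qed
  have other: "Ed f * Gh f \<in> J" if "f \<in> out_arcs G v" "f \<noteq> e" for f
  proof -
    have "awalk v [] v" using vG by (simp add: awalk_Nil_iff)
    then have "V (head G f) \<in> J" using Cons.prems(2)[of "[]" v e f] that e hn by auto
    then have "Ed f * V (head G f) * Gh f \<in> J"
      using that Jc(8)[of "Gh f" "Ed f * V (head G f)"] Jc(5)[of "Ed f" "V (head G f)"] by simp
    moreover have "Ed f * V (head G f) * Gh f \<approx> Ed f * Gh f"
      using that by (intro cg_right EV) auto
    ultimately show ?thesis by (simp add: cg_mem)
  qed
  have eo: "e \<in> out_arcs G v" using e by simp
  have fin: "finite (out_arcs G v)" using row_fin vG by (simp add: row_finite_def)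
  have "rp (e # p) z * gp (e # p) z = Ed e * (rp p z * gp p z) * Gh e" by (simp add: mult.assoc)
  also have "\<dots> \<approx> Ed e * V (head G e) * Gh e" using e IH by (intro cg_right cg_left) auto
  also have "\<dots> \<approx> Ed e * Gh e" using e by (intro cg_right EV) auto
  also have "\<dots> = (\<Sum>f\<in>out_arcs G v. if f = e then Ed e * Gh e else 0)" using eo fin by simp
  also have "\<dots> \<approx> (\<Sum>f\<in>out_arcs G v. Ed f * Gh f)"
    using other Jc(2,6) by (intro cg_sum) (auto simp: cg_def)
  also have "\<dots> \<approx> V v"
    using eo fin vG by (intro cg_sym[OF CK]) (auto simp: regular_vertex_def)
  finally show ?case .
qed

text \<open>The set is the preimage of the left ideal generated by \<open>v\<close>. For
  \<open>x\<close> in a left ideal properly above \<open>J\<close>, acyclicity removes the closed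
  paths from the reduction: \<open>gp p1 z * x * rp p z \<approx> scal c * V z\<close>. As
  \<open>rp p z * gp p z\<close> is congruent to \<open>V v\<close>, the right factor can be undone,
  and \<open>V v\<close> is a left multiple of \<open>x\<close> modulo \<open>J\<close>.\<close>

lemma line_vertex_minimal:
  assumes v: "v \<in> verts G" "V v \<notin> J"
    and line: "\<And>u q e f. awalk v q u \<Longrightarrow> e \<in> out_arcs G u \<Longrightarrow> f \<in> out_arcs G u \<Longrightarrow>
      V (head G e) \<notin> J \<Longrightarrow> V (head G f) \<notin> J \<Longrightarrow> e = f"
    and acyclic: "\<And>u q r. awalk v q u \<Longrightarrow> awalk u r u \<Longrightarrow> r = []"
  shows "rel_minimal (lpa_gens G) J {x \<in> F. x * V v \<approx> x}"
proof -
  let ?M = "{x \<in> F. x * V v \<approx> x}"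
  have VF: "V v \<in> F" using v by simp
  have JM: "J \<subseteq> ?M"
  proof
    fix j assume "j \<in> J"
    then show "j \<in> ?M" using Jc(1)[of j] Jc(7)[OF Jc(8)[OF VF, of j], of j] by (simp add: cg_def)
  qed
  have lM: "fa_left_ideal (lpa_gens G) ?M"
    unfolding fa_left_ideal_iff
  proof (intro conjI ballI allI)
    fix b s :: "('a, 'b) lpa_gen list \<Rightarrow>\<^sub>0 'k" assume "b \<in> F" "s \<in> ?M"
    then show "b * s \<in> ?M" using cg_left[of "s * V v" s b] by (auto simp: mult.assoc)
  next
    fix s t assume "s \<in> ?M" "t \<in> ?M"
    then show "s + t \<in> ?M" using cg_add[of "s * V v" s] by (auto simp: distrib_right)
  next
    fix d s assume "s \<in> ?M"
    then show "scal d * s \<in> ?M" using cg_scal[of "s * V v" s d] by (auto simp: mult.assoc)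
  qed auto
  have VM: "V v \<in> ?M" using VF VV v by simp
  have "K = J \<or> K = ?M" if K: "fa_left_ideal (lpa_gens G) K" "J \<subseteq> K" "K \<subseteq> ?M" for K
  proof (rule disjCI)
    assume "K \<noteq> ?M"
    note Kc = fa_left_ideal_closed[OF K(1)]
    show "K = J"
    proof (rule ccontr)
      assume "K \<noteq> J"
      then obtain x where x: "x \<in> K" "x \<notin> J" using K(2) by blast
      have xF: "x \<in> F" and xV: "x * V v \<approx> x" using x(1) K(3) by auto
      have xVn: "x * V v \<notin> J" using cg_mem[OF xV] x(2) by simp
      obtain p u p1 z c Q k where r: "awalk v p z" "awalk u p1 z" "c \<noteq> 0" "finite Q"
        "\<forall>q\<in>Q. awalk z q z \<and> q \<noteq> []" "V z \<notin> J"
        "gp p1 z * x * rp p z \<approx> scal c * V z + (\<Sum>q\<in>Q. scal (k q) * rp q z)"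
        by (rule reduction[OF xF v(1) xVn])
      have "Q = {}" using r(5) acyclic[OF r(1)] by blast
      then have y: "gp p1 z * x * rp p z \<approx> scal c * V z" using r(7) by simp
      have pF: "rp p z \<in> F" and gF: "gp p z \<in> F" and g1F: "gp p1 z \<in> F"
        using rp_F gp_F r(1,2) by blast+
      have lw: "rp p z * gp p z \<approx> V v" by (rule line_walk[OF r(1,6) line])
      let ?a = "rp p z * gp p1 z"
      have "?a * x \<approx> ?a * (x * V v)" using pF g1F by (intro cg_left cg_sym[OF xV]) auto
      also have "\<dots> \<approx> ?a * (x * (rp p z * gp p z))"
        using pF g1F xF by (intro cg_left cg_sym[OF lw]) auto
      also have "\<dots> = rp p z * (gp p1 z * x * rp p z) * gp p z" by (simp add: mult.assoc)
      also have "\<dots> \<approx> rp p z * (scal c * V z) * gp p z"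
        using pF gF by (intro cg_right cg_left y) auto
      also have "\<dots> = scal c * (rp p z * V z * gp p z)" by (simp add: mult_scal_left mult.assoc)
      also have "\<dots> \<approx> scal c * (rp p z * gp p z)"
        by (intro cg_scal cg_right rp_V[OF r(1)] gF)
      also have "\<dots> \<approx> scal c * V v" by (rule cg_scal[OF lw])
      finally have "scal (inverse c) * (?a * x) \<approx> scal (inverse c) * (scal c * V v)" by (rule cg_scal)
      also have "scal (inverse c) * (scal c * V v) = V v"
        using r(3) by (simp add: scal_mult flip: mult.assoc)
      finally have d: "V v - scal (inverse c) * (?a * x) \<in> K"
        using cg_sym K(2) unfolding cg_def by blast
      have "scal (inverse c) * (?a * x) \<in> K" using pF g1F x(1) by (intro Kc(4) Kc(5)) auto
      from Kc(3)[OF d this] have VK: "V v \<in> K" by simp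
      have "s \<in> K" if s: "s \<in> ?M" for s
      proof -
        have sV: "s * V v \<in> K" using s Kc(5)[OF _ VK] by blast
        have "s - s * V v \<in> K" using s cg_sym[of "s * V v" s] K(2) by (auto simp: cg_def)
        from Kc(3)[OF this sV] show ?thesis by simp
      qed
      then show False using \<open>K \<noteq> ?M\<close> K(3) by blast
    qed
  qed
  moreover have "?M \<noteq> J" using VM v(2) by blast
  ultimately show ?thesis using lM JM unfolding rel_minimal_def by blast
qed

end

section \<open>The socle series of a Leavitt path algebra\<close>

context wf_digraph
begin

text \<open>A library cycle through \<open>w\<close> is rotated so as to start at \<open>w\<close>.
  Conversely, keep the first edge of a closed walk and replace the rest by a walk back to
  \<open>w\<close> without repeated vertices.\<close>

lemma on_cycle_iff: "on_cycle G w \<longleftrightarrow> (\<exists>q. awalk w q w \<and> q \<noteq> [])"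
proof
  assume "on_cycle G w"
  then obtain u p where p: "cycle p" "awalk u p u" "w \<in> set (awalk_verts u p)"
    by (auto simp: on_cycle_def)
  then obtain q r where qr: "p = q @ r" "awalk u q w" "awalk w r u"
    using awalk_decomp[OF p(2,3)] by auto
  have "awalk w (r @ q) w" using qr by auto
  moreover have "r @ q \<noteq> []" using p(1) qr(1) by (auto simp: cycle_def)
  ultimately show "\<exists>q. awalk w q w \<and> q \<noteq> []" by blast
next
  assume "\<exists>q. awalk w q w \<and> q \<noteq> []"
  then obtain e q where q: "awalk w (e # q) w" by (metis neq_Nil_conv)
  then have e: "e \<in> arcs G" "tail G e = w" "awalk (head G e) q w" by (auto simp: awalk_Cons_iff)
  then obtain r where r: "apath (head G e) r w"
    using reachable_apath reachable_awalk by blast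
  then have "awalk w (e # r) w" "distinct (tl (awalk_verts w (e # r)))"
    using e by (auto simp: awalk_Cons_iff apath_def)
  moreover have "w \<in> set (awalk_verts w (e # r))"
    using e by simp
  ultimately show "on_cycle G w"
    unfolding on_cycle_def cycle_def by blast
qed

section \<open>Trees, the set of the theorem, and the next socle\<close>

lemma tree_of_iff: "w \<in> tree_of G v \<longleftrightarrow> (\<exists>p. awalk v p w)"
  by (simp add: tree_of_def reachable_awalk)

text \<open>The set of the theorem with an arbitrary \<open>H\<close> in place of
  \<open>P_l\<close>; for \<open>H = {}\<close> it consists of the line points when the graph is
  row-finite.\<close>

definition line_set :: "'a set \<Rightarrow> 'a set" where
  "line_set H = {v \<in> verts G. acyclic_tree G v \<and> (\<forall>w\<in>tree_of G v. ranges G w \<subseteq>\<^sup>1 H)}"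

lemma acyclic_tree_iff: "acyclic_tree G v \<longleftrightarrow> (\<forall>p w q. awalk v p w \<and> awalk w q w \<longrightarrow> q = [])"
  by (auto simp: acyclic_tree_def tree_of_iff on_cycle_iff)

lemma row_finite_ranges:
  assumes "row_finite G" "w \<in> verts G"
  shows "ranges G w \<subseteq>\<^sup>1 H \<longleftrightarrow>
    (\<forall>e\<in>out_arcs G w. \<forall>f\<in>out_arcs G w. head G e \<notin> H \<longrightarrow> head G f \<notin> H \<longrightarrow> e = f)"
proof -
  have fin: "finite (out_arcs G w)" using assms by (simp add: row_finite_def)
  have fin': "finite {e \<in> out_arcs G w. head G e \<notin> H}"
    by (rule finite_subset[OF _ fin]) auto
  show ?thesis
    unfolding ranges_subseteq1_iff_arcs[OF fin] One_nat_def card_le_Suc0_iff_eq[OF fin'] by blast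
qed

lemma line_set_iff:
  assumes "row_finite G"
  shows "v \<in> line_set H \<longleftrightarrow> v \<in> verts G \<and> acyclic_tree G v \<and>
    (\<forall>p w. awalk v p w \<longrightarrow>
      (\<forall>e\<in>out_arcs G w. \<forall>f\<in>out_arcs G w. head G e \<notin> H \<longrightarrow> head G f \<notin> H \<longrightarrow> e = f))"
proof -
  have "(\<forall>w\<in>tree_of G v. ranges G w \<subseteq>\<^sup>1 H) \<longleftrightarrow> (\<forall>p w. awalk v p w \<longrightarrow> ranges G w \<subseteq>\<^sup>1 H)"
    by (auto simp: tree_of_iff)
  also have "\<dots> \<longleftrightarrow> (\<forall>p w. awalk v p w \<longrightarrow>
      (\<forall>e\<in>out_arcs G w. \<forall>f\<in>out_arcs G w. head G e \<notin> H \<longrightarrow> head G f \<notin> H \<longrightarrow> e = f))"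
    by (intro iff_allI imp_cong refl row_finite_ranges[OF assms awalk_last_in_verts])
  finally show ?thesis by (simp add: line_set_def)
qed

text \<open>\<open>HJ\<close> lets vertices outside the ideal be identified with vertices outside
  \<open>H\<close>. \<open>acyc\<close> handles cycles inside \<open>H\<close>, which are invisible
  modulo the ideal but forbidden in \<open>line_set\<close>.\<close>

lemma rel_soc_lpa_ideal_of:
  assumes rf: "row_finite G" and H: "H \<subseteq> verts G" "hereditary G H"
    and acyc: "\<And>v. v \<in> H \<Longrightarrow> acyclic_tree G v"
    and HJ: "\<And>v. v \<in> verts G \<Longrightarrow> gen (Vertex v) \<in> (lpa_ideal_of G H :: (('a, 'b) lpa_gen list \<Rightarrow>\<^sub>0 'k::field) set) \<Longrightarrow> v \<in> H"
  shows "rel_soc (lpa_gens G) (lpa_ideal_of G H :: (('a, 'b) lpa_gen list \<Rightarrow>\<^sub>0 'k) set) = lpa_ideal_of G (line_set H)"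
proof -
  let ?J = "lpa_ideal_of G H :: (('a, 'b) lpa_gen list \<Rightarrow>\<^sub>0 'k) set"
  let ?J' = "lpa_ideal_of G (line_set H) :: (('a, 'b) lpa_gen list \<Rightarrow>\<^sub>0 'k) set"
  have JI: "fa_ideal (lpa_gens G) ?J" "lpa_relations G \<subseteq> ?J"
    "\<And>v. v \<in> H \<Longrightarrow> gen (Vertex v) \<in> ?J" "graded ?J"
    by (rule lpa_ideal_of_ideal[OF H(1)]; assumption?)+
  interpret lpa_quotient G ?J
    using rf JI by unfold_locales auto
  have HJ': "V v \<in> ?J \<longleftrightarrow> v \<in> H" if "v \<in> verts G" for v
    using that HJ JI(3) by blast
  have LP: "line_set H \<subseteq> verts G" by (auto simp: line_set_def)
  have J': "fa_ideal (lpa_gens G) ?J'" "lpa_relations G \<subseteq> ?J'"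
    "\<And>v. v \<in> line_set H \<Longrightarrow> gen (Vertex v) \<in> ?J'" "graded ?J'"
    by (rule lpa_ideal_of_ideal[OF LP]; assumption?)+
  have Hwalk: "w \<in> H" if "awalk v p w" "v \<in> H" for v p w
    using that H(2) by (induction p arbitrary: v) (auto simp: awalk_Cons_iff awalk_Nil_iff hereditary_def)
  \<comment> \<open>A walk that starts in \<open>H\<close> stays there, so none of its vertices
    emits an edge out of \<open>H\<close>.\<close>
  have HLP: "H \<subseteq> line_set H"
  proof
    fix v assume v: "v \<in> H"
    have "head G e \<in> H" if "awalk v p w" "e \<in> out_arcs G w" for p w e
      using Hwalk[OF that(1) v] H(2) that(2) by (auto simp: hereditary_def)
    then show "v \<in> line_set H" using v H(1) acyc by (auto simp: line_set_iff[OF rf])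
  qed
  have JJ': "?J \<subseteq> ?J'" using J' HLP by (intro lpa_ideal_of_least) auto
  have soc: "fa_ideal (lpa_gens G) (rel_soc (lpa_gens G) ?J)" "?J \<subseteq> rel_soc (lpa_gens G) ?J"
    by (rule rel_soc_ideal[OF JI(1)])+
  show ?thesis
  proof
    show "?J' \<subseteq> rel_soc (lpa_gens G) ?J"
    proof (rule lpa_ideal_of_least[OF soc(1)])
      show "lpa_relations G \<subseteq> rel_soc (lpa_gens G) ?J" using JI(2) soc(2) by blast
      fix v assume v: "v \<in> line_set H"
      then have vG: "v \<in> verts G" using LP by blast
      show "V v \<in> rel_soc (lpa_gens G) ?J"
      proof (cases "V v \<in> ?J")
        case True
        then show ?thesis using soc(2) by blast
      next
        case False
        have "rel_minimal (lpa_gens G) ?J {x \<in> F. cg (x * V v) x}"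
        proof (rule line_vertex_minimal[OF vG False])
          show "r = []" if "awalk v q u" "awalk u r u" for u q r
            using v that by (auto simp: line_set_iff[OF rf] acyclic_tree_iff)
          fix u q e f assume a: "awalk v q u" "e \<in> out_arcs G u" "f \<in> out_arcs G u"
            "V (head G e) \<notin> ?J" "V (head G f) \<notin> ?J"
          then have "head G e \<notin> H" "head G f \<notin> H" using HJ' by auto
          then show "e = f" using v a(1-3) unfolding line_set_iff[OF rf] by blast
        qed
        then have "{x \<in> F. cg (x * V v) x} \<subseteq> rel_soc (lpa_gens G) ?J"
          by (auto simp: rel_soc_def)
        then show ?thesis using VV[OF vG] vG by blast
      qed
    qed
  next
    have lJ': "fa_left_ideal (lpa_gens G) ?J'" using J'(1) by (simp add: fa_ideal_iff)
    have "M \<subseteq> ?J'" if M: "rel_minimal (lpa_gens G) ?J M" for M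
    proof -
      obtain y w where y: "y \<in> M" "y \<notin> ?J" "min_vertex w" "cg (V w * y) y"
        by (rule rel_minimal_min_vertex[OF M])
      have yF: "y \<in> F" using M y(1) by (auto simp: rel_minimal_def fa_left_ideal_iff)
      have wG: "w \<in> verts G" using y(3) by (simp add: min_vertex_def)
      \<comment> \<open>Minimality spreads to every vertex outside \<open>H\<close> that
        \<open>w\<close> reaches, so the results on edges and cycles apply along the whole
        tree.\<close>
      have out: "min_vertex u" if "awalk w p u" "u \<notin> H" for p u
        using min_vertex_walk[OF y(3) that(1)] HJ'[OF awalk_last_in_verts[OF that(1)]] that(2) by simp
      have "w \<in> line_set H"
        unfolding line_set_iff[OF rf] acyclic_tree_iff
      proof (intro conjI allI impI ballI)
        fix p u q assume a: "awalk w p u \<and> awalk u q u"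
        show "q = []"
        proof (cases "u \<in> H")
          case True
          have "awalk u [] u" using a by (auto simp: awalk_Nil_iff)
          then show ?thesis using acyc[OF True] a unfolding acyclic_tree_iff by blast
        next
          case False
          then show ?thesis using min_vertex_no_cycle out a by blast
        qed
      next
        fix p u e f assume a: "awalk w p u" "e \<in> out_arcs G u" "f \<in> out_arcs G u"
          "head G e \<notin> H" "head G f \<notin> H"
        then have "u \<notin> H" using H(2) by (auto simp: hereditary_def)
        then show "e = f" using min_vertex_edge[OF out[OF a(1)]] a(2-5) HJ' by auto
      qed (rule wG)
      \<comment> \<open>The line vertex \<open>w\<close> fixes \<open>y\<close> modulo
        \<open>?J\<close>, so \<open>y\<close> lies in \<open>?J'\<close>; and \<open>y\<close>
        generates \<open>M\<close> modulo \<open>?J\<close>.\<close>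
      then have "V w * y \<in> ?J'" using J'(3) fa_ideal_closed(8)[OF J'(1) yF] by blast
      then have yJ': "y \<in> ?J'"
        using y(4) JJ' fa_ideal_closed(7)[OF J'(1), of "V w * y" "V w * y - y"] by (auto simp: cg_def)
      show "M \<subseteq> ?J'"
      proof
        fix x assume "x \<in> M"
        then obtain a where a: "a \<in> F" "cg x (a * y)"
          using rel_minimal_generated[OF M y(1,2)] by blast
        then have "x - a * y \<in> ?J'" using JJ' by (auto simp: cg_def)
        from fa_ideal_closed(3)[OF J'(1) this fa_ideal_closed(5)[OF J'(1) a(1) yJ']]
        show "x \<in> ?J'" by simp
      qed
    qed
    then show "rel_soc (lpa_gens G) ?J \<subseteq> ?J'"
      unfolding rel_soc_def using lJ' JJ' by (intro Inter_lower) blast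
  qed
qed

section \<open>Saturated closures\<close>

lemma saturated_closure_least: "saturated G Y \<Longrightarrow> X \<subseteq> Y \<Longrightarrow> saturated_closure G X \<subseteq> Y"
  by (auto simp: saturated_closure_def)

lemma saturated_closure:
  assumes "X \<subseteq> verts G"
  shows "saturated G (saturated_closure G X)" "X \<subseteq> saturated_closure G X"
proof -
  have "saturated G (verts G)" by (simp add: saturated_def regular_vertex_def)
  then have "saturated_closure G X \<subseteq> verts G" using assms by (rule saturated_closure_least)
  moreover have "v \<in> saturated_closure G X"
    if v: "regular_vertex G v" "head G ` out_arcs G v \<subseteq> saturated_closure G X" for v
    unfolding saturated_closure_def
  proof (rule InterI)
    fix Y assume "Y \<in> {Y. saturated G Y \<and> X \<subseteq> Y}"
    then have Y: "saturated G Y" "saturated_closure G X \<subseteq> Y"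
      using saturated_closure_least by auto
    from order_trans[OF v(2) Y(2)] have "head G ` out_arcs G v \<subseteq> Y" .
    then show "v \<in> Y" using Y(1) v(1) by (simp add: saturated_def)
  qed
  ultimately show "saturated G (saturated_closure G X)" by (simp add: saturated_def)
  show "X \<subseteq> saturated_closure G X" by (auto simp: saturated_closure_def)
qed

text \<open>The members of the closure all of whose edges end in the closure form a saturated set
  that contains \<open>X\<close>; by minimality they are the whole closure.\<close>

lemma saturated_closure_hereditary:
  assumes X: "X \<subseteq> verts G" "hereditary G X"
  shows "hereditary G (saturated_closure G X)"
proof -
  let ?S = "saturated_closure G X"
  note S = saturated_closure[OF X(1)]
  let ?Y = "{v \<in> ?S. head G ` out_arcs G v \<subseteq> ?S}"
  have "saturated G ?Y" using S(1) by (auto simp: saturated_def)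
  moreover have "X \<subseteq> ?Y" using S(2) X(2) by (auto simp: hereditary_def)
  ultimately have SY: "?S \<subseteq> ?Y" by (rule saturated_closure_least)
  show ?thesis
    unfolding hereditary_def
  proof (intro ballI impI)
    fix e assume e: "e \<in> arcs G" "tail G e \<in> ?S"
    then have "head G ` out_arcs G (tail G e) \<subseteq> ?S" using SY by blast
    moreover have "e \<in> out_arcs G (tail G e)" using e by simp
    ultimately show "head G e \<in> ?S" by blast
  qed
qed

text \<open>A nonempty walk from \<open>v\<close>, closed or not, continues in the tree of the range
  of its first edge, which is acyclic. This is how acyclicity passes from the line set to its
  saturated closure.\<close>

lemma saturated_acyclic: "saturated G {v \<in> verts G. acyclic_tree G v}"
  unfolding saturated_def acyclic_tree_iff
proof (intro conjI allI impI CollectI)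
  fix v p w q
  assume v: "regular_vertex G v \<and> head G ` out_arcs G v \<subseteq> {v \<in> verts G. \<forall>p w q. awalk v p w \<and> awalk w q w \<longrightarrow> q = []}"
  then show "v \<in> verts G" by (simp add: regular_vertex_def)
  have ac: "q = []" if "e \<in> arcs G" "tail G e = v" "awalk (head G e) p w" "awalk w q w" for e p w q
  proof -
    have "head G e \<in> head G ` out_arcs G v" using that by auto
    then show ?thesis using v that(3,4) by blast
  qed
  assume a: "awalk v p w \<and> awalk w q w"
  show "q = []"
  proof (cases p)
    case (Cons e p')
    then show ?thesis using a ac[of e p' w q] by (auto simp: awalk_Cons_iff)
  next
    case Nil
    then have q: "awalk v q v" "w = v" using a by (auto simp: awalk_Nil_iff)
    show ?thesis
    proof (cases q)
      case (Cons e q')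
      then have "awalk (head G e) q' v" "e \<in> arcs G" "tail G e = v" using q by (auto simp: awalk_Cons_iff)
      then show ?thesis using ac[of e q' v q] q by blast
    qed
  qed
qed auto

lemma line_set_hereditary: "hereditary G (line_set H)"
  unfolding hereditary_def
proof (intro ballI impI)
  fix e assume e: "e \<in> arcs G" "tail G e \<in> line_set H"
  have "tree_of G (head G e) \<subseteq> tree_of G (tail G e)"
    using e(1) by (auto simp: tree_of_iff) (metis awalk_Cons_iff)
  then show "head G e \<in> line_set H" using e by (auto simp: line_set_def acyclic_tree_def)
qed

text \<open>Heredity and acyclicity are part of the induction because
  \<open>rel_soc_lpa_ideal_of\<close> relies on them. Its hypothesis that the ideal contains no
  further vertex comes from the definition of \<open>P_l\<close>, once \<open>S n\<close> is known
  to be generated by \<open>P_l K G n\<close>.\<close>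

lemma Soc_series_lpa:
  fixes K :: "'k::field itself" and n
  assumes rf: "row_finite G"
  defines "S \<equiv> (\<lambda>n. {x \<in> FA (lpa_gens G). lpa_ideal G +>\<^bsub>lpa_free G\<^esub> x \<in>
      Soc_series (leavitt_path_algebra G :: ('k, _) module) n})"
  shows "S n = lpa_ideal_of G (P_l K G n) \<and> hereditary G (P_l K G n) \<and> saturated G (P_l K G n) \<and>
    (\<forall>v\<in>P_l K G n. acyclic_tree G v) \<and> P_l K G (Suc n) = saturated_closure G (line_set (P_l K G n))"
proof -
  have I: "fa_ideal (lpa_gens G) (lpa_ideal G :: (('a, 'b) lpa_gen list \<Rightarrow>\<^sub>0 'k) set)"
    unfolding lpa_ideal_eq by (rule lpa_ideal_of_ideal) simp
  have SS: "S 0 = lpa_ideal G" "S (Suc n) = rel_soc (lpa_gens G) (S n)" for n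
    unfolding S_def leavitt_path_algebra_def lpa_free_eq by (rule Soc_series_vimage[OF I])+
  have P: "P_l K G n = {v \<in> verts G. gen (Vertex v) \<in> S n}" for n
    by (auto simp: P_l_def S_def lpa_vertex_def)
  have next_P: "S (Suc n) = lpa_ideal_of G (saturated_closure G (line_set (P_l K G n))) \<and>
      P_l K G (Suc n) = saturated_closure G (line_set (P_l K G n)) \<and>
      hereditary G (saturated_closure G (line_set (P_l K G n))) \<and>
      saturated G (saturated_closure G (line_set (P_l K G n))) \<and>
      (\<forall>v\<in>saturated_closure G (line_set (P_l K G n)). acyclic_tree G v)"
    if Sn: "S n = lpa_ideal_of G (P_l K G n)" and her: "hereditary G (P_l K G n)"
      and ac: "\<forall>v\<in>P_l K G n. acyclic_tree G v" for n
  proof -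
    let ?L = "line_set (P_l K G n)" and ?C = "saturated_closure G (line_set (P_l K G n))"
    have L: "?L \<subseteq> verts G" by (auto simp: line_set_def)
    note C = saturated_closure[OF L]
    have Cv: "?C \<subseteq> verts G" using C(1) by (simp add: saturated_def)
    have her': "hereditary G ?C" by (rule saturated_closure_hereditary[OF L line_set_hereditary])
    have "rel_soc (lpa_gens G) (S n) = lpa_ideal_of G ?L"
      unfolding Sn using rf her ac
    proof (intro rel_soc_lpa_ideal_of)
      show "P_l K G n \<subseteq> verts G" by (auto simp: P_l_def)
      fix v assume "v \<in> verts G" "gen (Vertex v) \<in> (lpa_ideal_of G (P_l K G n) :: (('a, 'b) lpa_gen list \<Rightarrow>\<^sub>0 'k) set)"
      then have "v \<in> {v \<in> verts G. gen (Vertex v) \<in> S n}" by (simp add: Sn)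
      then show "v \<in> P_l K G n" unfolding P[of n] .
    qed auto
    then have 1: "S (Suc n) = lpa_ideal_of G ?L" by (simp only: SS(2))
    let ?I = "lpa_ideal_of G ?L :: (('a, 'b) lpa_gen list \<Rightarrow>\<^sub>0 'k) set"
    let ?I' = "lpa_ideal_of G ?C :: (('a, 'b) lpa_gen list \<Rightarrow>\<^sub>0 'k) set"
  have LI: "fa_ideal (lpa_gens G) ?I" "lpa_relations G \<subseteq> ?I"
    "\<And>v. v \<in> ?L \<Longrightarrow> gen (Vertex v) \<in> ?I" "graded ?I"
    by (rule lpa_ideal_of_ideal[OF L]; assumption?)+
  have CI: "fa_ideal (lpa_gens G) ?I'" "lpa_relations G \<subseteq> ?I'"
    "\<And>v. v \<in> ?C \<Longrightarrow> gen (Vertex v) \<in> ?I'" "graded ?I'"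
    by (rule lpa_ideal_of_ideal[OF Cv]; assumption?)+
    \<comment> \<open>The relation that expands regular vertices makes the set of vertices in this
      ideal saturated; hence \<open>?L\<close> and its closure generate the same ideal.\<close>
    let ?Y = "{v \<in> verts G. gen (Vertex v) \<in> (lpa_ideal_of G ?L :: (('a, 'b) lpa_gen list \<Rightarrow>\<^sub>0 'k) set)}"
    interpret lpa_quotient G "lpa_ideal_of G ?L :: (('a, 'b) lpa_gen list \<Rightarrow>\<^sub>0 'k) set"
      using rf LI by unfold_locales auto
    have "saturated G ?Y"
      unfolding saturated_def
    proof (intro conjI allI impI CollectI)
      fix v assume v: "regular_vertex G v \<and> head G ` out_arcs G v \<subseteq> ?Y"
      then show "v \<in> verts G" by (simp add: regular_vertex_def)
      have "Ed e * Gh e \<in> lpa_ideal_of G ?L" if "e \<in> out_arcs G v" for e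
      proof -
        have "head G e \<in> ?Y" using v that by blast
        then have e: "e \<in> arcs G" "V (head G e) \<in> lpa_ideal_of G ?L" using that by auto
        have "Ed e * V (head G e) \<in> lpa_ideal_of G ?L" using e by (intro Jc(5)) auto
        then have "Ed e \<in> lpa_ideal_of G ?L" using cg_mem[OF EV[OF e(1)]] by simp
        then show ?thesis using e(1) by (intro Jc(8)) auto
      qed
      then have "(\<Sum>e\<in>out_arcs G v. Ed e * Gh e) \<in> lpa_ideal_of G ?L"
        by (rule fa_left_ideal_sum[OF lJ])
      then show "V v \<in> lpa_ideal_of G ?L" using cg_mem[OF CK[of v]] v by simp
    qed auto
    moreover have "?L \<subseteq> ?Y" using LI(3) L by blast
    ultimately have "?C \<subseteq> ?Y" by (rule saturated_closure_least)
    then have "lpa_ideal_of G ?C \<subseteq> (lpa_ideal_of G ?L :: (('a, 'b) lpa_gen list \<Rightarrow>\<^sub>0 'k) set)"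
      using LI by (intro lpa_ideal_of_least) auto
    moreover have "lpa_ideal_of G ?L \<subseteq> (lpa_ideal_of G ?C :: (('a, 'b) lpa_gen list \<Rightarrow>\<^sub>0 'k) set)"
      using CI C(2) by (intro lpa_ideal_of_least) auto
    ultimately have 2: "S (Suc n) = lpa_ideal_of G ?C" using 1 by simp
    \<comment> \<open>By the representation, the ideal generated by \<open>?C\<close> contains no
      vertex beyond \<open>?C\<close>.\<close>
    have 3: "P_l K G (Suc n) = ?C"
      unfolding P[of "Suc n"] 2 using lpa_ideal_of_vertex[OF rf her' C(1)] CI(3) Cv by blast
    have "?C \<subseteq> {v \<in> verts G. acyclic_tree G v}"
      by (rule saturated_closure_least[OF saturated_acyclic]) (auto simp: line_set_def)
    then show ?thesis using 2 3 her' C(1) by blast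
  qed
  have "S n = lpa_ideal_of G (P_l K G n) \<and> hereditary G (P_l K G n) \<and> saturated G (P_l K G n) \<and>
    (\<forall>v\<in>P_l K G n. acyclic_tree G v)" for n
  proof (induction n)
    case 0
    \<comment> \<open>Index 0 is the zero ideal. The empty set is saturated since a regular vertex
      emits an edge, so the representation for \<open>Y = {}\<close> shows that no vertex is
      zero.\<close>
    have S0: "S 0 = lpa_ideal_of G {}" using SS(1) by (simp add: lpa_ideal_eq)
    have h: "hereditary G {}" "saturated G {}"
      by (auto simp: hereditary_def saturated_def regular_vertex_def)
    then have "P_l K G 0 = {}"
      unfolding P[of 0] S0 using lpa_ideal_of_vertex[OF rf h] by blast
    then show ?case using S0 h by simp
  next
    case (Suc n)
    then show ?case using next_P[of n] by simp
  qed
  then show ?thesis using next_P[of n] by blast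
qed

end

theorem theorem4p6:
  fixes E :: "('v, 'e) pre_digraph" and n :: nat
  assumes "wf_digraph E" and "row_finite E" and "n \<ge> 1"
  shows "P_l TYPE('k::field) E (n + 1) =
    saturated_closure E {v \<in> verts E. acyclic_tree E v \<and>
      (\<forall>w\<in>tree_of E v. ranges E w \<subseteq>\<^sup>1 P_l TYPE('k) E n)}"
proof -
  interpret wf_digraph E by (rule assms(1))
  show ?thesis
    using Soc_series_lpa[OF assms(2), where K = "TYPE('k)" and n = n] by (simp add: line_set_def)
qed

end
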